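(* Fix reals $p\ge1$ and $\gamma'\in[1,2^{1/p})$. Let $\varepsilon=(\gamma')^{-p}-1/2>0$ and $\gamma=\left\lceil\max\left(12/\varepsilon,\frac{1}{(1+\varepsilon/2)^{1/p}-1}\right)\right\rceil$. There is a randomized algorithm which, given positive integers $m$ and $k$, runs in time $\mathrm{poly}(m,k)$ and outputs, with probability at least $0.99$, a $(p,\alpha,d,N,m',n')$-locally dense lattice $(A,\mathbf{s})$ with $\alpha=\left(\frac{1}{(\gamma')^p}-\frac{2}{\gamma^p}\right)^{1/p}$, $d=\gamma k$, $N=(2m(1+\gamma k))^{3(\gamma k)^p}\ge10^5(2m(1+\gamma k))^{(\gamma k)^p}$, and $n',m'=\mathrm{poly}(m,k)$, provided $m$ is sufficiently large compared to $p$.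
   Context: $\mathcal{L}(A)=\{A\mathbf{x}:\mathbf{x}\in\mathbb{Z}^n\}$; $\lambda_1^{(p)}(\mathcal{L})$ is the $\ell_p$ norm of a shortest nonzero vector; $\mathcal{B}^{(p)}_m(r)=\{\mathbf{x}\in\mathbb{R}^m:\|\mathbf{x}\|_p\le r\}$. For $\alpha\in(0,1)$, $p\ge1$ and positive integers $d,N,m,n$, a $(p,\alpha,d,N,m,n)$-locally dense lattice is a pair $(A,\mathbf{s})$ with $A\in\mathbb{Z}^{m\times n}$, $\mathbf{s}\in\mathbb{Z}^m$, such that $\lambda_1^{(p)}(\mathcal{L}(A))>d$ and $|(\mathcal{L}(A)-\mathbf{s})\cap\mathcal{B}^{(p)}_m(\alpha d)|\ge N$.
   Formalization: For irrational p the randomized algorithm may query binary approximations of p (query i costs i plus the answer's length), since for uncomputable p no ordinary algorithm can exist; for rational p it is an ordinary randomized polynomial-time algorithm. *)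

theory Defs
  imports
    "HOL-Probability.Probability_Mass_Function"
    "HOL-Library.Log_Nat"
    "Jordan_Normal_Form.Matrix"
begin

section \<open>Locally dense lattices\<close>

definition lp_norm :: "real \<Rightarrow> real Matrix.vec \<Rightarrow> real" where
  "lp_norm p v = (\<Sum>i<dim_vec v. \<bar>vec_index v i\<bar> powr p) powr (1 / p)"

definition lp_ball :: "real \<Rightarrow> nat \<Rightarrow> real \<Rightarrow> real Matrix.vec set" where
  "lp_ball p m r = {x \<in> carrier_vec m. lp_norm p x \<le> r}"

text \<open>The columns of the matrix generate the lattice; they need not be linearly independent.\<close>

definition lattice :: "int mat \<Rightarrow> int Matrix.vec set" where
  "lattice A = {A *\<^sub>v x | x. x \<in> carrier_vec (dim_col A)}"

abbreviation real_vec :: "int Matrix.vec \<Rightarrow> real Matrix.vec" where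
  "real_vec \<equiv> map_vec real_of_int"

text \<open>
  For a set of integer vectors the infimum is attained, provided that there is a nonzero vector.
  For the zero lattice the value is the unspecified \<open>Inf {}\<close>; this case never matters for
  \<open>locally_dense\<close> with \<open>N > 1\<close>, because the zero lattice has only one coset point.
\<close>

definition lambda1 :: "real \<Rightarrow> int Matrix.vec set \<Rightarrow> real" where
  "lambda1 p L = Inf {lp_norm p (real_vec v) | v. v \<in> L \<and> v \<noteq> 0\<^sub>v (dim_vec v)}"

text \<open>
  The bound \<open>N\<close> is a real number, since the bounds of interest, such as
  \<open>(2m(1 + \<gamma>k)) powr (3(\<gamma>k) powr p)\<close>, need not be integers. As it is compared with a
  cardinality, it may equivalently be rounded up to a positive integer.
\<close>

definition locally_dense ::
  "real \<Rightarrow> real \<Rightarrow> nat \<Rightarrow> real \<Rightarrow> nat \<Rightarrow> nat \<Rightarrow> int mat \<times> int Matrix.vec \<Rightarrow> bool" where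
  "locally_dense p \<alpha> d N m n = (\<lambda>(A, s).
     1 \<le> p \<and> 0 < \<alpha> \<and> \<alpha> < 1 \<and> 0 < d \<and> 0 < N \<and> 0 < m \<and> 0 < n \<and>
     A \<in> carrier_mat m n \<and> s \<in> carrier_vec m \<and>
     lambda1 p (lattice A) > real d \<and>
     real (card ((\<lambda>v. real_vec (v - s)) ` lattice A \<inter> lp_ball p m (\<alpha> * real d))) \<ge> N)"


section \<open>Randomized algorithms with logarithmic cost\<close>

text \<open>
  Programs are those of a random access machine with logarithmic cost, written as a while
  language over integer variables and integer arrays: every value that is computed, and every
  array index that is used, is charged its bit length. Up to polynomial factors this is the
  running time of a Turing machine, all primitive operations being polynomial-time in the lengths
  of their operands.

  \<open>Flip\<close> reads the next bit of the random string. \<open>Query\<close> asks for the value of an oracle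
  \<open>nat \<Rightarrow> int\<close>; the query \<open>i\<close> is charged as if \<open>i\<close> were written in unary.
\<close>

datatype aexp =
    Const int
  | Var string
  | Elem string aexp
  | Add aexp aexp
  | Sub aexp aexp
  | Mul aexp aexp
  | Div aexp aexp
  | Mod aexp aexp

datatype bexp =
    Less aexp aexp
  | Not bexp
  | And bexp bexp

datatype com =
    Skip
  | Assign string aexp
  | Store string aexp aexp
  | Flip string
  | Query string aexp
  | Seq com com
  | If bexp com com
  | While bexp com

record state =
  scal :: "string \<Rightarrow> int"
  arr :: "string \<Rightarrow> int \<Rightarrow> int"
  coins :: "bool list"

fun aval :: "aexp \<Rightarrow> state \<Rightarrow> int" where
  "aval (Const c) \<sigma> = c"
| "aval (Var x) \<sigma> = scal \<sigma> x"
| "aval (Elem a e) \<sigma> = arr \<sigma> a (aval e \<sigma>)"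
| "aval (Add e f) \<sigma> = aval e \<sigma> + aval f \<sigma>"
| "aval (Sub e f) \<sigma> = aval e \<sigma> - aval f \<sigma>"
| "aval (Mul e f) \<sigma> = aval e \<sigma> * aval f \<sigma>"
| "aval (Div e f) \<sigma> = aval e \<sigma> div aval f \<sigma>"
| "aval (Mod e f) \<sigma> = aval e \<sigma> mod aval f \<sigma>"

fun bval :: "bexp \<Rightarrow> state \<Rightarrow> bool" where
  "bval (Less e f) \<sigma> = (aval e \<sigma> < aval f \<sigma>)"
| "bval (Not b) \<sigma> = (\<not> bval b \<sigma>)"
| "bval (And b c) \<sigma> = (bval b \<sigma> \<and> bval c \<sigma>)"

definition int_cost :: "int \<Rightarrow> nat" where
  "int_cost v = 1 + nat (bitlen \<bar>v\<bar>)"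

fun subexp_cost :: "aexp \<Rightarrow> state \<Rightarrow> nat" and acost :: "aexp \<Rightarrow> state \<Rightarrow> nat" where
  "subexp_cost (Const c) \<sigma> = 0"
| "subexp_cost (Var x) \<sigma> = 0"
| "subexp_cost (Elem a e) \<sigma> = acost e \<sigma>"
| "subexp_cost (Add e f) \<sigma> = acost e \<sigma> + acost f \<sigma>"
| "subexp_cost (Sub e f) \<sigma> = acost e \<sigma> + acost f \<sigma>"
| "subexp_cost (Mul e f) \<sigma> = acost e \<sigma> + acost f \<sigma>"
| "subexp_cost (Div e f) \<sigma> = acost e \<sigma> + acost f \<sigma>"
| "subexp_cost (Mod e f) \<sigma> = acost e \<sigma> + acost f \<sigma>"
| "acost e \<sigma> = int_cost (aval e \<sigma>) + subexp_cost e \<sigma>"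

fun bcost :: "bexp \<Rightarrow> state \<Rightarrow> nat" where
  "bcost (Less e f) \<sigma> = 1 + acost e \<sigma> + acost f \<sigma>"
| "bcost (Not b) \<sigma> = 1 + bcost b \<sigma>"
| "bcost (And b c) \<sigma> = 1 + bcost b \<sigma> + bcost c \<sigma>"

text \<open>
  \<open>exec Q c \<sigma> t \<tau>\<close>: with oracle \<open>Q\<close>, the program \<open>c\<close> started in \<open>\<sigma>\<close> halts in \<open>\<tau>\<close> after time \<open>t\<close>.
  A program that wants to flip a coin when the random string is used up does not halt.
\<close>

inductive exec :: "(nat \<Rightarrow> int) \<Rightarrow> com \<Rightarrow> state \<Rightarrow> nat \<Rightarrow> state \<Rightarrow> bool" for Q where
  Skip: "exec Q Skip \<sigma> 1 \<sigma>"
| Assign: "exec Q (Assign x e) \<sigma> (1 + acost e \<sigma>) (\<sigma>\<lparr>scal := (scal \<sigma>)(x := aval e \<sigma>)\<rparr>)"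
| Store: "exec Q (Store a e f) \<sigma> (1 + acost e \<sigma> + acost f \<sigma>)
    (\<sigma>\<lparr>arr := (arr \<sigma>)(a := (arr \<sigma> a)(aval e \<sigma> := aval f \<sigma>))\<rparr>)"
| Flip: "coins \<sigma> = b # bs \<Longrightarrow>
    exec Q (Flip x) \<sigma> 1 (\<sigma>\<lparr>scal := (scal \<sigma>)(x := of_bool b), coins := bs\<rparr>)"
| Query: "i = nat (aval e \<sigma>) \<Longrightarrow>
    exec Q (Query x e) \<sigma> (1 + acost e \<sigma> + i + int_cost (Q i)) (\<sigma>\<lparr>scal := (scal \<sigma>)(x := Q i)\<rparr>)"
| Seq: "exec Q c \<sigma> t \<tau> \<Longrightarrow> exec Q c' \<tau> t' \<tau>' \<Longrightarrow> exec Q (Seq c c') \<sigma> (t + t') \<tau>'"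
| If_True: "bval b \<sigma> \<Longrightarrow> exec Q c \<sigma> t \<tau> \<Longrightarrow> exec Q (If b c c') \<sigma> (bcost b \<sigma> + t) \<tau>"
| If_False: "\<not> bval b \<sigma> \<Longrightarrow> exec Q c' \<sigma> t \<tau> \<Longrightarrow> exec Q (If b c c') \<sigma> (bcost b \<sigma> + t) \<tau>"
| While_False: "\<not> bval b \<sigma> \<Longrightarrow> exec Q (While b c) \<sigma> (bcost b \<sigma>) \<sigma>"
| While_True: "bval b \<sigma> \<Longrightarrow> exec Q c \<sigma> t \<tau> \<Longrightarrow> exec Q (While b c) \<tau> t' \<tau>' \<Longrightarrow>
    exec Q (While b c) \<sigma> (bcost b \<sigma> + t + t') \<tau>'"

primrec oracle_free :: "com \<Rightarrow> bool" where
  "oracle_free Skip = True"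
| "oracle_free (Assign x e) = True"
| "oracle_free (Store a e f) = True"
| "oracle_free (Flip x) = True"
| "oracle_free (Query x e) = False"
| "oracle_free (Seq c d) = (oracle_free c \<and> oracle_free d)"
| "oracle_free (If b c d) = (oracle_free c \<and> oracle_free d)"
| "oracle_free (While b c) = oracle_free c"

text \<open>
  An algorithm whose description involves an arbitrary real constant has access to the binary
  expansion of that constant.
\<close>

definition dyadic_approx :: "real \<Rightarrow> nat \<Rightarrow> int" where
  "dyadic_approx x i = \<lfloor>2 ^ i * x\<rfloor>"

definition start :: "nat \<Rightarrow> nat \<Rightarrow> bool list \<Rightarrow> state" where
  "start m k \<omega> =
     \<lparr>scal = (\<lambda>_. 0)(''m'' := int m, ''k'' := int k), arr = (\<lambda>_ _. 0), coins = \<omega>\<rparr>"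

text \<open>The output matrix is stored row by row in the array \<open>A\<close>.\<close>

definition result :: "state \<Rightarrow> int mat \<times> int Matrix.vec" where
  "result \<sigma> = (let r = nat (scal \<sigma> ''rows''); c = nat (scal \<sigma> ''cols'') in
     (mat r c (\<lambda>(i, j). arr \<sigma> ''A'' (int (i * c + j))), Matrix.vec r (\<lambda>i. arr \<sigma> ''s'' (int i))))"

definition coin_strings :: "nat \<Rightarrow> bool list pmf" where
  "coin_strings T = pmf_of_set {\<omega>. length \<omega> = T}"

text \<open>
  The time bound is a worst-case bound, for all outcomes of the coin flips. Since a coin flip takes
  time 1, \<open>T\<close> random bits are always enough for a program with running time at most \<open>T\<close>.
\<close>

definition halts_within :: "(nat \<Rightarrow> int) \<Rightarrow> com \<Rightarrow> nat \<Rightarrow> nat \<Rightarrow> nat \<Rightarrow> bool" where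
  "halts_within Q c T m k \<longleftrightarrow>
     (\<forall>\<omega>. length \<omega> = T \<longrightarrow> (\<exists>t \<tau>. t \<le> T \<and> exec Q c (start m k \<omega>) t \<tau>))"

definition success_prob ::
  "(nat \<Rightarrow> int) \<Rightarrow> com \<Rightarrow> nat \<Rightarrow> nat \<Rightarrow> nat \<Rightarrow> (int mat \<times> int Matrix.vec \<Rightarrow> bool) \<Rightarrow> real" where
  "success_prob Q c T m k good =
     measure_pmf.prob (coin_strings T) {\<omega>. \<exists>t \<tau>. exec Q c (start m k \<omega>) t \<tau> \<and> good (result \<tau>)}"

definition poly_bounded :: "(nat \<Rightarrow> nat \<Rightarrow> nat) \<Rightarrow> bool" where
  "poly_bounded f \<longleftrightarrow> (\<exists>C. \<forall>m k. f m k \<le> C * (m + k + 1) ^ C)"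

end

theory Submission
  imports
    Defs
    "HOL-Computational_Algebra.Primes"
    "HOL-Computational_Algebra.Polynomial"
    "HOL-Library.Multiset"
begin

text \<open>
  Let \<open>D = (\<gamma>k)\<^sup>p\<close>, \<open>K \<approx> D / 2\<close>, and let \<open>q \<ge> 2K\<close> be a prime. An integer vector \<open>x \<noteq> 0\<close> of length at most \<open>q\<close> with
  \<open>\<Sum>\<^sub>j x\<^sub>j j\<^sup>r \<equiv> 0 (mod q)\<close> for all \<open>r < K\<close> has \<open>\<ell>\<^sub>1\<close> norm at least \<open>2K > D\<close>: this is the Newton
  identities, applied to the positive and the negative part of \<open>x\<close>. As \<open>\<bar>x\<^sub>j\<bar> \<le> \<bar>x\<^sub>j\<bar>\<^sup>p\<close> for integers, its
  \<open>\<ell>\<^sub>p\<close> norm exceeds \<open>\<gamma>k\<close>. No kernel basis is computed; instead the syndrome is appended to \<open>x\<close> with a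
  weight larger than \<open>\<gamma>k\<close>.

  There are only \<open>q\<^sup>K\<close> syndromes, but \<open>2\<^sup>a\<^sup>h\<close> binary vectors with exactly one unit in each of \<open>h\<close> blocks
  of length \<open>2\<^sup>a\<close>. For \<open>h\<close> slightly larger than \<open>K\<close>, still at most \<open>\<alpha>\<^sup>p D\<close>, and \<open>q\<close> not much larger
  than \<open>2\<^sup>a\<close>, the syndrome of a random such vector is shared by many others with high probability. The prime
  exists by Chebyshev's lower bound, proved through the least common multiple of \<open>1, \<dots>, n\<close>.
\<close>

section \<open>Primes in short intervals\<close>

text \<open>The bound \<open>2 powr (1 / p)\<close> on \<gamma>' is a ratio of two counts. Position
  sets of size h outnumber the q^K syndromes only if h exceeds K, and a 0/1 vector with h units has
  h as the p-th power of its norm, against 2K for lattice vectors. So \<alpha>^p can approach 1/2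
  but not pass it. The Hamming distance for the same check matrix is only K + 1, which would leave
  no \<alpha> below 1; the factor 2 comes from multiplicities and signs, since K power sums
  determine a multiset with fewer than K elements.

  Newton's identities divide by 1, ..., e. Modulo q this needs e < q; a Wronskian of two root
  polynomials takes the place of the division.

  The slack \<epsilon> is spent on three things: approximating and rounding D, the surplus of h over
  K (about K\<epsilon>/2), and the term 2/\<gamma>^p. The surplus has to pay both for N and for the
  gap between q and the block length 2^a. It gains about a K/w bits with w about 2/\<epsilon>, while
  the gap costs cLK bits, where 2^L is about 2m(1 + \<gamma>k). Hence a is taken to be a large
  multiple of cL.\<close>

text \<open>With \<open>T(n, k) = (n + 1) (n choose k)\<close> (Leibniz's harmonic triangle),
  \<open>1 / T(n + 1, k + 1) = 1 / T(n, k) - 1 / T(n + 1, k)\<close>, so every common multiple of the two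
  entries on the right is a multiple of the entry on the left.\<close>

lemma leibniz_triangle:
  assumes "k \<le> n"
  shows "1 / real (Suc (Suc n) * (Suc n choose Suc k)) + 1 / real (Suc (Suc n) * (Suc n choose k))
    = 1 / real (Suc n * (n choose k))"
proof -
  have a: "real (Suc k) * real (Suc n choose Suc k) = real (Suc n) * real (n choose k)"
    unfolding of_nat_mult[symmetric] using Suc_times_binomial_eq[of n k] by (simp only: mult.commute)
  have b: "real (Suc n - k) * real (Suc n choose k) = real (Suc n) * real (n choose k)"
    unfolding of_nat_mult[symmetric] using binomial_absorb_comp[of "Suc n" k] by (simp only: diff_Suc_1)
  define N where "N = real (n choose k)"
  have N: "N > 0" unfolding N_def using assms by simp
  have e1: "real (Suc n choose Suc k) = real (Suc n) * N / real (Suc k)"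
    using a by (simp add: N_def field_simps del: of_nat_Suc binomial_Suc_Suc)
  have pos: "real (Suc n - k) > 0" using assms by simp
  have e2: "real (Suc n choose k) = real (Suc n) * N / real (Suc n - k)"
    using b pos unfolding N_def by (metis nonzero_mult_div_cancel_left less_numeral_extra(3))
  have s: "real (Suc k) + real (Suc n - k) = real (Suc (Suc n))" using assms by simp
  show ?thesis
    unfolding of_nat_mult e1 e2 N_def[symmetric] using N pos s
    by (simp add: divide_simps del: of_nat_Suc)
qed

lemma leibniz_dvd_common_multiple:
  assumes "k \<le> n" "\<And>i. 1 \<le> i \<Longrightarrow> i \<le> Suc n \<Longrightarrow> i dvd (l :: nat)"
  shows "Suc n * (n choose k) dvd l"
  using assms
proof (induction k arbitrary: n)
  case 0
  then show ?case by simp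
next
  case (Suc k)
  then obtain n' where n: "n = Suc n'" and k: "k \<le> n'" by (cases n) auto
  define a b c where "a = Suc n' * (n' choose k)" and "b = Suc n * (n choose k)"
    and "c = Suc n * (n choose Suc k)"
  have "a dvd l" unfolding a_def using Suc.prems n k by (intro Suc.IH) auto
  moreover have "b dvd l" unfolding b_def using Suc.prems n k by (intro Suc.IH) auto
  ultimately obtain x y where x: "l = a * x" and y: "l = b * y" unfolding dvd_def by blast
  have "1 / real c + 1 / real b = 1 / real a"
    unfolding a_def b_def c_def n by (rule leibniz_triangle[OF k])
  moreover have pos: "a > 0" "b > 0" "c > 0"
    unfolding a_def b_def c_def n using k by (auto simp del: binomial_Suc_Suc simp: zero_less_binomial_iff)
  ultimately have "real l / real c = real l / real a - real l / real b"
    by (metis add_diff_cancel_right' mult.right_neutral right_diff_distrib times_divide_eq_right)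
  also have "\<dots> = real x - real y" using pos x y
    by (metis nonzero_mult_div_cancel_left of_nat_0_less_iff of_nat_mult order_less_irrefl)
  finally have "real l = real c * (real x - real y)" using pos by (simp add: field_simps)
  \<comment> \<open>The cofactor \<open>x - y\<close> is an integer whose sign is not known at this
    point, hence the detour through \<open>int\<close>.\<close>
  then have "real_of_int (int l) = real_of_int (int c * (int x - int y))" by simp
  then have "int l = int c * (int x - int y)" by (simp only: of_int_eq_iff)
  then have "c dvd l" by (metis dvd_triv_left int_dvd_int_iff)
  then show ?case by (simp only: c_def)
qed

text \<open>All n + 1 numbers \<open>Suc n * (n choose k)\<close> divide the lcm, and their average
  is \<open>2 ^ n\<close>.\<close>

lemma Lcm_lower_bound: "2 ^ n \<le> Lcm {1..Suc n}"
proof -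
  define l where "l = Lcm {1..Suc n}"
  have dvd: "i dvd l" if "1 \<le> i" "i \<le> Suc n" for i using that by (auto simp: l_def)
  have "l > 0" unfolding l_def using Lcm_0_iff[of "{1..Suc n}"] by fastforce
  have "Suc n * (n choose k) \<le> l" if "k \<le> n" for k
    using leibniz_dvd_common_multiple[OF that dvd] \<open>l > 0\<close> by (simp add: dvd_imp_le)
  then have "(\<Sum>k\<le>n. Suc n * (n choose k)) \<le> (\<Sum>k\<le>n. l)" by (intro sum_mono) auto
  then have "Suc n * 2 ^ n \<le> Suc n * l"
    by (simp add: sum_distrib_left[symmetric] choose_row_sum del: mult_Suc)
  then show ?thesis unfolding l_def by (metis Suc_mult_le_cancel1)
qed

text \<open>The power of each prime in the lcm is itself at most n, so the lcm is a product of at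
  most \<pi>(n) factors bounded by n.\<close>

lemma Lcm_upper_bound:
  fixes n :: nat
  assumes "n \<ge> 1"
  shows "Lcm {1..n} \<le> n ^ card {p. prime p \<and> p \<le> n}"
proof -
  define S where "S = {p. prime p \<and> p \<le> n}"
  have fin: "finite S" unfolding S_def by (rule finite_subset[of _ "{..n}"]) auto
  define l where "l = Lcm {1..n}"
  have l0: "l \<noteq> 0" unfolding l_def using Lcm_0_iff[of "{1..n}"] by fastforce
  have pf: "prime_factors l \<subseteq> S"
  proof
    fix p assume "p \<in> prime_factors l"
    then have p: "prime p" "p dvd l" by auto
    have "l dvd \<Prod>{1..n}" unfolding l_def by (rule Lcm_least) (auto intro: dvd_prodI)
    then have "p dvd \<Prod>{1..n}" using p dvd_trans by blast
    then obtain i where "i \<in> {1..n}" "p dvd i" using p by (metis finite_atLeastAtMost prime_dvd_prod_iff)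
    then show "p \<in> S" using p by (auto simp: S_def dest: dvd_imp_le)
  qed
  have mult: "p ^ multiplicity p l \<le> n" if p: "prime p" for p
  proof (rule ccontr)
    assume gt: "\<not> p ^ multiplicity p l \<le> n"
    define e where "e = multiplicity p l"
    have e1: "e \<ge> 1" using gt assms by (cases e) (auto simp: e_def)
    obtain r where r: "l = p ^ e * r" using multiplicity_dvd[of p l] by (auto simp: e_def dvd_def)
    have "l dvd p ^ (e - 1) * r" unfolding l_def
    proof (rule Lcm_least)
      fix i assume "i \<in> {1..n}"
      then have i: "i dvd l" "i > 0" "i \<le> n" by (auto simp: l_def)
      obtain j where j: "i = p ^ multiplicity p i * j" "\<not> p dvd j"
        using i p by (metis multiplicity_decompose' not_prime_unit less_numeral_extra(3))
      have "p ^ multiplicity p i \<le> i" using i(2) multiplicity_dvd[of p i] by (simp add: dvd_imp_le)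
      then have "p ^ multiplicity p i < p ^ e" using gt i by (auto simp: e_def)
      then have lt: "multiplicity p i < e" using p prime_gt_1_nat power_less_imp_less_exp by blast
      have "j dvd l" using i j by (metis dvd_mult_right)
      moreover have "coprime j (p ^ e)"
        using j p by (metis coprime_commute coprime_power_left_iff prime_imp_coprime_nat)
      ultimately have "j dvd r" using r by (metis coprime_dvd_mult_right_iff)
      moreover have "p ^ multiplicity p i dvd p ^ (e - 1)" using lt by (intro le_imp_power_dvd) auto
      ultimately show "i dvd p ^ (e - 1) * r" using j(1) by (metis mult_dvd_mono)
    qed
    moreover have "r > 0" using r l0 by (cases r) auto
    moreover have "p > 1" using p prime_gt_1_nat by blast
    ultimately have "p ^ e * r \<le> p ^ (e - 1) * r" using r by (simp add: dvd_imp_le)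
    then have "p ^ e \<le> p ^ (e - 1)" using \<open>r > 0\<close> by simp
    then show False using \<open>p > 1\<close> e1 power_strict_increasing[of "e - 1" e p] by linarith
  qed
  have "l = (\<Prod>p\<in>prime_factors l. p ^ multiplicity p l)"
    using prod_prime_factors[of l] l0 by simp
  also have "\<dots> \<le> (\<Prod>p\<in>prime_factors l. n)" using mult by (intro prod_mono) auto
  also have "\<dots> = n ^ card (prime_factors l)" by simp
  also have "\<dots> \<le> n ^ card S" using assms pf fin by (intro power_increasing card_mono) auto
  finally show ?thesis unfolding l_def S_def .
qed

text \<open>Otherwise there would be at most n primes up to \<open>2 ^ j\<close>, and the two bounds
  on the lcm would give \<open>2 ^ (2 ^ j - 1) \<le> 2 ^ (j * n)\<close>. A power of 2 as the upper
  end keeps the logarithm exact.\<close>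

lemma prime_between_power2:
  assumes "Suc (j * n) < 2 ^ j"
  shows "\<exists>q::nat. prime q \<and> n < q \<and> q \<le> 2 ^ j"
proof (rule ccontr)
  assume H: "\<not> ?thesis"
  have "{p. prime p \<and> p \<le> 2 ^ j} \<subseteq> {1..n}"
  proof
    fix p :: nat assume "p \<in> {p. prime p \<and> p \<le> 2 ^ j}"
    then have "prime p" "p \<le> 2 ^ j" by auto
    then show "p \<in> {1..n}" using H prime_ge_1_nat[of p] by (meson atLeastAtMost_iff not_le)
  qed
  then have c: "card {p. prime p \<and> p \<le> (2::nat) ^ j} \<le> n"
    by (metis card_atLeastAtMost card_mono diff_Suc_1 finite_atLeastAtMost)
  have "(2::nat) ^ (2 ^ j - 1) \<le> Lcm {1..Suc (2 ^ j - 1)}" by (rule Lcm_lower_bound)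
  also have "\<dots> = Lcm {1..2 ^ j}" by simp
  also have "\<dots> \<le> (2 ^ j) ^ card {p. prime p \<and> p \<le> (2::nat) ^ j}" by (rule Lcm_upper_bound) simp
  also have "\<dots> \<le> (2 ^ j) ^ n" using c by (intro power_increasing) auto
  also have "\<dots> = 2 ^ (j * n)" by (simp add: power_mult)
  finally have "2 ^ j - 1 \<le> j * n" by simp
  then show False using assms by linarith
qed

section \<open>Integer vectors with vanishing power sums\<close>

definition root_poly :: "int multiset \<Rightarrow> int poly" where
  "root_poly M = (\<Prod>a\<in>#M. [:- a, 1:])"

definition power_sum :: "int multiset \<Rightarrow> nat \<Rightarrow> int" where
  "power_sum M j = (\<Sum>a\<in>#M. a ^ j)"

text \<open>The logarithmic derivative U'/U of the root polynomial is the series of all p_j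
  X^(-j-1), with p_j the power sums. This is its truncation to j < K, multiplied by X^K to become a
  polynomial: the sum of p_j X^(K-1-j).\<close>

primrec power_sum_poly :: "nat \<Rightarrow> int multiset \<Rightarrow> int poly" where
  "power_sum_poly 0 M = 0"
| "power_sum_poly (Suc K) M = pCons (power_sum M K) (power_sum_poly K M)"

lemma power_sum_poly_add: "power_sum_poly K (add_mset a M) = power_sum_poly K {#a#} + power_sum_poly K M"
  by (induction K) (auto simp: power_sum_def)

text \<open>Geometric sum: the quotient of X^K - a^K by X - a.\<close>

lemma power_sum_poly_single: "monom 1 K = [:- a, 1:] * power_sum_poly K {#a#} + [:a ^ K:]"
proof (induction K)
  case 0
  then show ?case by (simp add: one_pCons)
next
  case (Suc K)
  have "monom 1 (Suc K) = pCons 0 (monom 1 K :: int poly)" by (simp add: monom_Suc)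
  also have "\<dots> = pCons 0 ([:- a, 1:] * power_sum_poly K {#a#} + [:a ^ K:])" by (simp only: Suc.IH)
  also have "\<dots> = [:- a, 1:] * power_sum_poly (Suc K) {#a#} + [:a ^ Suc K:]"
    by (simp add: power_sum_def algebra_simps)
  finally show ?case .
qed

lemma root_poly_monic: "degree (root_poly M) = size M \<and> lead_coeff (root_poly M) = 1"
proof (induction M)
  case empty
  then show ?case by (simp add: root_poly_def)
next
  case (add a M)
  have eq: "root_poly (add_mset a M) = [:- a, 1:] * root_poly M" by (simp add: root_poly_def)
  from add have "root_poly M \<noteq> 0" by auto
  then have "degree (root_poly (add_mset a M)) = Suc (size M)"
    unfolding eq using add by (subst degree_mult_eq) auto
  moreover have "lead_coeff (root_poly (add_mset a M)) = 1"
  proof -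
    have "lead_coeff [:- a, 1:] = 1" by simp
    then show ?thesis unfolding eq lead_coeff_mult using add by (metis mult.left_neutral)
  qed
  ultimately show ?case by simp
qed

lemma poly_root_poly: "poly (root_poly M) x = (\<Prod>a\<in>#M. x - a)"
  by (induction M) (auto simp: root_poly_def algebra_simps)

text \<open>The logarithmic derivative is the generating function of the power sums.\<close>

lemma pderiv_root_poly:
  "\<exists>R. (\<forall>i\<ge>size M. coeff R i = 0) \<and>
    monom 1 K * pderiv (root_poly M) = root_poly M * power_sum_poly K M + R"
proof (induction M)
  case empty
  have "power_sum_poly K {#} = 0" by (induction K) (auto simp: power_sum_def)
  then show ?case by (intro exI[of _ 0]) (simp add: root_poly_def)
next
  case (add a M)
  define U where "U = root_poly M"
  define S where "S = power_sum_poly K M"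
  define S1 where "S1 = power_sum_poly K {#a#}"
  define R1 where "R1 = [:a ^ K:]"
  define l where "l = [:- a, 1::int:]"
  from add obtain R where R: "\<forall>i\<ge>size M. coeff R i = 0"
    and eq: "monom 1 K * pderiv U = U * S + R" by (auto simp: U_def S_def)
  have dU: "coeff U i = 0" if "i > size M" for i
    using root_poly_monic[of M] that unfolding U_def by (simp add: coeff_eq_0)
  have X: "monom 1 K = l * S1 + R1" unfolding l_def S1_def R1_def by (rule power_sum_poly_single)
  have dl: "pderiv l = 1" by (simp add: l_def pderiv_pCons)
  have "root_poly (add_mset a M) = l * U" by (simp add: root_poly_def U_def l_def)
  moreover have "power_sum_poly K (add_mset a M) = S1 + S"
    unfolding S_def S1_def by (rule power_sum_poly_add)
  moreover have "monom 1 K * pderiv (l * U) = l * U * (S1 + S) + (R1 * U + l * R)"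
  proof -
    have "monom 1 K * pderiv (l * U) = l * (monom 1 K * pderiv U) + monom 1 K * U"
      by (simp add: pderiv_mult dl algebra_simps)
    also have "\<dots> = l * (U * S + R) + monom 1 K * U" by (simp only: eq)
    also have "\<dots> = l * (U * S + R) + (l * S1 + R1) * U" by (simp only: X)
    finally show ?thesis by (simp add: algebra_simps)
  qed
  \<comment> \<open>Multiplication by l raises the degree of R by one and \<open>R1\<close> is
    constant, so the new remainder stays below the new size.\<close>
  moreover have "coeff (R1 * U + l * R) i = 0" if "i \<ge> Suc (size M)" for i
    using that R dU by (cases i) (auto simp: R1_def l_def coeff_pCons)
  ultimately show ?case by (intro exI[of _ "R1 * U + l * R"]) auto
qed

section \<open>Wronskians of monic polynomials modulo q\<close>

lemma coeff_mult_top: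
  fixes A B :: "'a :: comm_semiring_0 poly"
  assumes "\<And>i. i > a \<Longrightarrow> coeff A i = 0" "\<And>i. i > b \<Longrightarrow> coeff B i = 0"
  shows "coeff (A * B) (a + b) = coeff A a * coeff B b"
proof -
  have "coeff (A * B) (a + b) = (\<Sum>i\<le>a + b. coeff A i * coeff B (a + b - i))" by (rule coeff_mult)
  also have "\<dots> = (\<Sum>i\<in>{a}. coeff A i * coeff B (a + b - i))"
  proof (rule sum.mono_neutral_right)
    show "\<forall>i\<in>{..a + b} - {a}. coeff A i * coeff B (a + b - i) = 0"
    proof
      fix i assume i: "i \<in> {..a + b} - {a}"
      show "coeff A i * coeff B (a + b - i) = 0"
      proof (cases "i > a")
        case True
        then show ?thesis using assms(1) by simp
      next
        case False
        then have "a + b - i > b" using i by auto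
        then show ?thesis using assms(2) by simp
      qed
    qed
  qed auto
  finally show ?thesis by simp
qed

text \<open>Degree bounds are expressed by vanishing coefficients, so that zero or unexpectedly
  short factors need no case distinction.\<close>

lemma coeff_mult_above:
  fixes A B :: "'a :: comm_semiring_0 poly"
  assumes "\<And>i. i \<ge> a \<Longrightarrow> coeff A i = 0" "\<And>i. i > b \<Longrightarrow> coeff B i = 0" "i \<ge> a + b"
  shows "coeff (A * B) i = 0"
proof -
  have "coeff A j * coeff B (i - j) = 0" if "j \<le> i" for j
    using assms that by (cases "j \<ge> a") auto
  then show ?thesis by (simp add: coeff_mult)
qed

text \<open>The leading coefficient of the Wronskian \<open>(U - V)' V - (U - V) V'\<close> modulo \<open>q\<close> is the leading
  coefficient of \<open>U - V\<close> times a difference of degrees, which is invertible modulo \<open>q\<close>.\<close>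

lemma wronskian_coeff:
  fixes U V :: "int poly" and q :: int
  assumes q: "prime q" "int e < q"
    and U: "\<And>i. i > e \<Longrightarrow> coeff U i = 0" "coeff U e = 1"
    and V: "\<And>i. i > e \<Longrightarrow> coeff V i = 0" "coeff V e = 1"
    and neq: "\<not> q dvd coeff (U - V) i"
  obtains g where "\<not> q dvd coeff (pCons 0 (pderiv U * V - U * pderiv V)) (g + e)"
proof -
  define P where "P = U - V"
  \<comment> \<open>\<open>Max I\<close> is the degree of U - V modulo q; it lies below e because
    both polynomials have leading coefficient 1 at e.\<close>
  define I where "I = {i. \<not> q dvd coeff P i}"
  have sub: "I \<subseteq> {..<e}"
  proof
    fix i assume "i \<in> I"
    then have "coeff P i \<noteq> 0" by (auto simp: I_def)
    then have "i \<noteq> e" using U V by (auto simp: P_def)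
    moreover have "i \<le> e"
    proof (rule ccontr)
      assume "\<not> i \<le> e"
      then show False using U(1)[of i] V(1)[of i] \<open>coeff P i \<noteq> 0\<close> by (simp add: P_def)
    qed
    ultimately show "i \<in> {..<e}" by simp
  qed
  then have fin: "finite I" using finite_subset by blast
  have ne: "I \<noteq> {}" using neq by (auto simp: I_def P_def)
  define g where "g = Max I"
  have gI: "g \<in> I" unfolding g_def using fin ne by (rule Max_in)
  have ge: "g < e" using gI sub by auto
  have above: "q dvd coeff P i" if "i > g" for i
    using that Max_ge[OF fin, of i] unfolding g_def I_def by force
  \<comment> \<open>Modulo q only the coefficients up to g count; cutting off the rest makes g an
    honest degree bound, at the price of a multiple of q.\<close>
  define P1 where "P1 = poly_cutoff (Suc g) P"
  have P1: "coeff P1 i = (if i \<le> g then coeff P i else 0)" for i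
    by (simp add: P1_def coeff_poly_cutoff less_Suc_eq_le)
  have "[:q:] dvd P - P1"
    unfolding const_poly_dvd_iff using above P1 by auto
  then obtain P2 where P2: "P = P1 + [:q:] * P2" by (metis add.commute diff_eq_eq dvdE)
  have W: "pderiv U * V - U * pderiv V = pderiv P * V - P * pderiv V"
    by (simp add: P_def pderiv_diff algebra_simps)
  have dP: "pderiv P = pderiv P1 + [:q:] * pderiv P2"
    by (simp add: P2 pderiv_add pderiv_smult)
  have X: "pCons 0 (pderiv U * V - U * pderiv V) = pCons 0 (pderiv P1) * V - P1 * pCons 0 (pderiv V)
    + [:q:] * pCons 0 (pderiv P2 * V - P2 * pderiv V)"
  proof -
    \<comment> \<open>Proved for arbitrary ring elements first; x stands for the indeterminate and y
      for the constant q.\<close>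
    have "x * ((d1 + y * d2) * V - (P1 + y * P2) * d3)
        = (x * d1) * V - P1 * (x * d3) + y * (x * (d2 * V - P2 * d3))" for x y d1 d2 d3
      by (simp add: algebra_simps)
    moreover have "pCons 0 A = [:0, 1:] * A" for A :: "int poly" by simp
    ultimately show ?thesis unfolding W dP P2[symmetric] by (metis P2)
  qed
  \<comment> \<open>The extra factor X turns differentiation into multiplication of the i-th
    coefficient by i and keeps the index g + e free of a subtraction.\<close>
  have shift: "coeff (pCons 0 (pderiv A)) i = int i * coeff A i" for A :: "int poly" and i
    by (cases i) (auto simp: coeff_pderiv)
  have "coeff (pCons 0 (pderiv P1) * V) (g + e) = int g * coeff P g"
    using V by (subst coeff_mult_top) (auto simp: shift P1)
  moreover have "coeff (P1 * pCons 0 (pderiv V)) (g + e) = int e * coeff P g"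
    using V by (subst coeff_mult_top) (auto simp: shift P1)
  moreover have "coeff ([:q:] * pCons 0 (pderiv P2 * V - P2 * pderiv V)) (g + e)
      = q * coeff (pCons 0 (pderiv P2 * V - P2 * pderiv V)) (g + e)"
  proof -
    have "coeff ([:q:] * A) k = q * coeff A k" for A k by simp
    then show ?thesis .
  qed
  ultimately have c: "coeff (pCons 0 (pderiv U * V - U * pderiv V)) (g + e)
      = (int g - int e) * coeff P g + q * coeff (pCons 0 (pderiv P2 * V - P2 * pderiv V)) (g + e)"
    unfolding X coeff_add coeff_diff by (simp add: algebra_simps)
  \<comment> \<open>\<open>0 < e - g \<le> e < q\<close>: this takes the place of the divisions in
    Newton's identities.\<close>
  have "\<not> q dvd (int g - int e)"
    using ge q(2) zdvd_not_zless[of "int e - int g" q] by (simp add: dvd_diff_commute)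
  then have "\<not> q dvd (int g - int e) * coeff P g"
    using gI q(1) by (simp add: prime_dvd_mult_iff I_def)
  then have "\<not> q dvd coeff (pCons 0 (pderiv U * V - U * pderiv V)) (g + e)"
    unfolding c by (simp add: dvd_add_left_iff)
  then show ?thesis by (rule that)
qed

text \<open>Subtracting the truncated expansions of U'/U and V'/V shows that X^K times the Wronskian
  is a multiple of q plus terms of degree below 2e. Its coefficients from 2e on vanish modulo q,
  which \<open>wronskian_coeff\<close> excludes unless U and V agree modulo q.\<close>

lemma root_poly_cong:
  fixes q :: int
  assumes q: "prime q" "int e < q" and size: "size M = e" "size M' = e" and "e < K"
    and sums: "\<And>j. j < K \<Longrightarrow> q dvd power_sum M j - power_sum M' j"
  shows "q dvd coeff (root_poly M - root_poly M') i"
proof (rule ccontr)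
  assume ndvd: "\<not> q dvd coeff (root_poly M - root_poly M') i"
  define U where "U = root_poly M"
  define V where "V = root_poly M'"
  have U: "coeff U i = 0" if "i > e" for i
    using root_poly_monic[of M] that size unfolding U_def by (simp add: coeff_eq_0)
  have V: "coeff V i = 0" if "i > e" for i
    using root_poly_monic[of M'] that size unfolding V_def by (simp add: coeff_eq_0)
  have UV1: "coeff U e = 1" "coeff V e = 1"
    using root_poly_monic[of M] root_poly_monic[of M'] size by (auto simp: U_def V_def)
  define F where "F = pderiv U * V - U * pderiv V"
  obtain g where g: "\<not> q dvd coeff (pCons 0 F) (g + e)"
    using wronskian_coeff[OF q U UV1(1) V UV1(2)] ndvd unfolding U_def V_def F_def by metis
  obtain R where R: "\<forall>i\<ge>e. coeff R i = 0"
    and eR: "monom 1 K * pderiv U = U * power_sum_poly K M + R"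
    using pderiv_root_poly[of M K] unfolding size U_def by blast
  obtain R' where R': "\<forall>i\<ge>e. coeff R' i = 0"
    and eR': "monom 1 K * pderiv V = V * power_sum_poly K M' + R'"
    using pderiv_root_poly[of M' K] unfolding size V_def by blast
  define D where "D = power_sum_poly K M - power_sum_poly K M'"
  have "[:q:] dvd power_sum_poly k M - power_sum_poly k M'" if "k \<le> K" for k
    using that
  proof (induction k)
    case (Suc k)
    then show ?case using sums[of k] by (auto simp: const_poly_dvd_iff coeff_pCons split: nat.split)
  qed simp
  then obtain D' where D': "D = [:q:] * D'" unfolding D_def by blast
  have "monom 1 K * F = (monom 1 K * pderiv U) * V - U * (monom 1 K * pderiv V)"
    by (simp add: F_def algebra_simps)
  also have "\<dots> = U * V * D + (R * V - R' * U)"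
    unfolding eR eR' D_def by (simp add: algebra_simps)
  finally have eq: "monom 1 K * F = [:q:] * (U * V * D') + (R * V - R' * U)"
    by (simp add: D' algebra_simps)
  show False
  proof (cases "g + e")
    case 0
    then show ?thesis using g by simp
  next
    case (Suc s)
    have "coeff F s = coeff (monom 1 K * F) (K + s)" by (simp add: coeff_monom_mult)
    also have "\<dots> = q * coeff (U * V * D') (K + s) + coeff (R * V) (K + s) - coeff (R' * U) (K + s)"
      by (simp add: eq)
    \<comment> \<open>\<open>K + s \<ge> 2 * e\<close>, since \<open>K \<ge> e + 1\<close> and
      \<open>s = g + e - 1\<close>; both remainder products have ended before.\<close>
    also have "coeff (R * V) (K + s) = 0"
      using R V Suc \<open>e < K\<close> by (intro coeff_mult_above[of e _ e]) auto
    also have "coeff (R' * U) (K + s) = 0"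
      using R' U Suc \<open>e < K\<close> by (intro coeff_mult_above[of e _ e]) auto
    finally show False using g Suc by simp
  qed
qed

text \<open>As the two root polynomials agree modulo q, an element of M is a root modulo q of the
  other one, and the prime q divides one of its linear factors.\<close>

lemma power_sums_separate:
  fixes q :: int
  assumes q: "prime q" "int e < q" and size: "size M = e" "size M' = e" and "e < K"
    and sums: "\<And>j. j < K \<Longrightarrow> q dvd power_sum M j - power_sum M' j"
    and disj: "\<And>a b. a \<in># M \<Longrightarrow> b \<in># M' \<Longrightarrow> \<not> q dvd a - b"
  shows "M = {#}"
proof (rule ccontr)
  assume "M \<noteq> {#}"
  then obtain a where a: "a \<in># M" by auto
  have "[:q:] dvd root_poly M - root_poly M'"
    unfolding const_poly_dvd_iff using root_poly_cong[OF q size \<open>e < K\<close> sums] by auto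
  then obtain D where D: "root_poly M - root_poly M' = [:q:] * D" by blast
  have "poly (root_poly M - root_poly M') a = q * poly D a" by (simp add: D)
  moreover have "poly (root_poly M) a = 0" using a by (auto simp: poly_root_poly)
  ultimately have "q dvd poly (root_poly M') a" by (metis diff_0 dvd_minus_iff dvd_triv_left poly_diff)
  then have dv: "q dvd (\<Prod>b\<in>#M'. a - b)" by (simp add: poly_root_poly)
  have "\<exists>b\<in>#N. q dvd a - b" if "q dvd (\<Prod>b\<in>#N. a - b)" for N
    using that
  proof (induction N)
    case empty
    then show ?case using q by (auto dest: not_prime_unit)
  next
    case (add b N)
    then show ?case using q(1) by (auto simp: prime_dvd_mult_iff)
  qed
  then show False using dv disj a by blast
qed

lemma power_sum_sum: "power_sum (\<Sum>i\<in>I. f i) j = (\<Sum>i\<in>I. power_sum (f i) j)" if "finite I"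
  using that by (induction I rule: finite_induct) (auto simp: power_sum_def)

text \<open>Each position is taken with multiplicity \<open>\<bar>x i\<bar>\<close> in one of two
  multisets, according to the sign. These are disjoint and have equal power sums; if the norm is
  below 2K, both have fewer than K elements and must be empty. Coding theory knows this as the bound
  on the Lee distance of BCH codes.\<close>

theorem power_sum_kernel_min_distance:
  fixes x :: "nat \<Rightarrow> int" and q :: nat
  assumes q: "prime q" "n \<le> q" "2 * K \<le> q"
    and ker: "\<And>j. j < K \<Longrightarrow> int q dvd (\<Sum>i<n. x i * int i ^ j)"
    and nz: "i0 < n" "x i0 \<noteq> 0"
  shows "2 * int K \<le> (\<Sum>i<n. \<bar>x i\<bar>)"
proof (rule ccontr)
  assume "\<not> ?thesis"
  then have lt: "(\<Sum>i<n. \<bar>x i\<bar>) < 2 * int K" by simp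
  have "0 \<le> (\<Sum>i<n. \<bar>x i\<bar>)" by (rule sum_nonneg) simp
  then have K: "K > 0" using lt by linarith
  define M where "M y = (\<Sum>i<n. replicate_mset (nat (y i)) (int i))" for y :: "nat \<Rightarrow> int"
  have ps1: "power_sum (replicate_mset k a) j = int k * a ^ j" for k a j
    by (induction k) (auto simp: power_sum_def algebra_simps)
  have ps: "power_sum (M y) j = (\<Sum>i<n. int (nat (y i)) * int i ^ j)" for y j
    unfolding M_def by (simp add: power_sum_sum ps1)
  have sz: "int (size N) = power_sum N 0" for N
    by (induction N) (auto simp: power_sum_def)
  define u where "u = M x"
  define v where "v = M (\<lambda>i. - x i)"
  have diff: "power_sum u j - power_sum v j = (\<Sum>i<n. x i * int i ^ j)" for j
    unfolding u_def v_def ps sum_subtractf[symmetric] left_diff_distrib[symmetric]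
    by (intro sum.cong) auto
  have sizes: "int (size u) + int (size v) = (\<Sum>i<n. \<bar>x i\<bar>)"
    unfolding u_def v_def sz ps sum.distrib[symmetric] by (intro sum.cong) auto
  \<comment> \<open>The zeroth power sum counts elements: the sizes agree modulo q, hence agree, as
    the norm is below \<open>2 * K \<le> q\<close>. Each is then less than K.\<close>
  have "int q dvd int (size u) - int (size v)"
    using ker[OF K] diff[of 0] by (simp add: u_def v_def sz)
  moreover have "\<bar>int (size u) - int (size v)\<bar> < int q" using sizes lt q(3) by linarith
  ultimately have "int (size u) - int (size v) = 0"
    by (metis abs_of_nat dvd_imp_le_int not_le)
  then have eq: "size u = size v" by simp
  have mem: "a \<in># M y \<longleftrightarrow> (\<exists>i<n. a = int i \<and> y i > 0)" for a y
    unfolding M_def by (auto simp: set_mset_sum split: if_splits)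
  \<comment> \<open>Positions below \<open>n \<le> q\<close> are distinct modulo q, and no position
    carries both signs.\<close>
  have disj: "\<not> int q dvd a - b" if ab: "a \<in># u" "b \<in># v" for a b
  proof
    assume dv: "int q dvd a - b"
    obtain i k where "i < n" "a = int i" "x i > 0" "k < n" "b = int k" "x k < 0"
      using ab unfolding u_def v_def mem by auto
    moreover from this have "\<bar>a - b\<bar> < int q" using q(2) by linarith
    moreover from calculation have "a - b \<noteq> 0" by auto
    ultimately show False using dv by (metis abs_of_nat dvd_imp_le_int not_le)
  qed
  have e: "int (size u) < int q" "size u < K" using sizes eq lt q(3) by linarith+
  have "u = {#}"
    by (rule power_sums_separate[of "int q" "size u" u v K]) (use q e eq diff ker disj in auto)
  moreover from this have "v = {#}" using eq by simp
  moreover have "int i0 \<in># u \<or> int i0 \<in># v"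
    unfolding u_def v_def mem using nz by (cases "x i0 > 0") auto
  ultimately show False by auto
qed

section \<open>The lattice and its dense coset\<close>

text \<open>Block form: I and 0 on top, W H and W q I below, where H has the entries j^r mod q. With
  the syndrome as additional coordinates the generators are explicit and the matrix is square; the
  columns W q e_i make the syndrome count modulo q only.\<close>

definition code_mat :: "nat \<Rightarrow> nat \<Rightarrow> nat \<Rightarrow> int \<Rightarrow> int mat" where
  "code_mat n K q W = mat (n + K) (n + K) (\<lambda>(i, j).
     if i < n then of_bool (i = j)
     else if j < n then W * (int j ^ (i - n) mod int q)
     else W * int q * of_bool (i = j))"

text \<open>The sum of residues is not reduced modulo q again: the coset is insensitive to multiples
  of W q in these coordinates, and a program can simply accumulate.\<close>

definition syndrome_vec :: "nat \<Rightarrow> nat \<Rightarrow> nat \<Rightarrow> int \<Rightarrow> nat \<Rightarrow> (nat \<Rightarrow> nat) \<Rightarrow> int Matrix.vec" where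
  "syndrome_vec n K q W h y = Matrix.vec (n + K) (\<lambda>i.
     if i < n then 0 else W * (\<Sum>b<h. int (y b) ^ (i - n) mod int q))"

lemma sum_split_at:
  fixes f :: "nat \<Rightarrow> 'a :: comm_monoid_add"
  shows "(\<Sum>i<n + K. f i) = (\<Sum>i<n. f i) + (\<Sum>r<K. f (n + r))"
  by (induction K) (auto simp: ac_simps)

text \<open>The identity block shows the first n coefficients as the first n coordinates, so
  membership becomes a separate condition on each of the last K coordinates.\<close>

lemma lattice_code_mat:
  "v \<in> lattice (code_mat n K q W) \<longleftrightarrow> v \<in> carrier_vec (n + K) \<and>
    (\<forall>r<K. \<exists>z. vec_index v (n + r) = W * ((\<Sum>j<n. (int j ^ r mod int q) * vec_index v j) + int q * z))"
    (is "_ \<longleftrightarrow> ?R")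
proof -
  have row: "vec_index (code_mat n K q W *\<^sub>v x) i =
      (if i < n then vec_index x i
       else W * ((\<Sum>j<n. (int j ^ (i - n) mod int q) * vec_index x j) + int q * vec_index x i))"
    if x: "x \<in> carrier_vec (n + K)" and i: "i < n + K" for x i
  proof -
    have "vec_index (code_mat n K q W *\<^sub>v x) i
        = (\<Sum>j<n + K. code_mat n K q W $$ (i, j) * vec_index x j)"
      using x i by (simp add: code_mat_def scalar_prod_def atLeast0LessThan)
    also have "\<dots> = (\<Sum>j<n. code_mat n K q W $$ (i, j) * vec_index x j)
       + (\<Sum>r<K. code_mat n K q W $$ (i, n + r) * vec_index x (n + r))"
      by (rule sum_split_at)
    also have "\<dots> = (if i < n then vec_index x i
       else W * ((\<Sum>j<n. (int j ^ (i - n) mod int q) * vec_index x j) + int q * vec_index x i))"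
    proof (cases "i < n")
      case True
      have "(\<Sum>j<n. code_mat n K q W $$ (i, j) * vec_index x j) = (\<Sum>j<n. if j = i then vec_index x i else 0)"
        using True by (intro sum.cong) (auto simp: code_mat_def)
      moreover have "(\<Sum>r<K. code_mat n K q W $$ (i, n + r) * vec_index x (n + r)) = 0"
        using True by (intro sum.neutral) (auto simp: code_mat_def)
      ultimately show ?thesis using True by simp
    next
      case False
      then obtain r0 where r0: "i = n + r0" "r0 < K" using i by (metis add_less_cancel_left le_Suc_ex not_le)
      have "(\<Sum>r<K. code_mat n K q W $$ (i, n + r) * vec_index x (n + r))
          = (\<Sum>r<K. if r = r0 then W * int q * vec_index x i else 0)"
        using r0 by (intro sum.cong) (auto simp: code_mat_def)
      then have "(\<Sum>r<K. code_mat n K q W $$ (i, n + r) * vec_index x (n + r)) = W * int q * vec_index x i"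
        using r0 by simp
      moreover have "(\<Sum>j<n. code_mat n K q W $$ (i, j) * vec_index x j)
          = W * (\<Sum>j<n. (int j ^ (i - n) mod int q) * vec_index x j)"
        unfolding sum_distrib_left using r0 by (intro sum.cong) (auto simp: code_mat_def)
      ultimately show ?thesis using False by (simp add: algebra_simps)
    qed
    finally show ?thesis .
  qed
  have dim: "dim_col (code_mat n K q W) = n + K" "dim_row (code_mat n K q W) = n + K"
    by (simp_all add: code_mat_def)
  show ?thesis
  proof
    assume "v \<in> lattice (code_mat n K q W)"
    then obtain x where x: "x \<in> carrier_vec (n + K)" "v = code_mat n K q W *\<^sub>v x"
      unfolding lattice_def dim by blast
    have "v \<in> carrier_vec (n + K)" unfolding x(2) carrier_vec_def by (simp add: dim)
    moreover have "vec_index v (n + r) = W * ((\<Sum>j<n. (int j ^ r mod int q) * vec_index v j) + int q * vec_index x (n + r))"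
      if "r < K" for r
    proof -
      have "(\<Sum>j<n. (int j ^ r mod int q) * vec_index v j) = (\<Sum>j<n. (int j ^ r mod int q) * vec_index x j)"
        unfolding x(2) using row[OF x(1)] by (intro sum.cong) auto
      then show ?thesis using row[OF x(1), of "n + r"] that x(2) by simp
    qed
    ultimately show ?R by blast
  next
    assume R: ?R
    then obtain z where z: "\<And>r. r < K \<Longrightarrow>
        vec_index v (n + r) = W * ((\<Sum>j<n. (int j ^ r mod int q) * vec_index v j) + int q * z r)"
      by metis
    define x where "x = Matrix.vec (n + K) (\<lambda>i. if i < n then vec_index v i else z (i - n))"
    have x: "x \<in> carrier_vec (n + K)" by (simp add: x_def)
    have "code_mat n K q W *\<^sub>v x = v"
    proof (rule eq_vecI)
      fix i assume "i < dim_vec v"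
      then have i: "i < n + K" using R by auto
      have s: "(\<Sum>j<n. c j * vec_index x j) = (\<Sum>j<n. c j * vec_index v j)" for c
        by (intro sum.cong) (auto simp: x_def)
      show "vec_index (code_mat n K q W *\<^sub>v x) i = vec_index v i"
      proof (cases "i < n")
        case True
        then show ?thesis using row[OF x i] i by (simp add: x_def)
      next
        case False
        then show ?thesis using row[OF x i] z[of "i - n"] i s by (simp add: x_def)
      qed
    qed (use R dim in auto)
    then show "v \<in> lattice (code_mat n K q W)" unfolding lattice_def dim using x by blast
  qed
qed

lemma abs_le_abs_powr:
  assumes "1 \<le> p"
  shows "real_of_int \<bar>z\<bar> \<le> \<bar>real_of_int z\<bar> powr p"
proof (cases "z = 0")
  case False
  then have "1 \<le> \<bar>real_of_int z\<bar>" by linarith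
  then have "\<bar>real_of_int z\<bar> powr 1 \<le> \<bar>real_of_int z\<bar> powr p" using assms by (intro powr_mono) auto
  then show ?thesis using False by simp
qed simp

text \<open>A nonzero syndrome coordinate is a multiple of W and alone contributes W^p; if all of
  them vanish, the first n coordinates form a kernel vector and the l_1 bound applies.\<close>

lemma lattice_code_mat_powr_sum:
  assumes p: "1 \<le> p" and q: "prime q" "n \<le> q" "2 * K \<le> q" and W: "0 < W"
    and v: "v \<in> lattice (code_mat n K q W)" "v \<noteq> 0\<^sub>v (dim_vec v)"
  shows "min (2 * real K) (real_of_int W powr p) \<le> (\<Sum>i<dim_vec v. \<bar>real_of_int (vec_index v i)\<bar> powr p)"
proof -
  have dim: "dim_vec v = n + K" and char: "\<And>r. r < K \<Longrightarrow>
      \<exists>z. vec_index v (n + r) = W * ((\<Sum>j<n. (int j ^ r mod int q) * vec_index v j) + int q * z)"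
    using v(1) unfolding lattice_code_mat by auto
  show ?thesis
  proof (cases "\<exists>r<K. vec_index v (n + r) \<noteq> 0")
    case True
    then obtain r where r: "r < K" "vec_index v (n + r) \<noteq> 0" by blast
    then have "W dvd vec_index v (n + r)" using char[of r] by auto
    then have "W \<le> \<bar>vec_index v (n + r)\<bar>" using r W dvd_imp_le_int[of _ W] by auto
    then have "real_of_int W powr p \<le> \<bar>real_of_int (vec_index v (n + r))\<bar> powr p"
      using W p by (intro powr_mono2) linarith+
    also have "\<dots> \<le> (\<Sum>i<dim_vec v. \<bar>real_of_int (vec_index v i)\<bar> powr p)"
      using r dim by (intro member_le_sum) auto
    finally show ?thesis by simp
  next
    case False
    then have zero: "vec_index v (n + r) = 0" if "r < K" for r using that by auto
    have ker: "int q dvd (\<Sum>j<n. vec_index v j * int j ^ r)" if r: "r < K" for r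
    proof -
      obtain z where "0 = W * ((\<Sum>j<n. (int j ^ r mod int q) * vec_index v j) + int q * z)"
        using char[OF r] zero[OF r] by auto
      then have "(\<Sum>j<n. (int j ^ r mod int q) * vec_index v j) = int q * (- z)" using W by auto
      then have "(\<Sum>j<n. (int j ^ r mod int q) * vec_index v j) mod int q = 0" by simp
      moreover have "(\<Sum>j<n. (int j ^ r mod int q) * vec_index v j) mod int q
          = (\<Sum>j<n. vec_index v j * int j ^ r) mod int q"
        by (subst (1 2) mod_sum_eq[symmetric]) (simp add: mod_mult_left_eq mult.commute mod_mult_right_eq)
      ultimately show ?thesis by auto
    qed
    have "\<exists>i<n + K. vec_index v i \<noteq> 0" using v(2) dim by (metis eq_vecI index_zero_vec(1) index_zero_vec(2))
    then obtain i0 where i0: "i0 < n + K" "vec_index v i0 \<noteq> 0" by blast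
    have "i0 < n"
    proof (rule ccontr)
      assume "\<not> i0 < n"
      then have "n + (i0 - n) = i0" "i0 - n < K" using i0(1) by auto
      then show False using zero[of "i0 - n"] i0(2) by simp
    qed
    then have "2 * int K \<le> (\<Sum>i<n. \<bar>vec_index v i\<bar>)"
      using power_sum_kernel_min_distance[OF q, of "vec_index v" i0] ker i0 by simp
    then have "real_of_int (2 * int K) \<le> real_of_int (\<Sum>i<n. \<bar>vec_index v i\<bar>)"
      by (simp only: of_int_le_iff)
    then have "2 * real K \<le> (\<Sum>i<n. real_of_int \<bar>vec_index v i\<bar>)" by simp
    also have "\<dots> \<le> (\<Sum>i<n. \<bar>real_of_int (vec_index v i)\<bar> powr p)"
      by (intro sum_mono abs_le_abs_powr p)
    also have "\<dots> \<le> (\<Sum>i<dim_vec v. \<bar>real_of_int (vec_index v i)\<bar> powr p)"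
      unfolding dim by (intro sum_mono2) auto
    finally show ?thesis by simp
  qed
qed

text \<open>All nonzero vectors share one bound c on the p-th power of the norm, with c strictly
  above d^p; a merely pointwise strict inequality would not pass to the infimum.\<close>

lemma lambda1_code_mat:
  assumes p: "1 \<le> p" and q: "prime q" "n \<le> q" "2 * K \<le> q" and K: "1 \<le> K"
    and d: "real d powr p < 2 * real K" "int d < W"
  shows "real d < lambda1 p (lattice (code_mat n K q W))"
proof -
  define c where "c = min (2 * real K) (real_of_int W powr p)"
  define S where "S = {lp_norm p (real_vec v) | v. v \<in> lattice (code_mat n K q W) \<and> v \<noteq> 0\<^sub>v (dim_vec v)}"
  have W: "0 < W" using d by linarith
  have "real d powr p < real_of_int W powr p" using d p by (intro powr_less_mono2) linarith+
  then have c: "real d powr p < c" using d by (simp add: c_def)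
  then have c0: "c > 0" by (metis le_less_trans powr_ge_zero)
  \<comment> \<open>The set under \<open>Inf\<close> has to be nonempty. The column W q e_n serves;
    it exists because \<open>1 \<le> K\<close>.\<close>
  define v0 where "v0 = Matrix.vec (n + K) (\<lambda>i. if i = n then W * int q else 0)"
  have v0n: "vec_index v0 n \<noteq> 0" using W K prime_gt_0_nat[OF q(1)] by (simp add: v0_def)
  have "v0 \<in> lattice (code_mat n K q W)"
    unfolding lattice_code_mat
  proof (intro conjI allI impI)
    fix r assume "r < K"
    then show "\<exists>z. vec_index v0 (n + r) = W * ((\<Sum>j<n. int j ^ r mod int q * vec_index v0 j) + int q * z)"
      by (intro exI[of _ "of_bool (r = 0)"]) (auto simp: v0_def)
  qed (simp add: v0_def)
  moreover have "v0 \<noteq> 0\<^sub>v (dim_vec v0)"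
  proof
    assume "v0 = 0\<^sub>v (dim_vec v0)"
    then have "vec_index v0 n = vec_index (0\<^sub>v (n + K)) n" by (metis dim_vec v0_def)
    then show False using v0n K by simp
  qed
  ultimately have ne: "S \<noteq> {}" unfolding S_def by blast
  have "c powr (1 / p) \<le> Inf S"
  proof (rule cInf_greatest[OF ne])
    fix x assume "x \<in> S"
    then obtain v where v: "v \<in> lattice (code_mat n K q W)" "v \<noteq> 0\<^sub>v (dim_vec v)"
      and x: "x = lp_norm p (real_vec v)" by (auto simp: S_def)
    have "c \<le> (\<Sum>i<dim_vec v. \<bar>real_of_int (vec_index v i)\<bar> powr p)"
      unfolding c_def by (rule lattice_code_mat_powr_sum[OF p q W v])
    then have "c powr (1 / p) \<le> (\<Sum>i<dim_vec v. \<bar>real_of_int (vec_index v i)\<bar> powr p) powr (1 / p)"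
      using c0 p by (intro powr_mono2) auto
    then show "c powr (1 / p) \<le> x" unfolding x lp_norm_def by simp
  qed
  moreover have "real d < c powr (1 / p)"
  proof -
    have "(real d powr p) powr (1 / p) < c powr (1 / p)" using c p by (intro powr_less_mono2) auto
    moreover have "(real d powr p) powr (1 / p) = real d" using p by (simp add: powr_powr)
    ultimately show ?thesis by simp
  qed
  ultimately show ?thesis unfolding lambda1_def S_def by linarith
qed

section \<open>Coset points from position sets with equal syndromes\<close>

definition syndrome :: "nat \<Rightarrow> nat \<Rightarrow> nat set \<Rightarrow> nat list" where
  "syndrome q K J = map (\<lambda>r. (\<Sum>j\<in>J. j ^ r) mod q) [0..<K]"

lemma finite_int_vecs_bounded:
  "finite {v :: int Matrix.vec. v \<in> carrier_vec m \<and> (\<forall>i<m. \<bar>vec_index v i\<bar> \<le> b)}" (is "finite ?S")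
proof -
  have "?S \<subseteq> vec_of_list ` {xs. set xs \<subseteq> {- b..b} \<and> length xs = m}"
  proof
    fix v assume v: "v \<in> ?S"
    have "set (list_of_vec v) \<subseteq> {- b..b}"
      using v by (auto simp: set_list_of_vec abs_le_iff vec_set_def)
    moreover have "length (list_of_vec v) = m" using v by auto
    ultimately show "v \<in> vec_of_list ` {xs. set xs \<subseteq> {- b..b} \<and> length xs = m}"
      by (intro image_eqI[of _ _ "list_of_vec v"]) (auto simp: vec_list)
  qed
  then show ?thesis
    by (rule finite_subset) (intro finite_imageI finite_lists_length_eq finite_atLeastAtMost_int)
qed

text \<open>\<open>card\<close> is 0 on infinite sets, so a lower bound on the number of coset
  points in the ball presupposes finiteness.\<close>

lemma finite_coset_ball:
  fixes L :: "int Matrix.vec set"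
  assumes p: "1 \<le> p" and L: "L \<subseteq> carrier_vec m" and s: "s \<in> carrier_vec m"
  shows "finite ((\<lambda>v. real_vec (v - s)) ` L \<inter> lp_ball p m R)"
proof -
  have "(\<lambda>v. real_vec (v - s)) ` L \<inter> lp_ball p m R
      \<subseteq> real_vec ` {v. v \<in> carrier_vec m \<and> (\<forall>i<m. \<bar>vec_index v i\<bar> \<le> \<lceil>R powr p\<rceil>)}"
  proof
    fix x assume "x \<in> (\<lambda>v. real_vec (v - s)) ` L \<inter> lp_ball p m R"
    then obtain v where v: "v \<in> L" "x = real_vec (v - s)" "lp_norm p x \<le> R"
      by (auto simp: lp_ball_def)
    define w where "w = v - s"
    have w: "w \<in> carrier_vec m" using v(1) s L by (auto simp: w_def)
    have "\<bar>vec_index w i\<bar> \<le> \<lceil>R powr p\<rceil>" if i: "i < m" for i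
    proof -
      define X where "X = (\<Sum>i<m. \<bar>real_of_int (vec_index w i)\<bar> powr p)"
      have X0: "X \<ge> 0" unfolding X_def by (intro sum_nonneg) auto
      have "X powr (1 / p) \<le> R"
        using v(3) w unfolding v(2) w_def[symmetric] lp_norm_def X_def by simp
      then have "(X powr (1 / p)) powr p \<le> R powr p" using p by (intro powr_mono2) auto
      then have "X \<le> R powr p" using X0 p by (simp add: powr_powr)
      moreover have "real_of_int \<bar>vec_index w i\<bar> \<le> \<bar>real_of_int (vec_index w i)\<bar> powr p"
        by (rule abs_le_abs_powr[OF p])
      moreover have "\<bar>real_of_int (vec_index w i)\<bar> powr p \<le> X"
        unfolding X_def using i by (intro member_le_sum) auto
      ultimately have "real_of_int \<bar>vec_index w i\<bar> \<le> R powr p" by linarith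
      then show ?thesis by linarith
    qed
    then show "x \<in> real_vec ` {v. v \<in> carrier_vec m \<and> (\<forall>i<m. \<bar>vec_index v i\<bar> \<le> \<lceil>R powr p\<rceil>)}"
      unfolding v(2) w_def[symmetric] using w by blast
  qed
  then show ?thesis by (rule finite_subset) (intro finite_imageI finite_int_vecs_bounded)
qed

text \<open>The indicator vector of J', padded with zeros, becomes a lattice vector when s is added,
  because the syndromes of J' and J agree; its norm is h^(1/p).\<close>

lemma card_coset_ball:
  assumes p: "1 \<le> p" and y: "inj_on y {..<h}" "y ` {..<h} = J"
    and F: "\<And>J'. J' \<in> F \<Longrightarrow> J' \<subseteq> {..<n} \<and> card J' = h \<and> syndrome q K J' = syndrome q K J"
    and R: "0 \<le> R" "real h \<le> R powr p"
  shows "card F \<le> card ((\<lambda>v. real_vec (v - syndrome_vec n K q W h y)) ` lattice (code_mat n K q W) \<inter> lp_ball p (n + K) R)"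
proof -
  define s where "s = syndrome_vec n K q W h y"
  define pt where "pt J' = Matrix.vec (n + K) (\<lambda>i. of_bool (i < n \<and> i \<in> J') :: int)" for J'
  have s: "s \<in> carrier_vec (n + K)" by (simp add: s_def syndrome_vec_def)
  have ptJ: "pt J' = (pt J' + s) - s" for J'
    using s by (intro eq_vecI) (auto simp: pt_def)
  have finJ: "finite J'" if "J' \<in> F" for J' using F[OF that] by (meson finite_lessThan finite_subset)
  have mem: "pt J' + s \<in> lattice (code_mat n K q W)" if J': "J' \<in> F" for J'
    unfolding lattice_code_mat
  proof (intro conjI allI impI)
    show "pt J' + s \<in> carrier_vec (n + K)" using s by (simp add: pt_def)
    fix r assume r: "r < K"
    have m: "(\<Sum>j\<in>I. int j ^ r mod int q) mod int q = int (syndrome q K I ! r)" if "finite I" for I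
      using r by (simp add: syndrome_def mod_sum_eq zmod_int of_nat_sum)
    have "(\<Sum>j<n. (int j ^ r mod int q) * vec_index (pt J' + s) j)
        = (\<Sum>j<n. if j \<in> J' then int j ^ r mod int q else 0)"
      using s by (intro sum.cong) (auto simp: pt_def s_def syndrome_vec_def)
    also have "\<dots> = (\<Sum>j\<in>J'. int j ^ r mod int q)"
      using F[OF J'] by (simp add: sum.If_cases Int_absorb1)
    finally have e1: "(\<Sum>j<n. (int j ^ r mod int q) * vec_index (pt J' + s) j) = (\<Sum>j\<in>J'. int j ^ r mod int q)" .
    have "vec_index (pt J' + s) (n + r) = W * (\<Sum>b<h. int (y b) ^ r mod int q)"
      using r s by (simp add: pt_def s_def syndrome_vec_def)
    also have "(\<Sum>b<h. int (y b) ^ r mod int q) = (\<Sum>j\<in>J. int j ^ r mod int q)"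
      unfolding y(2)[symmetric] by (simp add: sum.reindex[OF y(1)])
    finally have e2: "vec_index (pt J' + s) (n + r) = W * (\<Sum>j\<in>J. int j ^ r mod int q)" .
    have "finite J" using y(2) by auto
    then have "(\<Sum>j\<in>J. int j ^ r mod int q) mod int q = (\<Sum>j\<in>J'. int j ^ r mod int q) mod int q"
      using m finJ[OF J'] F[OF J'] by simp
    then have "int q dvd (\<Sum>j\<in>J. int j ^ r mod int q) - (\<Sum>j\<in>J'. int j ^ r mod int q)"
      by (simp add: mod_eq_dvd_iff)
    then obtain z where "(\<Sum>j\<in>J. int j ^ r mod int q) - (\<Sum>j\<in>J'. int j ^ r mod int q) = int q * z" by blast
    then have "(\<Sum>j\<in>J. int j ^ r mod int q) = (\<Sum>j\<in>J'. int j ^ r mod int q) + int q * z" by linarith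
    then show "\<exists>z. vec_index (pt J' + s) (n + r)
        = W * ((\<Sum>j<n. int j ^ r mod int q * vec_index (pt J' + s) j) + int q * z)"
      unfolding e1 e2 by (intro exI[of _ z]) simp
  qed
  have ball: "real_vec (pt J') \<in> lp_ball p (n + K) R" if J': "J' \<in> F" for J'
  proof -
    have "(\<Sum>i<n + K. \<bar>vec_index (real_vec (pt J')) i\<bar> powr p) = (\<Sum>i<n + K. if i \<in> J' then 1 else 0)"
      using F[OF J'] p by (intro sum.cong) (auto simp: pt_def)
    also have "{..<n + K} \<inter> {i. i \<in> J'} = J'" using F[OF J'] by auto
    then have "(\<Sum>i<n + K. if i \<in> J' then 1 else 0) = real h"
      using F[OF J'] by (simp add: sum.If_cases)
    finally have "lp_norm p (real_vec (pt J')) = real h powr (1 / p)" by (simp add: lp_norm_def pt_def)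
    also have "\<dots> \<le> (R powr p) powr (1 / p)" using R p by (intro powr_mono2) auto
    also have "\<dots> = R" using R p by (simp add: powr_powr)
    finally show ?thesis by (simp add: lp_ball_def pt_def)
  qed
  have "inj_on (\<lambda>J'. real_vec (pt J')) F"
  proof (rule inj_onI)
    fix J1 J2 assume J12: "J1 \<in> F" "J2 \<in> F" and eq: "real_vec (pt J1) = real_vec (pt J2)"
    have "i \<in> J1 \<longleftrightarrow> i \<in> J2" if "i < n" for i
    proof -
      have "vec_index (real_vec (pt J1)) i = vec_index (real_vec (pt J2)) i" using eq by simp
      then show ?thesis using that by (auto simp: pt_def of_bool_def split: if_splits)
    qed
    then show "J1 = J2" using F[OF J12(1)] F[OF J12(2)] by blast
  qed
  then have "card F = card ((\<lambda>J'. real_vec (pt J')) ` F)" by (simp add: card_image)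
  also have "\<dots> \<le> card ((\<lambda>v. real_vec (v - s)) ` lattice (code_mat n K q W) \<inter> lp_ball p (n + K) R)"
  proof (rule card_mono)
    show "finite ((\<lambda>v. real_vec (v - s)) ` lattice (code_mat n K q W) \<inter> lp_ball p (n + K) R)"
      by (rule finite_coset_ball[OF p _ s]) (auto simp: lattice_code_mat)
    show "(\<lambda>J'. real_vec (pt J')) ` F \<subseteq> (\<lambda>v. real_vec (v - s)) ` lattice (code_mat n K q W) \<inter> lp_ball p (n + K) R"
    proof
      fix x assume "x \<in> (\<lambda>J'. real_vec (pt J')) ` F"
      then obtain J' where J': "J' \<in> F" "x = real_vec (pt J')" by blast
      have "x = real_vec ((pt J' + s) - s)" using J' ptJ[of J'] by simp
      then show "x \<in> (\<lambda>v. real_vec (v - s)) ` lattice (code_mat n K q W) \<inter> lp_ball p (n + K) R"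
        using mem[OF J'(1)] ball[OF J'(1)] J'(2) by (intro IntI image_eqI[of _ _ "pt J' + s"]) auto
    qed
  qed
  finally show ?thesis unfolding s_def .
qed

section \<open>Position sets drawn by coin flips\<close>

definition bits_val :: "bool list \<Rightarrow> nat" where
  "bits_val bs = foldl (\<lambda>v b. 2 * v + of_bool b) 0 bs"

lemma bits_val_snoc: "bits_val (bs @ [b]) = 2 * bits_val bs + of_bool b"
  by (simp add: bits_val_def)

lemma bits_val_less: "bits_val bs < 2 ^ length bs"
  by (induction bs rule: rev_induct) (auto simp: bits_val_snoc, simp add: bits_val_def)

lemma bits_val_inj: "length bs = length cs \<Longrightarrow> bits_val bs = bits_val cs \<Longrightarrow> bs = cs"
proof (induction bs arbitrary: cs rule: rev_induct)
  case (snoc b bs)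
  then obtain c cs' where cs: "cs = cs' @ [c]" by (cases cs rule: rev_cases) auto
  have eq: "2 * bits_val bs + of_bool b = 2 * bits_val cs' + of_bool c"
    using snoc.prems by (simp add: cs bits_val_snoc)
  then have "b = c" by (cases b; cases c; simp; presburger)
  moreover from this eq have "bits_val bs = bits_val cs'" by simp
  ultimately show ?case using snoc cs by simp
qed simp

text \<open>Block b receives one position, chosen by its own a bits. A power of 2 as block length
  makes the choice exactly uniform. One unit per block gives every set exactly h elements, and
  distinct strings of a h bits give distinct sets.\<close>

definition position :: "nat \<Rightarrow> bool list \<Rightarrow> nat \<Rightarrow> nat" where
  "position a \<omega> b = b * 2 ^ a + bits_val (take a (drop (a * b) \<omega>))"

lemma position_bound: "position a \<omega> b div 2 ^ a = b" "position a \<omega> b < Suc b * 2 ^ a"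
proof -
  have "bits_val (take a (drop (a * b) \<omega>)) < 2 ^ length (take a (drop (a * b) \<omega>))"
    by (rule bits_val_less)
  also have "\<dots> \<le> 2 ^ a" by (intro power_increasing) auto
  finally have "bits_val (take a (drop (a * b) \<omega>)) < 2 ^ a" .
  then show "position a \<omega> b div 2 ^ a = b" "position a \<omega> b < Suc b * 2 ^ a"
    by (auto simp: position_def)
qed

lemma position_inj: "inj_on (position a \<omega>) A"
  by (metis inj_onI position_bound(1))

lemma position_image_subset: "position a \<omega> ` {..<h} \<subseteq> {..<h * 2 ^ a}"
proof clarify
  fix b assume "b < h"
  then have "Suc b * 2 ^ a \<le> h * 2 ^ a" by (intro mult_right_mono) auto
  then show "position a \<omega> b < h * 2 ^ a" using position_bound(2)[of a \<omega> b] by linarith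
qed

lemma position_image_inj:
  assumes len: "length \<omega> = a * h" "length \<omega>' = a * h"
    and eq: "position a \<omega> ` {..<h} = position a \<omega>' ` {..<h}"
  shows "\<omega> = \<omega>'"
proof (rule nth_equalityI)
  show "length \<omega> = length \<omega>'" using len by simp
  fix i assume i: "i < length \<omega>"
  then have a: "a > 0" using len by (cases a) auto
  define b where "b = i div a"
  have b: "b < h" using i len a unfolding b_def by (simp add: less_mult_imp_div_less mult.commute)
  then have "position a \<omega> b \<in> position a \<omega>' ` {..<h}" using eq by blast
  then obtain b' where "position a \<omega> b = position a \<omega>' b'" by blast
  \<comment> \<open>Equal images might match b with another b'; the block number, recovered by
    \<open>div 2 ^ a\<close>, forces b = b'.\<close>
  then have "position a \<omega> b = position a \<omega>' b" by (metis position_bound(1))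
  then have "bits_val (take a (drop (a * b) \<omega>)) = bits_val (take a (drop (a * b) \<omega>'))"
    by (simp add: position_def)
  then have t: "take a (drop (a * b) \<omega>) = take a (drop (a * b) \<omega>')"
    by (rule bits_val_inj[rotated]) (simp add: len)
  have m: "i mod a < a" using a by simp
  have idx: "i = a * b + i mod a" by (simp add: b_def)
  have "\<omega> ! i = take a (drop (a * b) \<omega>) ! (i mod a)" using i m idx by (metis nth_take nth_drop less_imp_le le_add1 le_less_trans)
  also have "\<dots> = take a (drop (a * b) \<omega>') ! (i mod a)" by (simp only: t)
  also have "\<dots> = \<omega>' ! i" using i len m idx by (metis nth_take nth_drop less_imp_le le_add1 le_less_trans)
  finally show "\<omega> ! i = \<omega>' ! i" .
qed

lemma position_take: "b < h \<Longrightarrow> position a (take (a * h) \<omega>) b = position a \<omega> b"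
proof -
  assume "b < h"
  then have "a * b + a \<le> a * h" by (metis Suc_leI mult_Suc_right mult_le_mono2 add.commute)
  then have "take a (drop (a * b) (take (a * h) \<omega>)) = take a (drop (a * b) \<omega>)"
    by (simp add: drop_take min_def)
  then show ?thesis by (simp add: position_def)
qed

lemma syndrome_vec_cong: "(\<And>b. b < h \<Longrightarrow> y b = y' b) \<Longrightarrow> syndrome_vec n K q W h y = syndrome_vec n K q W h y'"
  unfolding syndrome_vec_def by (intro eq_vecI) auto

text \<open>Grouped by their values, the elements fall into at most \<open>card S\<close> fibres,
  each contributing either nothing or fewer than N elements.\<close>

lemma card_small_fibres:
  fixes N :: real
  assumes fin: "finite X" "finite S" and f: "f ` X \<subseteq> S" and N: "0 \<le> N"
  shows "real (card {x \<in> X. real (card {x' \<in> X. f x' = f x}) < N}) \<le> real (card S) * N"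
proof -
  define B where "B = {x \<in> X. real (card {x' \<in> X. f x' = f x}) < N}"
  have "B = (\<Union>s\<in>S. {x \<in> B. f x = s})" using f by (auto simp: B_def)
  then have "card B \<le> (\<Sum>s\<in>S. card {x \<in> B. f x = s})"
    using card_UN_le[OF fin(2), of "\<lambda>s. {x \<in> B. f x = s}"] by simp
  then have "real (card B) \<le> (\<Sum>s\<in>S. real (card {x \<in> B. f x = s}))"
    by (metis of_nat_le_iff of_nat_sum)
  also have "\<dots> \<le> (\<Sum>s\<in>S. N)"
  proof (rule sum_mono)
    fix s assume "s \<in> S"
    show "real (card {x \<in> B. f x = s}) \<le> N"
    proof (cases "{x \<in> B. f x = s} = {}")
      case True
      then show ?thesis using N by (metis card.empty of_nat_0)
    next
      case False
      then obtain x where x: "x \<in> B" "f x = s" by blast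
      have "card {x \<in> B. f x = s} \<le> card {x' \<in> X. f x' = f x}"
        using x fin by (intro card_mono) (auto simp: B_def)
      then show ?thesis using x by (simp add: B_def)
    qed
  qed
  finally show ?thesis by (simp add: B_def)
qed

text \<open>Every prefix of length r has \<open>2 ^ (T - r)\<close> continuations. This reconciles
  the T coins supplied with the smaller number of coins that are read.\<close>

lemma prob_coin_strings_take:
  assumes "r \<le> T"
  shows "measure_pmf.prob (coin_strings T) {\<omega>. P (take r \<omega>)}
    = real (card {\<eta>. length \<eta> = r \<and> P \<eta>}) / 2 ^ r"
proof -
  have fin: "finite {\<omega> :: bool list. length \<omega> = t}" for t
    using finite_lists_length_eq[of "UNIV :: bool set" t] by simp
  have card: "card {\<omega> :: bool list. length \<omega> = t} = 2 ^ t" for t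
    using card_lists_length_eq[of "UNIV :: bool set" t] by simp
  have ne: "{\<omega> :: bool list. length \<omega> = T} \<noteq> {}" using card[of T] by (metis card.empty power_not_zero zero_neq_numeral)
  define A where "A = {\<eta>. length \<eta> = r \<and> P \<eta>}"
  define R where "R = {\<rho> :: bool list. length \<rho> = T - r}"
  have eq: "{\<omega>. length \<omega> = T} \<inter> {\<omega>. P (take r \<omega>)} = (\<lambda>(\<eta>, \<rho>). \<eta> @ \<rho>) ` (A \<times> R)"
  proof (intro subset_antisym subsetI)
    fix \<omega> assume "\<omega> \<in> {\<omega>. length \<omega> = T} \<inter> {\<omega>. P (take r \<omega>)}"
    then show "\<omega> \<in> (\<lambda>(\<eta>, \<rho>). \<eta> @ \<rho>) ` (A \<times> R)"
      using assms by (intro image_eqI[of _ _ "(take r \<omega>, drop r \<omega>)"]) (auto simp: A_def R_def)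
  qed (use assms in \<open>auto simp: A_def R_def\<close>)
  have "inj_on (\<lambda>(\<eta>, \<rho>). \<eta> @ \<rho>) (A \<times> R)" by (auto simp: inj_on_def A_def)
  then have "card ({\<omega>. length \<omega> = T} \<inter> {\<omega>. P (take r \<omega>)}) = card A * 2 ^ (T - r)"
    unfolding eq by (simp add: card_image card_cartesian_product R_def card)
  then have "measure_pmf.prob (coin_strings T) {\<omega>. P (take r \<omega>)} = real (card A * 2 ^ (T - r)) / 2 ^ T"
    unfolding coin_strings_def using measure_pmf_of_set[OF ne fin] card by simp
  also have "(2::real) ^ T = 2 ^ r * 2 ^ (T - r)" using assms by (simp add: power_add[symmetric])
  finally show ?thesis by (simp add: A_def)
qed

text \<open>The syndrome is that of a random position set, so it is hit in proportion to the size of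
  its fibre. Strings in fibres smaller than N number at most q^K N, at most one percent of all
  strings; each of the others yields at least N coset points.\<close>

theorem code_mat_locally_dense_prob:
  assumes p: "1 \<le> p" and \<alpha>: "0 < \<alpha>" "\<alpha> < 1" and d: "0 < d" "real d powr p < 2 * real K" "int d < W"
    and q: "prime q" "h * 2 ^ a \<le> q" "2 * K \<le> q" and K: "1 \<le> K"
    and h: "real h \<le> (\<alpha> * real d) powr p"
    and N: "0 < N" "100 * (real q ^ K * N) \<le> 2 ^ (a * h)" and T: "a * h \<le> T"
  shows "measure_pmf.prob (coin_strings T) {\<omega>. locally_dense p \<alpha> d N (h * 2 ^ a + K) (h * 2 ^ a + K)
    (code_mat (h * 2 ^ a) K q W, syndrome_vec (h * 2 ^ a) K q W h (position a \<omega>))} \<ge> 0.99"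
proof -
  define n where "n = h * 2 ^ a"
  define X where "X = {\<eta> :: bool list. length \<eta> = a * h}"
  define J where "J \<eta> = position a \<eta> ` {..<h}" for \<eta>
  define f where "f \<eta> = syndrome q K (J \<eta>)" for \<eta>
  define S where "S = {xs. set xs \<subseteq> {..<q} \<and> length xs = K}"
  define bad where "bad \<eta> \<longleftrightarrow> real (card {\<eta>' \<in> X. f \<eta>' = f \<eta>}) < N" for \<eta>
  have finX: "finite X" unfolding X_def using finite_lists_length_eq[of "UNIV :: bool set"] by simp
  have cardX: "card X = 2 ^ (a * h)" unfolding X_def using card_lists_length_eq[of "UNIV :: bool set"] by simp
  have S: "finite S" "card S = q ^ K" unfolding S_def
    by (auto simp: finite_lists_length_eq card_lists_length_eq)
  have fS: "f ` X \<subseteq> S" using prime_gt_0_nat[OF q(1)] by (auto simp: f_def syndrome_def S_def)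
  have good: "locally_dense p \<alpha> d N (n + K) (n + K)
      (code_mat n K q W, syndrome_vec n K q W h (position a \<omega>))"
    if \<omega>: "\<not> bad (take (a * h) \<omega>)" for \<omega>
  proof -
    define \<eta> where "\<eta> = take (a * h) \<omega>"
    define F where "F = J ` {\<eta>' \<in> X. f \<eta>' = f \<eta>}"
    \<comment> \<open>Positions in the h blocks depend on the first a h coins only.\<close>
    have sv: "syndrome_vec n K q W h (position a \<omega>) = syndrome_vec n K q W h (position a \<eta>)"
      unfolding \<eta>_def by (intro syndrome_vec_cong) (simp add: position_take)
    have "inj_on J X" unfolding J_def X_def by (rule inj_onI, rule position_image_inj) auto
    then have "card F = card {\<eta>' \<in> X. f \<eta>' = f \<eta>}"
      unfolding F_def by (intro card_image) (auto simp: inj_on_def)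
    then have "N \<le> real (card F)" using \<omega> by (simp add: bad_def \<eta>_def)
    also have "card F \<le> card ((\<lambda>v. real_vec (v - syndrome_vec n K q W h (position a \<eta>))) ` lattice (code_mat n K q W)
        \<inter> lp_ball p (n + K) (\<alpha> * real d))"
    proof (rule card_coset_ball[OF p position_inj])
      show "position a \<eta> ` {..<h} = J \<eta>" by (simp add: J_def)
      show "J' \<subseteq> {..<n} \<and> card J' = h \<and> syndrome q K J' = syndrome q K (J \<eta>)" if "J' \<in> F" for J'
      proof -
        obtain \<eta>' where "J' = position a \<eta>' ` {..<h}" "syndrome q K J' = syndrome q K (J \<eta>)"
          using \<open>J' \<in> F\<close> by (auto simp: F_def J_def f_def)
        then show ?thesis
          using position_image_subset[of a \<eta>' h] by (simp add: n_def card_image position_inj)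
      qed
    qed (use \<alpha> h in auto)
    finally have "N \<le> real (card ((\<lambda>v. real_vec (v - syndrome_vec n K q W h (position a \<omega>))) ` lattice (code_mat n K q W)
        \<inter> lp_ball p (n + K) (\<alpha> * real d)))" unfolding sv by simp
    moreover have "real d < lambda1 p (lattice (code_mat n K q W))"
      using lambda1_code_mat[OF p q(1) _ q(3) K d(2,3)] q(2) by (simp add: n_def)
    moreover have "code_mat n K q W \<in> carrier_mat (n + K) (n + K)" by (simp add: code_mat_def)
    moreover have "syndrome_vec n K q W h (position a \<omega>) \<in> carrier_vec (n + K)" by (simp add: syndrome_vec_def)
    ultimately show ?thesis unfolding locally_dense_def using p \<alpha> d(1) N(1) K by simp
  qed
  have "real (card {\<eta> \<in> X. bad \<eta>}) \<le> real (card S) * N"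
    unfolding bad_def by (rule card_small_fibres[OF finX S(1) fS]) (use N in simp)
  then have "100 * real (card {\<eta> \<in> X. bad \<eta>}) \<le> 2 ^ (a * h)" using N(2) S(2) by simp
  moreover have "card X = card {\<eta> \<in> X. bad \<eta>} + card {\<eta> \<in> X. \<not> bad \<eta>}"
    by (subst card_Un_disjoint[symmetric]) (use finX in \<open>auto intro: arg_cong[of _ _ card]\<close>)
  then have "real (card X) = real (card {\<eta> \<in> X. bad \<eta>}) + real (card {\<eta> \<in> X. \<not> bad \<eta>})"
    by simp
  ultimately have c: "0.99 * 2 ^ (a * h) \<le> real (card {\<eta> \<in> X. \<not> bad \<eta>})"
    unfolding cardX by simp
  have "0.99 \<le> real (card {\<eta>. length \<eta> = a * h \<and> \<not> bad \<eta>}) / 2 ^ (a * h)"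
    using c by (simp add: X_def field_simps)
  also have "\<dots> = measure_pmf.prob (coin_strings T) {\<omega>. \<not> bad (take (a * h) \<omega>)}"
    using prob_coin_strings_take[OF T, of "\<lambda>\<eta>. \<not> bad \<eta>"] by simp
  also have "\<dots> \<le> measure_pmf.prob (coin_strings T) {\<omega>. locally_dense p \<alpha> d N (n + K) (n + K)
    (code_mat n K q W, syndrome_vec n K q W h (position a \<omega>))}"
    using good by (intro measure_pmf.finite_measure_mono) auto
  finally show ?thesis unfolding n_def .
qed

section \<open>Running time of programs\<close>

text \<open>A total-correctness triple with a time bound, for one initial state.\<close>

definition runs :: "(nat \<Rightarrow> int) \<Rightarrow> com \<Rightarrow> state \<Rightarrow> nat \<Rightarrow> (state \<Rightarrow> bool) \<Rightarrow> bool" where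
  "runs Q c \<sigma> T R \<longleftrightarrow> (\<exists>t \<tau>. exec Q c \<sigma> t \<tau> \<and> t \<le> T \<and> R \<tau>)"

lemma runs_mono:
  "runs Q c \<sigma> T R \<Longrightarrow> T \<le> T' \<Longrightarrow> (\<And>\<tau>. R \<tau> \<Longrightarrow> R' \<tau>) \<Longrightarrow> runs Q c \<sigma> T' R'"
  unfolding runs_def using order_trans by blast

lemma runs_Seq:
  "runs Q c \<sigma> T R \<Longrightarrow> (\<And>\<tau>. R \<tau> \<Longrightarrow> runs Q c' \<tau> T' R') \<Longrightarrow> runs Q (Seq c c') \<sigma> (T + T') R'"
  unfolding runs_def by (meson add_mono exec.Seq)

primrec scalars_written :: "com \<Rightarrow> string set" where
  "scalars_written Skip = {}"
| "scalars_written (Assign x e) = {x}"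
| "scalars_written (Store a e f) = {}"
| "scalars_written (Flip x) = {x}"
| "scalars_written (Query x e) = {x}"
| "scalars_written (Seq c d) = scalars_written c \<union> scalars_written d"
| "scalars_written (If b c d) = scalars_written c \<union> scalars_written d"
| "scalars_written (While b c) = scalars_written c"

primrec arrays_written :: "com \<Rightarrow> string set" where
  "arrays_written Skip = {}"
| "arrays_written (Assign x e) = {}"
| "arrays_written (Store a e f) = {a}"
| "arrays_written (Flip x) = {}"
| "arrays_written (Query x e) = {}"
| "arrays_written (Seq c d) = arrays_written c \<union> arrays_written d"
| "arrays_written (If b c d) = arrays_written c \<union> arrays_written d"
| "arrays_written (While b c) = arrays_written c"

primrec flip_free :: "com \<Rightarrow> bool" where
  "flip_free Skip = True"
| "flip_free (Assign x e) = True"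
| "flip_free (Store a e f) = True"
| "flip_free (Flip x) = False"
| "flip_free (Query x e) = True"
| "flip_free (Seq c d) = (flip_free c \<and> flip_free d)"
| "flip_free (If b c d) = (flip_free c \<and> flip_free d)"
| "flip_free (While b c) = flip_free c"

text \<open>A frame condition read off the program text: specifications of subprograms need to
  mention only what they change.\<close>

definition framed :: "com \<Rightarrow> state \<Rightarrow> state \<Rightarrow> bool" where
  "framed c \<sigma> \<tau> \<longleftrightarrow> (\<forall>x. x \<notin> scalars_written c \<longrightarrow> scal \<tau> x = scal \<sigma> x) \<and>
    (\<forall>a. a \<notin> arrays_written c \<longrightarrow> arr \<tau> a = arr \<sigma> a) \<and> (flip_free c \<longrightarrow> coins \<tau> = coins \<sigma>)"

lemma framed_scal: "framed c \<sigma> \<tau> \<Longrightarrow> x \<notin> scalars_written c \<Longrightarrow> scal \<tau> x = scal \<sigma> x"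
  and framed_arr: "framed c \<sigma> \<tau> \<Longrightarrow> a \<notin> arrays_written c \<Longrightarrow> arr \<tau> a = arr \<sigma> a"
  and framed_coins: "framed c \<sigma> \<tau> \<Longrightarrow> flip_free c \<Longrightarrow> coins \<tau> = coins \<sigma>"
  by (simp_all add: framed_def)

lemma exec_framed: "exec Q c \<sigma> t \<tau> \<Longrightarrow> framed c \<sigma> \<tau>"
  by (induction rule: exec.induct) (auto simp: framed_def)

lemma runs_framed: "runs Q c \<sigma> T R \<Longrightarrow> runs Q c \<sigma> T (\<lambda>\<tau>. R \<tau> \<and> framed c \<sigma> \<tau>)"
  unfolding runs_def using exec_framed by blast

lemma framed_trans: "framed c \<sigma> \<tau> \<Longrightarrow> framed c \<tau> \<tau>' \<Longrightarrow> framed c \<sigma> \<tau>'"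
  by (simp add: framed_def)

lemma framed_refl: "framed c \<sigma> \<sigma>"
  by (simp add: framed_def)

text \<open>The ghost index i counts rounds, so termination and the factor \<open>Suc n\<close> (n
  rounds and the final test of the guard) come from one induction. The frame relative to the state
  before the loop spares the invariant all unmodified variables.\<close>

lemma runs_While:
  assumes "I 0 \<sigma>"
    and step: "\<And>i \<tau>. i < n \<Longrightarrow> I i \<tau> \<Longrightarrow> framed c \<sigma> \<tau> \<Longrightarrow>
      bval b \<tau> \<and> bcost b \<tau> \<le> G \<and> runs Q c \<tau> T (I (Suc i))"
    and stop: "\<And>\<tau>. I n \<tau> \<Longrightarrow> framed c \<sigma> \<tau> \<Longrightarrow> \<not> bval b \<tau> \<and> bcost b \<tau> \<le> G \<and> R \<tau>"
  shows "runs Q (While b c) \<sigma> (Suc n * (G + T)) R"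
proof -
  have "runs Q (While b c) \<tau> (Suc (n - i) * (G + T)) R"
    if "i \<le> n" "I i \<tau>" "framed c \<sigma> \<tau>" for i \<tau>
    using that
  proof (induction "n - i" arbitrary: i \<tau>)
    case 0
    then have "\<not> bval b \<tau> \<and> bcost b \<tau> \<le> G \<and> R \<tau>" using stop by simp
    then show ?case unfolding runs_def using exec.While_False[of b \<tau> Q c]
      by (intro exI[of _ "bcost b \<tau>"] exI[of _ \<tau>]) (auto intro: trans_le_add1)
  next
    case (Suc d)
    then have i: "i < n" by simp
    from step[OF this Suc.prems(2,3)] obtain t \<tau>' where b: "bval b \<tau>" "bcost b \<tau> \<le> G"
      and c: "exec Q c \<tau> t \<tau>'" "t \<le> T" "I (Suc i) \<tau>'" unfolding runs_def by blast
    have "framed c \<sigma> \<tau>'" using framed_trans[OF Suc.prems(3) exec_framed[OF c(1)]] .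
    then have "runs Q (While b c) \<tau>' (Suc (n - Suc i) * (G + T)) R"
      using Suc.hyps c(3) i by (intro Suc.hyps(1)) auto
    then obtain t' \<tau>'' where w: "exec Q (While b c) \<tau>' t' \<tau>''" "t' \<le> Suc (n - Suc i) * (G + T)" "R \<tau>''"
      unfolding runs_def by blast
    have "Suc (n - i) = Suc (Suc (n - Suc i))" using i by simp
    then have "Suc (n - i) * (G + T) = (G + T) + Suc (n - Suc i) * (G + T)" by (simp only: mult_Suc)
    then have "bcost b \<tau> + t + t' \<le> Suc (n - i) * (G + T)" using b c(2) w(2) by linarith
    then show ?case unfolding runs_def using exec.While_True[OF b(1) c(1) w(1)] w(3) by blast
  qed
  from this[of 0 \<sigma>] assms(1) show ?thesis by (simp add: framed_refl)
qed

section \<open>Cost bounds for straight-line programs\<close>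

primrec asize :: "aexp \<Rightarrow> nat" where
  "asize (Const c) = 1"
| "asize (Var x) = 1"
| "asize (Elem a e) = 1 + asize e"
| "asize (Add e f) = 1 + asize e + asize f"
| "asize (Sub e f) = 1 + asize e + asize f"
| "asize (Mul e f) = 1 + asize e + asize f"
| "asize (Div e f) = 1 + asize e + asize f"
| "asize (Mod e f) = 1 + asize e + asize f"

text \<open>One bound M for the cost of all intermediate values reduces the running time to program
  size times M. The recursion unfolds into one inequality per subexpression.\<close>

primrec acost_ok :: "nat \<Rightarrow> aexp \<Rightarrow> state \<Rightarrow> bool" where
  "acost_ok M (Const c) \<sigma> = (int_cost c \<le> M)"
| "acost_ok M (Var x) \<sigma> = (int_cost (scal \<sigma> x) \<le> M)"
| "acost_ok M (Elem a e) \<sigma> = (acost_ok M e \<sigma> \<and> int_cost (aval (Elem a e) \<sigma>) \<le> M)"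
| "acost_ok M (Add e f) \<sigma> = (acost_ok M e \<sigma> \<and> acost_ok M f \<sigma> \<and> int_cost (aval (Add e f) \<sigma>) \<le> M)"
| "acost_ok M (Sub e f) \<sigma> = (acost_ok M e \<sigma> \<and> acost_ok M f \<sigma> \<and> int_cost (aval (Sub e f) \<sigma>) \<le> M)"
| "acost_ok M (Mul e f) \<sigma> = (acost_ok M e \<sigma> \<and> acost_ok M f \<sigma> \<and> int_cost (aval (Mul e f) \<sigma>) \<le> M)"
| "acost_ok M (Div e f) \<sigma> = (acost_ok M e \<sigma> \<and> acost_ok M f \<sigma> \<and> int_cost (aval (Div e f) \<sigma>) \<le> M)"
| "acost_ok M (Mod e f) \<sigma> = (acost_ok M e \<sigma> \<and> acost_ok M f \<sigma> \<and> int_cost (aval (Mod e f) \<sigma>) \<le> M)"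

lemma acost_le: "acost_ok M e \<sigma> \<Longrightarrow> acost e \<sigma> \<le> asize e * M"
  by (induction e) (auto simp: add_mult_distrib)

lemma acost_ok_pos: "acost_ok M e \<sigma> \<Longrightarrow> M \<ge> 1"
  by (induction e) (auto simp: int_cost_def)

primrec bsize :: "bexp \<Rightarrow> nat" where
  "bsize (Less e f) = 1 + asize e + asize f"
| "bsize (Not b) = 1 + bsize b"
| "bsize (And b c) = 1 + bsize b + bsize c"

primrec bcost_ok :: "nat \<Rightarrow> bexp \<Rightarrow> state \<Rightarrow> bool" where
  "bcost_ok M (Less e f) \<sigma> = (acost_ok M e \<sigma> \<and> acost_ok M f \<sigma>)"
| "bcost_ok M (Not b) \<sigma> = bcost_ok M b \<sigma>"
| "bcost_ok M (And b c) \<sigma> = (bcost_ok M b \<sigma> \<and> bcost_ok M c \<sigma>)"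

lemma bcost_le: "bcost_ok M b \<sigma> \<Longrightarrow> bcost b \<sigma> \<le> bsize b * M \<and> M \<ge> 1"
proof (induction b)
  case (Less e f)
  then show ?case
    using acost_le[of M e \<sigma>] acost_le[of M f \<sigma>] acost_ok_pos[of M e \<sigma>]
    by (simp add: add_mult_distrib del: acost.simps)
qed (auto simp: add_mult_distrib)

primrec loop_free :: "com \<Rightarrow> bool" where
  "loop_free Skip = True"
| "loop_free (Assign x e) = True"
| "loop_free (Store a e f) = True"
| "loop_free (Flip x) = False"
| "loop_free (Query x e) = False"
| "loop_free (Seq c d) = (loop_free c \<and> loop_free d)"
| "loop_free (If b c d) = (loop_free c \<and> loop_free d)"
| "loop_free (While b c) = False"

text \<open>Symbolic execution: final states and costs of straight-line blocks are obtained by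
  simplification instead of by the rules of \<open>exec\<close>.\<close>

primrec after :: "com \<Rightarrow> state \<Rightarrow> state" where
  "after Skip \<sigma> = \<sigma>"
| "after (Assign x e) \<sigma> = \<sigma>\<lparr>scal := (scal \<sigma>)(x := aval e \<sigma>)\<rparr>"
| "after (Store a e f) \<sigma> = \<sigma>\<lparr>arr := (arr \<sigma>)(a := (arr \<sigma> a)(aval e \<sigma> := aval f \<sigma>))\<rparr>"
| "after (Flip x) \<sigma> = \<sigma>"
| "after (Query x e) \<sigma> = \<sigma>"
| "after (Seq c d) \<sigma> = after d (after c \<sigma>)"
| "after (If b c d) \<sigma> = (if bval b \<sigma> then after c \<sigma> else after d \<sigma>)"
| "after (While b c) \<sigma> = \<sigma>"

primrec csize :: "com \<Rightarrow> nat" where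
  "csize Skip = 1"
| "csize (Assign x e) = 1 + asize e"
| "csize (Store a e f) = 1 + asize e + asize f"
| "csize (Flip x) = 1"
| "csize (Query x e) = 1"
| "csize (Seq c d) = csize c + csize d"
| "csize (If b c d) = bsize b + csize c + csize d"
| "csize (While b c) = 1"

primrec cost_ok :: "nat \<Rightarrow> com \<Rightarrow> state \<Rightarrow> bool" where
  "cost_ok M Skip \<sigma> = (M \<ge> 1)"
| "cost_ok M (Assign x e) \<sigma> = acost_ok M e \<sigma>"
| "cost_ok M (Store a e f) \<sigma> = (acost_ok M e \<sigma> \<and> acost_ok M f \<sigma>)"
| "cost_ok M (Flip x) \<sigma> = False"
| "cost_ok M (Query x e) \<sigma> = False"
| "cost_ok M (Seq c d) \<sigma> = (cost_ok M c \<sigma> \<and> cost_ok M d (after c \<sigma>))"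
| "cost_ok M (If b c d) \<sigma> = (bcost_ok M b \<sigma> \<and> (if bval b \<sigma> then cost_ok M c \<sigma> else cost_ok M d \<sigma>))"
| "cost_ok M (While b c) \<sigma> = False"

lemma runs_loop_free:
  assumes "loop_free c" "cost_ok M c \<sigma>" "R (after c \<sigma>)"
  shows "runs Q c \<sigma> (csize c * M) R"
proof -
  have "\<exists>t. exec Q c \<sigma> t (after c \<sigma>) \<and> t \<le> csize c * M"
    using assms(1,2)
  proof (induction c arbitrary: \<sigma>)
    case Skip
    then show ?case using exec.Skip by (intro exI[of _ 1]) auto
  next
    case (Assign x e)
    then show ?case using exec.Assign[of Q x e \<sigma>] acost_le[of M e \<sigma>] acost_ok_pos[of M e \<sigma>]
      by (intro exI[of _ "1 + acost e \<sigma>"]) (simp add: add_mult_distrib del: acost.simps)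
  next
    case (Store a e f)
    then show ?case using exec.Store[of Q a e f \<sigma>] acost_le[of M e \<sigma>] acost_le[of M f \<sigma>] acost_ok_pos[of M e \<sigma>]
      by (intro exI[of _ "1 + acost e \<sigma> + acost f \<sigma>"]) (simp add: add_mult_distrib del: acost.simps)
  next
    case (Seq c d)
    then obtain t t' where "exec Q c \<sigma> t (after c \<sigma>)" "t \<le> csize c * M"
      "exec Q d (after c \<sigma>) t' (after d (after c \<sigma>))" "t' \<le> csize d * M" by fastforce
    then show ?case using exec.Seq by (intro exI[of _ "t + t'"]) (auto simp: add_mult_distrib)
  next
    case (If b c d)
    have b: "bcost b \<sigma> \<le> bsize b * M" using If.prems bcost_le by auto
    show ?case
    proof (cases "bval b \<sigma>")
      case True
      then obtain t where "exec Q c \<sigma> t (after c \<sigma>)" "t \<le> csize c * M" using If by fastforce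
      then show ?thesis using exec.If_True[OF True] True b
        by (intro exI[of _ "bcost b \<sigma> + t"]) (auto simp: add_mult_distrib)
    next
      case False
      then obtain t where "exec Q d \<sigma> t (after d \<sigma>)" "t \<le> csize d * M" using If by fastforce
      then show ?thesis using exec.If_False[OF False] False b
        by (intro exI[of _ "bcost b \<sigma> + t"]) (auto simp: add_mult_distrib)
    qed
  qed auto
  then show ?thesis unfolding runs_def using assms(3) by blast
qed

lemma int_cost_le_power: "\<bar>v\<bar> \<le> 2 ^ Z \<Longrightarrow> int_cost v \<le> Z + 2"
proof -
  assume v: "\<bar>v\<bar> \<le> 2 ^ Z"
  also have "(2::int) ^ Z < 2 ^ Suc Z" by simp
  finally have "bitlen \<bar>v\<bar> \<le> int (Suc Z)" by (subst bitlen_le_iff_power) (simp_all only: nat_int of_nat_0_le_iff simp_thms)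
  then show ?thesis by (simp add: int_cost_def)
qed

text \<open>Deliberately crude: a number is charged by its value in place of its logarithm. This is
  affordable because most quantities in the program are polynomial in m and k.\<close>

lemma int_cost_le: "\<bar>v\<bar> \<le> int N \<Longrightarrow> int_cost v \<le> N + 2"
proof (rule int_cost_le_power)
  assume "\<bar>v\<bar> \<le> int N"
  also have "int N \<le> int (2 ^ N)" using less_exp[of N] by (simp only: of_nat_le_iff)
  finally show "\<bar>v\<bar> \<le> 2 ^ N" by simp
qed

text \<open>The exceptions are powers such as g^u and j^e, which may be exponentially large;
  \<open>B \<le> 2 ^ B\<close> still gives them polynomial bit length.\<close>

lemma int_cost_power: "B * j \<le> Z \<Longrightarrow> int_cost (int B ^ j) \<le> Z + 2"
proof (rule int_cost_le_power)
  assume Z: "B * j \<le> Z"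
  have "B ^ j \<le> (2 ^ B) ^ j" using less_exp[of B] by (intro power_mono) auto
  also have "\<dots> = 2 ^ (B * j)" by (simp add: power_mult)
  also have "\<dots> \<le> 2 ^ Z" using Z by (intro power_increasing) auto
  finally have "int (B ^ j) \<le> int (2 ^ Z)" by (simp only: of_nat_le_iff)
  then show "\<bar>int B ^ j\<bar> \<le> 2 ^ Z" by simp
qed

definition power_loop :: "string \<Rightarrow> string \<Rightarrow> string \<Rightarrow> string \<Rightarrow> com" where
  "power_loop x b e i = Seq (Seq (Assign x (Const 1)) (Assign i (Const 0)))
    (While (Less (Var i) (Var e))
      (Seq (Assign x (Mul (Var x) (Var b))) (Assign i (Add (Var i) (Const 1)))))"

definition power_time :: "nat \<Rightarrow> nat \<Rightarrow> nat" where
  "power_time B N = (N + 2) * (20 * (B * N + B + N + 3))"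

lemma runs_power_loop:
  assumes dist: "distinct [x, b, e, i]" and b: "scal \<sigma> b = int B" and e: "scal \<sigma> e = int N"
  shows "runs Q (power_loop x b e i) \<sigma> (power_time B N) (\<lambda>\<tau>. scal \<tau> x = int B ^ N)"
proof -
  define Z where "Z = B * N + B + N + 1"
  have Z: "N + 1 \<le> Z" "B \<le> Z" by (auto simp: Z_def)
  define M where "M = Z + 2"
  have small: "int_cost v \<le> M" if "\<bar>v\<bar> \<le> int Z" for v
    unfolding M_def using that by (rule int_cost_le)
  have big: "int_cost (int B ^ j) \<le> M" if "j \<le> N" for j
    unfolding M_def using mult_le_mono2[OF that, of B] by (intro int_cost_power) (unfold Z_def, linarith)
  define body where "body = Seq (Assign x (Mul (Var x) (Var b))) (Assign i (Add (Var i) (Const 1)))"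
  have "runs Q (power_loop x b e i) \<sigma> (csize (Seq (Assign x (Const 1)) (Assign i (Const 0))) * M
      + Suc N * (bsize (Less (Var i) (Var e)) * M + csize body * M)) (\<lambda>\<tau>. scal \<tau> x = int B ^ N)"
    unfolding power_loop_def body_def[symmetric]
  proof (rule runs_Seq)
    show "runs Q (Seq (Assign x (Const 1)) (Assign i (Const 0))) \<sigma>
      (csize (Seq (Assign x (Const 1)) (Assign i (Const 0))) * M)
      (\<lambda>\<tau>. scal \<tau> b = int B \<and> scal \<tau> e = int N \<and> scal \<tau> x = 1 \<and> scal \<tau> i = 0)"
      using dist b e by (intro runs_loop_free) (use Z in \<open>auto intro!: small\<close>)
  next
    fix \<tau> :: state assume \<tau>: "scal \<tau> b = int B \<and> scal \<tau> e = int N \<and> scal \<tau> x = 1 \<and> scal \<tau> i = 0"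
    show "runs Q (While (Less (Var i) (Var e)) body) \<tau>
      (Suc N * (bsize (Less (Var i) (Var e)) * M + csize body * M)) (\<lambda>\<tau>. scal \<tau> x = int B ^ N)"
    proof (rule runs_While[where I = "\<lambda>j \<tau>. scal \<tau> i = int j \<and> scal \<tau> x = int B ^ j"])
      show "scal \<tau> i = int 0 \<and> scal \<tau> x = int B ^ 0" using \<tau> by simp
    next
      fix j and \<tau>' :: state assume j: "j < N" and I: "scal \<tau>' i = int j \<and> scal \<tau>' x = int B ^ j" and f: "framed body \<tau> \<tau>'"
      have be: "scal \<tau>' b = int B" "scal \<tau>' e = int N"
        using f \<tau> dist by (auto simp: framed_scal body_def)
      have bc: "bcost (Less (Var i) (Var e)) \<tau>' \<le> bsize (Less (Var i) (Var e)) * M"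
        using I be j by (intro bcost_le[THEN conjunct1]) (use Z in \<open>auto intro!: small\<close>)
      have pw: "int B ^ j * int B = int B ^ Suc j" by simp
      have "runs Q body \<tau>' (csize body * M) (\<lambda>\<tau>. scal \<tau> i = int (Suc j) \<and> scal \<tau> x = int B ^ Suc j)"
        using I be j dist big[of j] big[of "Suc j"] unfolding body_def
        by (intro runs_loop_free) (use Z in \<open>auto intro!: small simp: pw simp del: power_Suc\<close>)
      then show "bval (Less (Var i) (Var e)) \<tau>' \<and> bcost (Less (Var i) (Var e)) \<tau>' \<le> bsize (Less (Var i) (Var e)) * M
        \<and> runs Q body \<tau>' (csize body * M) (\<lambda>\<tau>. scal \<tau> i = int (Suc j) \<and> scal \<tau> x = int B ^ Suc j)"
        using bc I be j by simp
    next
      fix \<tau>' :: state assume I: "scal \<tau>' i = int N \<and> scal \<tau>' x = int B ^ N" and f: "framed body \<tau> \<tau>'"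
      have be: "scal \<tau>' e = int N"
        using f \<tau> dist by (auto simp: framed_scal body_def)
      have "bcost (Less (Var i) (Var e)) \<tau>' \<le> bsize (Less (Var i) (Var e)) * M"
        using I be by (intro bcost_le[THEN conjunct1]) (use Z in \<open>auto intro!: small\<close>)
      then show "\<not> bval (Less (Var i) (Var e)) \<tau>' \<and> bcost (Less (Var i) (Var e)) \<tau>' \<le> bsize (Less (Var i) (Var e)) * M
        \<and> scal \<tau>' x = int B ^ N" using I be by simp
    qed
  qed
  moreover have "csize (Seq (Assign x (Const 1)) (Assign i (Const 0))) * M
      + Suc N * (bsize (Less (Var i) (Var e)) * M + csize body * M) \<le> power_time B N"
  proof -
    \<comment> \<open>4 is the size of the initialisation, 11 that of guard and body. The numerical
      factors in the time bounds are such sizes, rounded up.\<close>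
    have "4 * M + Suc N * (11 * M) \<le> (N + 2) * (20 * M)" by (simp add: algebra_simps)
    then show ?thesis unfolding power_time_def body_def M_def Z_def
      by (simp add: algebra_simps)
  qed
  ultimately show ?thesis by (rule runs_mono)
qed

section \<open>The program\<close>

lemma written_power_loop [simp]:
  "scalars_written (power_loop x b e i) = {x, i}" "arrays_written (power_loop x b e i) = {}"
  "flip_free (power_loop x b e i)"
  by (auto simp: power_loop_def)

section \<open>Rounded-up binary logarithms\<close>

definition clog :: "nat \<Rightarrow> nat" where
  "clog b = (LEAST l. b \<le> 2 ^ l)"

lemma clog: "b \<le> 2 ^ clog b"
  unfolding clog_def by (rule LeastI[of _ b]) (simp add: less_exp less_imp_le)

lemma clog_minimal: "l < clog b \<Longrightarrow> 2 ^ l < b"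
  unfolding clog_def using not_less_Least not_le by blast

lemma clog_le: "clog b \<le> b"
  unfolding clog_def by (rule Least_le) (simp add: less_exp less_imp_le)

text \<open>L is the unit of all later sizes. With B = 2m(1 + \<gamma>k) \<le> 2^L, the bound N is
  at most 2^(3DL), block lengths are powers of 2^L, and an irrational p is approximated to a
  precision of order 2^(-L).\<close>

definition log_prog :: "nat \<Rightarrow> com" where
  "log_prog \<gamma> = Seq
     (Seq (Assign ''g'' (Mul (Const (int \<gamma>)) (Var ''k''))) (Seq (Assign ''x'' (Const 1)) (Assign ''L'' (Const 0))))
     (While (Less (Var ''x'') (Mul (Mul (Const 2) (Var ''m'')) (Add (Const 1) (Var ''g''))))
       (Seq (Assign ''x'' (Mul (Const 2) (Var ''x''))) (Assign ''L'' (Add (Var ''L'') (Const 1)))))"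

definition log_time :: "nat \<Rightarrow> nat \<Rightarrow> nat \<Rightarrow> nat" where
  "log_time \<gamma> m k = (let b = 2 * m * (1 + \<gamma> * k) in (b + 2) * (30 * (2 * b + 2 * m + k + \<gamma> + \<gamma> * k + 9)))"

lemma runs_log_prog:
  assumes mk: "scal \<sigma> ''m'' = int m" "scal \<sigma> ''k'' = int k"
  shows "runs Q (log_prog \<gamma>) \<sigma> (log_time \<gamma> m k)
    (\<lambda>\<tau>. scal \<tau> ''g'' = int (\<gamma> * k) \<and> scal \<tau> ''L'' = int (clog (2 * m * (1 + \<gamma> * k))) \<and>
      scal \<tau> ''x'' = 2 ^ clog (2 * m * (1 + \<gamma> * k)))"
proof -
  define b where "b = 2 * m * (1 + \<gamma> * k)"
  define Z where "Z = 2 * b + 2 * m + k + \<gamma> + \<gamma> * k + 7"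
  define M where "M = Z + 2"
  define g where "g = \<gamma> * k"
  have gi: "int \<gamma> * int k = int g" by (simp add: g_def)
  have bi: "2 * int m * (1 + int g) = int b" by (simp add: g_def b_def algebra_simps)
  have Z: "2 * b + 7 \<le> Z" "2 * m + 7 \<le> Z" "k + 7 \<le> Z" "\<gamma> + 7 \<le> Z" "g + 7 \<le> Z" by (simp_all add: Z_def g_def)
  have small: "int_cost v \<le> M" if "\<bar>v\<bar> \<le> int Z" for v
    unfolding M_def using that by (rule int_cost_le)
  define pre where "pre = Seq (Assign ''g'' (Mul (Const (int \<gamma>)) (Var ''k''))) (Seq (Assign ''x'' (Const 1)) (Assign ''L'' (Const 0)))"
  define body where "body = Seq (Assign ''x'' (Mul (Const 2) (Var ''x''))) (Assign ''L'' (Add (Var ''L'') (Const 1)))"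
  define cond where "cond = Less (Var ''x'') (Mul (Mul (Const 2) (Var ''m'')) (Add (Const 1) (Var ''g'')))"
  define R :: "state \<Rightarrow> bool" where "R = (\<lambda>\<tau>. scal \<tau> ''g'' = int (\<gamma> * k) \<and> scal \<tau> ''L'' = int (clog (2 * m * (1 + \<gamma> * k))) \<and>
      scal \<tau> ''x'' = 2 ^ clog (2 * m * (1 + \<gamma> * k)))"
  have "runs Q (log_prog \<gamma>) \<sigma> (csize pre * M + Suc (clog b) * (bsize cond * M + csize body * M)) R"
    unfolding log_prog_def pre_def[symmetric] body_def[symmetric] cond_def[symmetric]
  proof (rule runs_Seq)
    show "runs Q pre \<sigma> (csize pre * M)
      (\<lambda>\<tau>. scal \<tau> ''m'' = int m \<and> scal \<tau> ''g'' = int g \<and> scal \<tau> ''x'' = 1 \<and> scal \<tau> ''L'' = 0)"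
      using mk Z unfolding pre_def by (intro runs_loop_free) (auto intro!: small simp: gi)
  next
    fix \<tau> :: state
    assume \<tau>: "scal \<tau> ''m'' = int m \<and> scal \<tau> ''g'' = int g \<and> scal \<tau> ''x'' = 1 \<and> scal \<tau> ''L'' = 0"
    define I :: "nat \<Rightarrow> state \<Rightarrow> bool" where "I j \<tau> \<longleftrightarrow> scal \<tau> ''x'' = int (2 ^ j) \<and> scal \<tau> ''L'' = int j" for j \<tau>
    show "runs Q (While cond body) \<tau> (Suc (clog b) * (bsize cond * M + csize body * M)) R"
    proof (rule runs_While[where I = I])
      show "I 0 \<tau>" using \<tau> by (simp add: I_def)
    next
      fix j and \<tau>' :: state assume j: "j < clog b" and I: "I j \<tau>'" and f: "framed body \<tau> \<tau>'"
      have mg: "scal \<tau>' ''m'' = int m" "scal \<tau>' ''g'' = int g"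
        using f \<tau> by (auto simp: framed_scal body_def)
      have lt: "2 ^ j < b" using j by (rule clog_minimal)
      have lti: "(2::int) ^ j < int b" using lt by (metis of_nat_less_iff of_nat_numeral of_nat_power)
      have lti2: "2 * (2::int) ^ j \<le> int Z" using lti Z(1) by linarith
      have jb: "j < b" using j clog_le[of b] by linarith
      have "bcost cond \<tau>' \<le> bsize cond * M"
        using I mg Z lt lti unfolding cond_def I_def
        by (intro bcost_le[THEN conjunct1]) (auto intro!: small simp: bi)
      moreover have "runs Q body \<tau>' (csize body * M) (I (Suc j))"
        using I mg Z lt lti2 jb unfolding body_def I_def
        by (intro runs_loop_free) (auto intro!: small)
      ultimately show "bval cond \<tau>' \<and> bcost cond \<tau>' \<le> bsize cond * M \<and> runs Q body \<tau>' (csize body * M) (I (Suc j))"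
        using I mg lti by (simp add: cond_def I_def bi)
    next
      fix \<tau>' :: state assume I: "I (clog b) \<tau>'" and f: "framed body \<tau> \<tau>'"
      have mg: "scal \<tau>' ''m'' = int m" "scal \<tau>' ''g'' = int g"
        using f \<tau> by (auto simp: framed_scal body_def)
      have ge: "int b \<le> 2 ^ clog b" using clog[of b] by (metis of_nat_le_iff of_nat_numeral of_nat_power)
      \<comment> \<open>The last test of the guard sees an x that has overshot b by at most a factor
        2; the summand 1 covers \<open>b = 0\<close>.\<close>
      have "2 ^ clog b \<le> 2 * b + 1"
      proof (cases "clog b")
        case (Suc l)
        then have "2 ^ l < b" using clog_minimal[of l b] by simp
        then have "2 ^ clog b < 2 * b" by (simp add: Suc)
        then show ?thesis by simp
      qed simp
      then have "bcost cond \<tau>' \<le> bsize cond * M"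
        using I mg Z unfolding cond_def I_def
        by (intro bcost_le[THEN conjunct1]) (auto intro!: small simp: bi)
      moreover have "R = (\<lambda>\<tau>. scal \<tau> ''g'' = int g \<and> scal \<tau> ''L'' = int (clog b) \<and> scal \<tau> ''x'' = 2 ^ clog b)"
        unfolding R_def b_def g_def by (rule refl)
      ultimately show "\<not> bval cond \<tau>' \<and> bcost cond \<tau>' \<le> bsize cond * M \<and> R \<tau>'"
        using I mg ge by (simp add: cond_def I_def bi)
    qed
  qed
  moreover have "csize pre * M + Suc (clog b) * (bsize cond * M + csize body * M) \<le> log_time \<gamma> m k"
  proof -
    have "Suc (clog b) * (17 * M) \<le> Suc b * (17 * M)"
      using clog_le[of b] by (intro mult_le_mono1) simp
    then have "8 * M + Suc (clog b) * (17 * M) \<le> 8 * M + Suc b * (17 * M)" by (rule add_left_mono)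
    also have "\<dots> \<le> (b + 2) * (30 * M)" by (simp add: algebra_simps)
    finally have "8 * M + Suc (clog b) * (9 * M + 8 * M) \<le> (b + 2) * (30 * M)" by simp
    moreover have "csize pre = 8" "csize body = 8" "bsize cond = 9"
      by (simp_all add: pre_def body_def cond_def)
    moreover have "2 * b + 2 * m + k + \<gamma> + \<gamma> * k + 9 = M" by (simp add: M_def Z_def)
    ultimately show ?thesis unfolding log_time_def Let_def b_def[symmetric] by metis
  qed
  ultimately show ?thesis unfolding R_def by (rule runs_mono)
qed

section \<open>Rounded-up rational powers\<close>

definition root_ceil :: "nat \<Rightarrow> nat \<Rightarrow> nat" where
  "root_ceil v x = (LEAST e. x \<le> e ^ v)"

lemma root_ceil:
  assumes "1 \<le> v"
  shows "x \<le> root_ceil v x ^ v"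
  unfolding root_ceil_def
proof (rule LeastI[of _ x])
  show "x \<le> x ^ v" using self_le_power[of x v] assms by (cases "x = 0") auto
qed

lemma root_ceil_minimal: "e < root_ceil v x \<Longrightarrow> e ^ v < x"
  unfolding root_ceil_def using not_less_Least not_le by blast

lemma power_time_mono: "B \<le> B' \<Longrightarrow> N \<le> N' \<Longrightarrow> power_time B N \<le> power_time B' N'"
  unfolding power_time_def by (intro mult_le_mono add_mono) auto

text \<open>E is g^(u/v) rounded up, found by comparing the exact integers E^v and g^u. A linear
  search is affordable because E will be polynomially bounded.\<close>

definition root_prog :: com where
  "root_prog = Seq (power_loop ''G'' ''g'' ''u'' ''i'')
     (Seq (Seq (Assign ''E'' (Const 0)) (Assign ''R'' (Const 0)))
       (While (Less (Var ''R'') (Var ''G''))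
         (Seq (Assign ''E'' (Add (Var ''E'') (Const 1))) (power_loop ''R'' ''E'' ''v'' ''i''))))"

definition root_time :: "nat \<Rightarrow> nat \<Rightarrow> nat \<Rightarrow> nat \<Rightarrow> nat" where
  "root_time g u v e = power_time g u + (e + 2) * (10 * (g * u + e * v + e + 3) + power_time e v)"

lemma runs_root_prog:
  assumes gu: "scal \<sigma> ''g'' = int g" "scal \<sigma> ''u'' = int u" "scal \<sigma> ''v'' = int v" and v: "1 \<le> v"
    and e: "e = root_ceil v (g ^ u)"
  shows "runs Q root_prog \<sigma> (root_time g u v e) (\<lambda>\<tau>. scal \<tau> ''E'' = int e)"
proof -
  define Z where "Z = g * u + e * v + e + 1"
  define M where "M = Z + 2"
  have Z: "e + 1 \<le> Z" by (simp add: Z_def)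
  have small: "int_cost v \<le> M" if "\<bar>v\<bar> \<le> int Z" for v
    unfolding M_def using that by (rule int_cost_le)
  have bigG: "int_cost (int g ^ u) \<le> M" unfolding M_def by (rule int_cost_power) (simp add: Z_def)
  have bigR: "int_cost (int j ^ v) \<le> M" if "j \<le> e" for j
    unfolding M_def
  proof (rule int_cost_power)
    show "j * v \<le> Z" unfolding Z_def using mult_le_mono1[OF that, of v] by linarith
  qed
  define pre where "pre = Seq (Assign ''E'' (Const 0)) (Assign ''R'' (Const 0))"
  define inc where "inc = Assign ''E'' (Add (Var ''E'') (Const 1))"
  define body where "body = Seq inc (power_loop ''R'' ''E'' ''v'' ''i'')"
  define cond where "cond = Less (Var ''R'') (Var ''G'')"
  define T where "T = power_time g u + (csize pre * M + Suc e * (bsize cond * M + (csize inc * M + power_time e v)))"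
  have "runs Q root_prog \<sigma> T (\<lambda>\<tau>. scal \<tau> ''E'' = int e)"
    unfolding root_prog_def pre_def[symmetric] inc_def[symmetric] body_def[symmetric] cond_def[symmetric] T_def
  proof (rule runs_Seq[OF runs_framed[OF runs_power_loop[OF _ gu(1,2)]]])
    fix \<tau> :: state assume \<tau>: "scal \<tau> ''G'' = int g ^ u \<and> framed (power_loop ''G'' ''g'' ''u'' ''i'') \<sigma> \<tau>"
    then have v\<tau>: "scal \<tau> ''v'' = int v" using gu by (auto simp: framed_scal)
    show "runs Q (Seq pre (While cond body)) \<tau>
        (csize pre * M + Suc e * (bsize cond * M + (csize inc * M + power_time e v))) (\<lambda>\<tau>. scal \<tau> ''E'' = int e)"
    proof (rule runs_Seq)
      show "runs Q pre \<tau> (csize pre * M)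
        (\<lambda>\<tau>. scal \<tau> ''v'' = int v \<and> scal \<tau> ''G'' = int g ^ u \<and> scal \<tau> ''E'' = 0 \<and> scal \<tau> ''R'' = 0)"
        using \<tau> v\<tau> unfolding pre_def by (intro runs_loop_free) (auto intro!: small)
    next
      fix \<tau>1 :: state
      assume \<tau>1: "scal \<tau>1 ''v'' = int v \<and> scal \<tau>1 ''G'' = int g ^ u \<and> scal \<tau>1 ''E'' = 0 \<and> scal \<tau>1 ''R'' = 0"
      define I :: "nat \<Rightarrow> state \<Rightarrow> bool" where "I j \<tau> \<longleftrightarrow> scal \<tau> ''E'' = int j \<and> scal \<tau> ''R'' = int j ^ v" for j \<tau>
      show "runs Q (While cond body) \<tau>1 (Suc e * (bsize cond * M + (csize inc * M + power_time e v))) (\<lambda>\<tau>. scal \<tau> ''E'' = int e)"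
      proof (rule runs_While[where I = I])
        \<comment> \<open>R starts as 0 = 0^v, which relies on \<open>1 \<le> v\<close>.\<close>
        show "I 0 \<tau>1" using \<tau>1 v by (simp add: I_def)
      next
        fix j and \<tau>' :: state assume j: "j < e" and I: "I j \<tau>'" and f: "framed body \<tau>1 \<tau>'"
        have vG: "scal \<tau>' ''v'' = int v" "scal \<tau>' ''G'' = int g ^ u"
          using f \<tau>1 by (auto simp: framed_scal body_def inc_def)
        have "j ^ v < g ^ u" using j unfolding e by (rule root_ceil_minimal)
        then have lt: "int j ^ v < int g ^ u" by (metis of_nat_less_iff of_nat_power)
        have bc: "bcost cond \<tau>' \<le> bsize cond * M"
          using I vG j bigG bigR unfolding cond_def I_def by (intro bcost_le[THEN conjunct1]) auto
        have "runs Q body \<tau>' (csize inc * M + power_time e v) (I (Suc j))"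
          unfolding body_def
        proof (rule runs_Seq)
          show "runs Q inc \<tau>' (csize inc * M) (\<lambda>\<tau>. scal \<tau> ''E'' = int (Suc j) \<and> scal \<tau> ''v'' = int v)"
            using I vG j Z unfolding inc_def I_def by (intro runs_loop_free) (auto intro!: small)
        next
          fix \<tau>2 :: state assume \<tau>2: "scal \<tau>2 ''E'' = int (Suc j) \<and> scal \<tau>2 ''v'' = int v"
          then have "runs Q (power_loop ''R'' ''E'' ''v'' ''i'') \<tau>2 (power_time (Suc j) v)
            (\<lambda>\<tau>. scal \<tau> ''R'' = int (Suc j) ^ v \<and> framed (power_loop ''R'' ''E'' ''v'' ''i'') \<tau>2 \<tau>)"
            by (intro runs_framed runs_power_loop) auto
          then show "runs Q (power_loop ''R'' ''E'' ''v'' ''i'') \<tau>2 (power_time e v) (I (Suc j))"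
            by (rule runs_mono) (use j \<tau>2 in \<open>auto simp: I_def framed_scal intro!: power_time_mono\<close>)
        qed
        then show "bval cond \<tau>' \<and> bcost cond \<tau>' \<le> bsize cond * M \<and> runs Q body \<tau>' (csize inc * M + power_time e v) (I (Suc j))"
          using bc I vG lt by (simp add: cond_def I_def)
      next
        fix \<tau>' :: state assume I: "I e \<tau>'" and f: "framed body \<tau>1 \<tau>'"
        have vG: "scal \<tau>' ''v'' = int v" "scal \<tau>' ''G'' = int g ^ u"
          using f \<tau>1 by (auto simp: framed_scal body_def inc_def)
        have bc: "bcost cond \<tau>' \<le> bsize cond * M"
          using I vG bigG bigR unfolding cond_def I_def by (intro bcost_le[THEN conjunct1]) auto
        have "g ^ u \<le> e ^ v" unfolding e by (rule root_ceil[OF v])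
        then have ge: "int g ^ u \<le> int e ^ v" by (metis of_nat_le_iff of_nat_power)
        show "\<not> bval cond \<tau>' \<and> bcost cond \<tau>' \<le> bsize cond * M \<and> scal \<tau>' ''E'' = int e"
          using bc I vG ge by (simp add: cond_def I_def)
      qed
    qed
  qed simp
  moreover have "T \<le> root_time g u v e"
  proof -
    have "4 * M + Suc e * (3 * M + (4 * M + power_time e v)) \<le> (e + 2) * (10 * M + power_time e v)"
      by (simp add: algebra_simps)
    moreover have "csize pre = 4" "csize inc = 4" "bsize cond = 3"
      by (simp_all add: pre_def inc_def cond_def)
    moreover have "g * u + e * v + e + 3 = M" by (simp add: M_def Z_def)
    ultimately show ?thesis unfolding T_def root_time_def by (metis add_left_mono)
  qed
  ultimately show ?thesis by (rule runs_mono)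
qed

text \<open>\<open>E div 2 + 1\<close> is the least K with 2K > E, so D \<le> E makes 2K exceed D
  strictly. The surplus \<open>K div w\<close> of h over K is what the counting argument lives
  on.\<close>

definition dim_prog :: "nat \<Rightarrow> nat \<Rightarrow> com" where
  "dim_prog w c = Seq
     (Seq (Assign ''K'' (Add (Div (Var ''E'') (Const 2)) (Const 1)))
     (Seq (Assign ''h'' (Add (Var ''K'') (Div (Var ''K'') (Const (int w)))))
     (Seq (Assign ''a'' (Mul (Const (int c)) (Var ''L''))) (Assign ''t'' (Const 2)))))
     (Seq (power_loop ''P'' ''t'' ''a'' ''i'') (Assign ''n'' (Mul (Var ''h'') (Var ''P''))))"

definition dim_time :: "nat \<Rightarrow> nat \<Rightarrow> nat \<Rightarrow> nat \<Rightarrow> nat \<Rightarrow> nat \<Rightarrow> nat \<Rightarrow> nat" where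
  "dim_time w c e L K a n = 30 * (e + K + w + c + L + a + 2 * n + 5) + power_time 2 a"

lemma runs_dim_prog:
  assumes eL: "scal \<sigma> ''E'' = int e" "scal \<sigma> ''L'' = int L"
    and K: "K = e div 2 + 1" and h: "h = K + K div w" and a: "a = c * L" and n: "n = h * 2 ^ a"
  shows "runs Q (dim_prog w c) \<sigma> (dim_time w c e L K a n) (\<lambda>\<tau>. scal \<tau> ''K'' = int K \<and>
    scal \<tau> ''h'' = int h \<and> scal \<tau> ''a'' = int a \<and> scal \<tau> ''P'' = 2 ^ a \<and> scal \<tau> ''n'' = int n)"
proof -
  define Z where "Z = e + K + w + c + L + a + 2 * n + 3"
  define M where "M = Z + 2"
  have "1 \<le> h" by (simp add: h K)
  then have hn: "h \<le> n" and Pn: "2 ^ a \<le> n" unfolding n by simp_all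
  have hK: "K div w \<le> n" using hn unfolding h by (rule add_leD2)
  have Z: "e + 3 \<le> Z" "K + 3 \<le> Z" "w \<le> Z" "c \<le> Z" "L \<le> Z" "a \<le> Z" "n \<le> Z" "h \<le> Z" "2 ^ a \<le> Z" "K div w \<le> Z"
    using hn Pn hK by (simp_all add: Z_def)
  have small: "int_cost v \<le> M" if "\<bar>v\<bar> \<le> int Z" for v
    unfolding M_def using that by (rule int_cost_le)
  have eK: "int e div 2 + 1 = int K" by (simp add: K zdiv_int)
  have Kh: "int K + int K div int w = int h" by (simp add: h zdiv_int)
  have ca: "int c * int L = int a" by (simp add: a)
  have hP: "int h * 2 ^ a = int n" by (simp add: n)
  have ed: "int e div 2 = int (e div 2)" "int K div int w = int (K div w)" by (simp_all add: zdiv_int)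
  have ed2: "e div 2 \<le> Z" using Z(1) by linarith
  define pre where "pre = Seq (Assign ''K'' (Add (Div (Var ''E'') (Const 2)) (Const 1)))
     (Seq (Assign ''h'' (Add (Var ''K'') (Div (Var ''K'') (Const (int w)))))
     (Seq (Assign ''a'' (Mul (Const (int c)) (Var ''L''))) (Assign ''t'' (Const 2))))"
  define post where "post = Assign ''n'' (Mul (Var ''h'') (Var ''P''))"
  have "runs Q (dim_prog w c) \<sigma> (csize pre * M + (power_time 2 a + csize post * M)) (\<lambda>\<tau>. scal \<tau> ''K'' = int K \<and>
    scal \<tau> ''h'' = int h \<and> scal \<tau> ''a'' = int a \<and> scal \<tau> ''P'' = 2 ^ a \<and> scal \<tau> ''n'' = int n)"
    unfolding dim_prog_def pre_def[symmetric] post_def[symmetric]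
  proof (rule runs_Seq)
    have Kpos: "int (e div 2) + 1 = int K" by (simp add: K)
    have Khpos: "int K + int (K div w) = int h" by (simp add: h)
    show "runs Q pre \<sigma> (csize pre * M) (\<lambda>\<tau>. scal \<tau> ''K'' = int K \<and> scal \<tau> ''h'' = int h \<and>
        scal \<tau> ''a'' = int a \<and> scal \<tau> ''t'' = int 2)"
      using eL Z ed2 unfolding pre_def
      by (intro runs_loop_free) (auto intro!: small simp: eK Kh ca ed Kpos Khpos simp del: of_nat_div)
  next
    fix \<tau> :: state
    assume \<tau>: "scal \<tau> ''K'' = int K \<and> scal \<tau> ''h'' = int h \<and> scal \<tau> ''a'' = int a \<and> scal \<tau> ''t'' = int 2"
    show "runs Q (Seq (power_loop ''P'' ''t'' ''a'' ''i'') post) \<tau> (power_time 2 a + csize post * M)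
      (\<lambda>\<tau>. scal \<tau> ''K'' = int K \<and> scal \<tau> ''h'' = int h \<and> scal \<tau> ''a'' = int a \<and> scal \<tau> ''P'' = 2 ^ a \<and> scal \<tau> ''n'' = int n)"
    proof (rule runs_Seq[OF runs_framed[OF runs_power_loop]])
      fix \<tau>' :: state
      assume *: "scal \<tau>' ''P'' = int 2 ^ a \<and> framed (power_loop ''P'' ''t'' ''a'' ''i'') \<tau> \<tau>'"
      then have "scal \<tau>' ''K'' = int K" "scal \<tau>' ''h'' = int h" "scal \<tau>' ''a'' = int a" "scal \<tau>' ''P'' = 2 ^ a"
        using \<tau> by (auto simp: framed_scal)
      then show "runs Q post \<tau>' (csize post * M)
        (\<lambda>\<tau>. scal \<tau> ''K'' = int K \<and> scal \<tau> ''h'' = int h \<and> scal \<tau> ''a'' = int a \<and> scal \<tau> ''P'' = 2 ^ a \<and> scal \<tau> ''n'' = int n)"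
        using Z unfolding post_def by (intro runs_loop_free) (auto intro!: small simp: hP)
    qed (use \<tau> in auto)
  qed
  moreover have "csize pre * M + (power_time 2 a + csize post * M) \<le> dim_time w c e L K a n"
    by (simp add: dim_time_def pre_def post_def M_def Z_def)
  ultimately show ?thesis by (rule runs_mono)
qed

section \<open>Search for a prime\<close>

definition next_prime :: "nat \<Rightarrow> nat" where
  "next_prime n = (LEAST q. n < q \<and> prime q)"

lemma next_prime: "n < next_prime n \<and> prime (next_prime n)"
proof -
  obtain q where "prime q" "n < q" using bigger_prime by blast
  then show ?thesis unfolding next_prime_def using LeastI[of "\<lambda>q. n < q \<and> prime q" q] by simp
qed

lemma next_prime_le: "prime q \<Longrightarrow> n < q \<Longrightarrow> next_prime n \<le> q"
  unfolding next_prime_def by (rule Least_le) simp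

lemma next_prime_minimal: "n < q \<Longrightarrow> q < next_prime n \<Longrightarrow> \<not> prime q"
  unfolding next_prime_def using not_less_Least[of q "\<lambda>q. n < q \<and> prime q"] by simp

text \<open>Trial division is fast enough: q will be polynomial in m and k, so time polynomial in
  the value of q rather than in its length is allowed.\<close>

definition trial_prog :: com where
  "trial_prog = While (Less (Var ''i'') (Var ''q''))
     (Seq (If (Less (Mod (Var ''q'') (Var ''i'')) (Const 1)) (Assign ''f'' (Const 0)) Skip)
       (Assign ''i'' (Add (Var ''i'') (Const 1))))"

definition prime_prog :: com where
  "prime_prog = Seq (Seq (Assign ''q'' (Var ''n'')) (Assign ''f'' (Const 0)))
     (While (Less (Var ''f'') (Const 1))
       (Seq (Seq (Assign ''q'' (Add (Var ''q'') (Const 1))) (Seq (Assign ''f'' (Const 1)) (Assign ''i'' (Const 2))))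
         trial_prog))"

definition prime_time :: "nat \<Rightarrow> nat" where
  "prime_time q = (q + 2) * ((q + 2) * (30 * (q + 5)))"

lemma runs_trial_prog:
  assumes q: "scal \<sigma> ''q'' = int q" "2 \<le> q" and fi: "scal \<sigma> ''f'' = 1" "scal \<sigma> ''i'' = 2"
  shows "runs Q trial_prog \<sigma> (q * (15 * (q + 4))) (\<lambda>\<tau>. scal \<tau> ''f'' = of_bool (prime q))"
proof -
  define Z where "Z = q + 2"
  define M where "M = Z + 2"
  have small: "int_cost v \<le> M" if "\<bar>v\<bar> \<le> int Z" for v
    unfolding M_def using that by (rule int_cost_le)
  define cond where "cond = Less (Var ''i'') (Var ''q'')"
  define body where "body = Seq (If (Less (Mod (Var ''q'') (Var ''i'')) (Const 1)) (Assign ''f'' (Const 0)) Skip)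
       (Assign ''i'' (Add (Var ''i'') (Const 1)))"
  define D where "D j \<longleftrightarrow> (\<forall>d\<in>{2..<j + 2}. \<not> d dvd q)" for j
  define I :: "nat \<Rightarrow> state \<Rightarrow> bool" where
    "I j \<tau> \<longleftrightarrow> scal \<tau> ''i'' = int (j + 2) \<and> scal \<tau> ''f'' = of_bool (D j)" for j \<tau>
  have "runs Q trial_prog \<sigma> (Suc (q - 2) * (bsize cond * M + csize body * M)) (\<lambda>\<tau>. scal \<tau> ''f'' = of_bool (prime q))"
    unfolding trial_prog_def cond_def[symmetric] body_def[symmetric]
  proof (rule runs_While[where I = I])
    show "I 0 \<sigma>" using fi by (simp add: I_def D_def)
  next
    fix j and \<tau> :: state assume j: "j < q - 2" and I: "I j \<tau>" and f: "framed body \<sigma> \<tau>"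
    have q\<tau>: "scal \<tau> ''q'' = int q" using f q by (auto simp: framed_scal body_def)
    have i\<tau>: "scal \<tau> ''i'' = int (j + 2)" "scal \<tau> ''f'' = of_bool (D j)" using I by (auto simp: I_def)
    have bc: "bcost cond \<tau> \<le> bsize cond * M"
      using i\<tau> q\<tau> j unfolding cond_def by (intro bcost_le[THEN conjunct1]) (auto intro!: small simp: Z_def)
    have md: "int q mod (2 + int j) = int (q mod (2 + j))" by (simp add: zmod_int)
    have mb: "int (q mod Suc (Suc j)) \<le> 2 + int q"
      using mod_less_eq_dividend[of q "Suc (Suc j)"] by linarith
    have M1: "Suc 0 \<le> M" by (simp add: M_def)
    have DS: "D (Suc j) \<longleftrightarrow> D j \<and> 0 < q mod (2 + j)"
    proof -
      have "{2..<Suc j + 2} = insert (2 + j) {2..<j + 2}" by auto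
      then show ?thesis unfolding D_def by (auto simp: mod_greater_zero_iff_not_dvd)
    qed
    have "runs Q body \<tau> (csize body * M) (I (Suc j))"
    proof (rule runs_loop_free)
      show "cost_ok M body \<tau>"
        using i\<tau>(1) q\<tau> j unfolding body_def
        by (auto intro!: small simp: Z_def md mb M1 simp del: of_nat_mod)
      show "I (Suc j) (after body \<tau>)"
        using i\<tau> q\<tau> DS unfolding body_def I_def
        by (auto simp: md simp del: of_nat_mod)
    qed (simp add: body_def)
    then show "bval cond \<tau> \<and> bcost cond \<tau> \<le> bsize cond * M \<and> runs Q body \<tau> (csize body * M) (I (Suc j))"
      using bc i\<tau> q\<tau> j by (simp add: cond_def)
  next
    fix \<tau> :: state assume I: "I (q - 2) \<tau>" and f: "framed body \<sigma> \<tau>"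
    have q\<tau>: "scal \<tau> ''q'' = int q" using f q by (auto simp: framed_scal body_def)
    have qq: "q - 2 + 2 = q" using q(2) by simp
    have i\<tau>: "scal \<tau> ''i'' = int q" "scal \<tau> ''f'' = of_bool (D (q - 2))" using I qq unfolding I_def by simp_all
    have "bcost cond \<tau> \<le> bsize cond * M"
      using i\<tau> q\<tau> unfolding cond_def by (intro bcost_le[THEN conjunct1]) (auto intro!: small simp: Z_def)
    moreover have "D (q - 2) = prime q" unfolding D_def qq prime_nat_iff' using q(2) by auto
    ultimately show "\<not> bval cond \<tau> \<and> bcost cond \<tau> \<le> bsize cond * M \<and> scal \<tau> ''f'' = of_bool (prime q)"
      using i\<tau> q\<tau> by (simp add: cond_def)
  qed
  moreover have "Suc (q - 2) * (bsize cond * M + csize body * M) \<le> q * (15 * (q + 4))"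
    using q(2) by (intro mult_le_mono) (auto simp: cond_def body_def M_def Z_def)
  ultimately show ?thesis by (rule runs_mono)
qed

lemma runs_prime_prog:
  assumes n: "scal \<sigma> ''n'' = int n" "1 \<le> n"
  shows "runs Q prime_prog \<sigma> (prime_time (next_prime n)) (\<lambda>\<tau>. scal \<tau> ''q'' = int (next_prime n))"
proof -
  define q0 where "q0 = next_prime n"
  have q0: "n < q0" "prime q0" using next_prime[of n] by (auto simp: q0_def)
  define Z where "Z = q0 + 2"
  define M where "M = Z + 2"
  have small: "int_cost v \<le> M" if "\<bar>v\<bar> \<le> int Z" for v
    unfolding M_def using that by (rule int_cost_le)
  define pre where "pre = Seq (Assign ''q'' (Var ''n'')) (Assign ''f'' (Const 0))"
  define cond where "cond = Less (Var ''f'') (Const 1)"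
  define inc where "inc = Seq (Assign ''q'' (Add (Var ''q'') (Const 1))) (Seq (Assign ''f'' (Const 1)) (Assign ''i'' (Const 2)))"
  define T where "T = q0 * (15 * (q0 + 4))"
  \<comment> \<open>At j = 0 the flag is down even if n is prime, since the prime sought is larger
    than n.\<close>
  define I :: "nat \<Rightarrow> state \<Rightarrow> bool" where
    "I j \<tau> \<longleftrightarrow> scal \<tau> ''q'' = int (n + j) \<and> scal \<tau> ''f'' = of_bool (0 < j \<and> prime (n + j))" for j \<tau>
  have "runs Q prime_prog \<sigma> (csize pre * M + Suc (q0 - n) * (bsize cond * M + (csize inc * M + T)))
      (\<lambda>\<tau>. scal \<tau> ''q'' = int q0)"
    unfolding prime_prog_def pre_def[symmetric] cond_def[symmetric] inc_def[symmetric]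
  proof (rule runs_Seq)
    show "runs Q pre \<sigma> (csize pre * M) (I 0)"
      using n q0 unfolding pre_def I_def by (intro runs_loop_free) (auto intro!: small simp: Z_def)
  next
    fix \<tau> :: state assume \<tau>: "I 0 \<tau>"
    show "runs Q (While cond (Seq inc trial_prog)) \<tau> (Suc (q0 - n) * (bsize cond * M + (csize inc * M + T)))
      (\<lambda>\<tau>. scal \<tau> ''q'' = int q0)"
    proof (rule runs_While[where I = I, OF \<tau>])
      fix j and \<tau>' :: state assume j: "j < q0 - n" and I: "I j \<tau>'"
      have np: "\<not> (0 < j \<and> prime (n + j))"
        using j next_prime_minimal[of n "n + j"] by (auto simp: q0_def)
      then have qf: "scal \<tau>' ''q'' = int (n + j)" "scal \<tau>' ''f'' = 0" using I by (auto simp: I_def)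
      have bc: "bcost cond \<tau>' \<le> bsize cond * M"
        using qf unfolding cond_def by (intro bcost_le[THEN conjunct1]) (auto intro!: small simp: Z_def)
      have le: "n + Suc j \<le> q0" using j by linarith
      have "runs Q (Seq inc trial_prog) \<tau>' (csize inc * M + T) (I (Suc j))"
      proof (rule runs_Seq)
        show "runs Q inc \<tau>' (csize inc * M) (\<lambda>\<tau>. scal \<tau> ''q'' = int (n + Suc j) \<and> scal \<tau> ''f'' = 1 \<and> scal \<tau> ''i'' = 2)"
          using qf le unfolding inc_def by (intro runs_loop_free) (auto intro!: small simp: Z_def)
      next
        fix \<tau>2 :: state assume \<tau>2: "scal \<tau>2 ''q'' = int (n + Suc j) \<and> scal \<tau>2 ''f'' = 1 \<and> scal \<tau>2 ''i'' = 2"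
        have "runs Q trial_prog \<tau>2 ((n + Suc j) * (15 * ((n + Suc j) + 4)))
          (\<lambda>\<tau>. scal \<tau> ''f'' = of_bool (prime (n + Suc j)) \<and> framed trial_prog \<tau>2 \<tau>)"
          using \<tau>2 n(2) by (intro runs_framed runs_trial_prog) auto
        moreover have "(n + Suc j) * (15 * ((n + Suc j) + 4)) \<le> T"
          unfolding T_def using le by (intro mult_le_mono) auto
        ultimately show "runs Q trial_prog \<tau>2 T (I (Suc j))"
        proof (rule runs_mono)
          fix \<tau>3 assume *: "scal \<tau>3 ''f'' = of_bool (prime (n + Suc j)) \<and> framed trial_prog \<tau>2 \<tau>3"
          then have "scal \<tau>3 ''q'' = scal \<tau>2 ''q''" by (intro framed_scal[of trial_prog]) (auto simp: trial_prog_def)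
          then show "I (Suc j) \<tau>3" using * \<tau>2 by (simp add: I_def)
        qed
      qed
      then show "bval cond \<tau>' \<and> bcost cond \<tau>' \<le> bsize cond * M \<and> runs Q (Seq inc trial_prog) \<tau>' (csize inc * M + T) (I (Suc j))"
        using bc qf by (simp add: cond_def)
    next
      fix \<tau>' :: state assume I: "I (q0 - n) \<tau>'"
      have qf: "scal \<tau>' ''q'' = int q0" "scal \<tau>' ''f'' = 1" using I q0 by (auto simp: I_def)
      have "bcost cond \<tau>' \<le> bsize cond * M"
        using qf unfolding cond_def by (intro bcost_le[THEN conjunct1]) (auto intro!: small simp: Z_def)
      then show "\<not> bval cond \<tau>' \<and> bcost cond \<tau>' \<le> bsize cond * M \<and> scal \<tau>' ''q'' = int q0"
        using qf by (simp add: cond_def)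
    qed
  qed
  moreover have "csize pre * M + Suc (q0 - n) * (bsize cond * M + (csize inc * M + T)) \<le> prime_time q0"
  proof -
    have c: "csize pre = 4" "bsize cond = 3" "csize inc = 8" by (simp_all add: pre_def cond_def inc_def)
    have "Suc (q0 - n) \<le> q0 + 1" by simp
    then have "Suc (q0 - n) * (3 * M + (8 * M + T)) \<le> (q0 + 1) * (11 * M + T)"
      by (intro mult_le_mono) auto
    moreover have "T \<le> (q0 + 1) * (15 * M)" unfolding T_def M_def Z_def by (intro mult_le_mono) auto
    then have "11 * M + T \<le> (q0 + 2) * (15 * M)" by (simp add: algebra_simps)
    then have "(q0 + 1) * (11 * M + T) \<le> (q0 + 1) * ((q0 + 2) * (15 * M))" by (intro mult_le_mono) auto
    moreover have "4 * M \<le> (q0 + 2) * (15 * M)" by (simp add: algebra_simps)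
    ultimately have "4 * M + Suc (q0 - n) * (3 * M + (8 * M + T)) \<le> (q0 + 2) * ((q0 + 2) * (15 * M))"
      by (simp add: algebra_simps)
    also have "\<dots> \<le> prime_time q0" unfolding prime_time_def M_def Z_def by (intro mult_le_mono) auto
    finally show ?thesis unfolding c .
  qed
  ultimately show ?thesis unfolding q0_def by (rule runs_mono)
qed

section \<open>Writing the generator matrix\<close>

definition code_entry :: "nat \<Rightarrow> nat \<Rightarrow> int \<Rightarrow> nat \<Rightarrow> nat \<Rightarrow> int" where
  "code_entry n q W i j = (if i < n then of_bool (i = j)
     else if j < n then W * (int j ^ (i - n) mod int q)
     else W * int q * of_bool (i = j))"

definition equal_test :: bexp where
  "equal_test = And (Not (Less (Var ''i'') (Var ''j''))) (Not (Less (Var ''j'') (Var ''i'')))"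

text \<open>In the identity rows the exponent is set to 0, matching \<open>i - n\<close> on
  \<open>nat\<close>, so that the power loop can run for every entry.\<close>

definition locate_prog :: com where
  "locate_prog = Seq (Assign ''i'' (Div (Var ''x'') (Var ''cols''))) (Seq (Assign ''j'' (Mod (Var ''x'') (Var ''cols'')))
     (If (Less (Var ''i'') (Var ''n'')) (Assign ''e'' (Const 0)) (Assign ''e'' (Sub (Var ''i'') (Var ''n'')))))"

definition entry_prog :: com where
  "entry_prog = Seq
     (If (Less (Var ''i'') (Var ''n''))
       (If equal_test (Store ''A'' (Var ''x'') (Const 1)) (Store ''A'' (Var ''x'') (Const 0)))
       (If (Less (Var ''j'') (Var ''n''))
         (Store ''A'' (Var ''x'') (Mul (Var ''W'') (Mod (Var ''t'') (Var ''q''))))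
         (If equal_test (Store ''A'' (Var ''x'') (Mul (Var ''W'') (Var ''q''))) (Store ''A'' (Var ''x'') (Const 0)))))
     (Assign ''x'' (Add (Var ''x'') (Const 1)))"

text \<open>One loop over the row-major index x avoids nesting; row and column come from
  \<open>div\<close> and \<open>mod\<close>. The weight g + 1 is the least integer above d.\<close>

definition matrix_prog :: com where
  "matrix_prog = Seq
     (Seq (Assign ''rows'' (Add (Var ''n'') (Var ''K''))) (Seq (Assign ''cols'' (Add (Var ''n'') (Var ''K'')))
       (Seq (Assign ''W'' (Add (Var ''g'') (Const 1))) (Assign ''x'' (Const 0)))))
     (While (Less (Var ''x'') (Mul (Var ''rows'') (Var ''cols'')))
       (Seq locate_prog (Seq (power_loop ''t'' ''j'' ''e'' ''r'') entry_prog)))"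

definition matrix_time :: "nat \<Rightarrow> nat \<Rightarrow> nat \<Rightarrow> nat" where
  "matrix_time z g q = (z * z + 2) * (100 * (z * z + z + (g + 1) * q + g + q + 5) + power_time z z)"

lemma runs_matrix_prog:
  assumes init: "scal \<sigma> ''n'' = int n" "scal \<sigma> ''K'' = int K" "scal \<sigma> ''q'' = int q" "scal \<sigma> ''g'' = int g"
    and q: "1 \<le> q" and z: "z = n + K"
  shows "runs Q matrix_prog \<sigma> (matrix_time z g q) (\<lambda>\<tau>. scal \<tau> ''rows'' = int z \<and> scal \<tau> ''cols'' = int z \<and>
    scal \<tau> ''W'' = int (g + 1) \<and> (\<forall>x<z * z. arr \<tau> ''A'' (int x) = code_entry n q (int (g + 1)) (x div z) (x mod z)))"
proof -
  define Z where "Z = z * z + z + (g + 1) * q + g + q + 3"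
  define M where "M = Z + 2"
  have Z: "z * z + 2 \<le> Z" "z + 2 \<le> Z" "n \<le> Z" "K \<le> Z" "(g + 1) * q \<le> Z" "g + 2 \<le> Z" "q + 2 \<le> Z"
    by (simp_all add: Z_def z)
  have small: "int_cost v \<le> M" if "\<bar>v\<bar> \<le> int Z" for v
    unfolding M_def using that by (rule int_cost_le)
  have zi: "int n + int K = int z" by (simp add: z)
  have zz: "int z * int z = int (z * z)" by simp
  have gi: "int g + 1 = int (g + 1)" by simp
  define W where "W = g + 1"
  define pre where "pre = Seq (Assign ''rows'' (Add (Var ''n'') (Var ''K''))) (Seq (Assign ''cols'' (Add (Var ''n'') (Var ''K'')))
       (Seq (Assign ''W'' (Add (Var ''g'') (Const 1))) (Assign ''x'' (Const 0))))"
  define cond where "cond = Less (Var ''x'') (Mul (Var ''rows'') (Var ''cols''))"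
  define body where "body = Seq locate_prog (Seq (power_loop ''t'' ''j'' ''e'' ''r'') entry_prog)"
  define T where "T = csize locate_prog * M + (power_time z z + csize entry_prog * M)"
  define C :: "state \<Rightarrow> bool" where "C \<tau> \<longleftrightarrow> scal \<tau> ''rows'' = int z \<and> scal \<tau> ''cols'' = int z \<and>
      scal \<tau> ''W'' = int W \<and> scal \<tau> ''n'' = int n \<and> scal \<tau> ''q'' = int q" for \<tau>
  define I :: "nat \<Rightarrow> state \<Rightarrow> bool" where "I x0 \<tau> \<longleftrightarrow> scal \<tau> ''x'' = int x0 \<and>
      (\<forall>x<x0. arr \<tau> ''A'' (int x) = code_entry n q (int W) (x div z) (x mod z))" for x0 \<tau>
  define R :: "state \<Rightarrow> bool" where "R \<tau> \<longleftrightarrow> scal \<tau> ''rows'' = int z \<and> scal \<tau> ''cols'' = int z \<and>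
    scal \<tau> ''W'' = int W \<and> (\<forall>x<z * z. arr \<tau> ''A'' (int x) = code_entry n q (int W) (x div z) (x mod z))" for \<tau>
  have "runs Q matrix_prog \<sigma> (csize pre * M + Suc (z * z) * (bsize cond * M + T)) R"
    unfolding matrix_prog_def pre_def[symmetric] cond_def[symmetric] body_def[symmetric]
  proof (rule runs_Seq)
    show "runs Q pre \<sigma> (csize pre * M) (\<lambda>\<tau>. C \<tau> \<and> I 0 \<tau>)"
      using init Z unfolding pre_def I_def C_def
      by (intro runs_loop_free) (auto intro!: small simp: zi W_def)
  next
    fix \<tau>0 :: state assume \<tau>0: "C \<tau>0 \<and> I 0 \<tau>0"
    show "runs Q (While cond body) \<tau>0 (Suc (z * z) * (bsize cond * M + T)) R"
    proof (rule runs_While[where I = I])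
      show "I 0 \<tau>0" using \<tau>0 by simp
    next
      fix x and \<tau> :: state assume x: "x < z * z" and I: "I x \<tau>" and f: "framed body \<tau>0 \<tau>"
      have C: "C \<tau>" using f \<tau>0 unfolding C_def body_def
        by (auto simp: framed_scal locate_prog_def entry_prog_def)
      have x\<tau>: "scal \<tau> ''x'' = int x" using I by (simp add: I_def)
      define i where "i = x div z"
      define j where "j = x mod z"
      define e where "e = i - n"
      have zpos: "z > 0" using x by (cases z) auto
      have jz: "j < z" unfolding j_def using zpos by simp
      have iz: "i < z" unfolding i_def using x by (simp add: less_mult_imp_div_less)
      have ez: "e \<le> z" using iz by (simp add: e_def)
      have di: "int x div int z = int i" and dj: "int x mod int z = int j"
        by (simp_all add: i_def j_def zdiv_int zmod_int)
      have bc: "bcost cond \<tau> \<le> bsize cond * M"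
        using C x\<tau> x Z unfolding cond_def C_def
        by (intro bcost_le[THEN conjunct1]) (auto intro!: small simp: zz simp del: of_nat_mult)
      have bv: "bval cond \<tau>" using C x\<tau> x by (simp add: cond_def C_def zz del: of_nat_mult)
      have "runs Q body \<tau> T (I (Suc x))"
        unfolding body_def T_def
      proof (rule runs_Seq)
        show "runs Q locate_prog \<tau> (csize locate_prog * M)
          (\<lambda>\<tau>'. scal \<tau>' ''i'' = int i \<and> scal \<tau>' ''j'' = int j \<and> scal \<tau>' ''e'' = int e \<and> framed locate_prog \<tau> \<tau>')"
        proof (rule runs_mono[OF runs_framed])
          show "runs Q locate_prog \<tau> (csize locate_prog * M)
            (\<lambda>\<tau>'. scal \<tau>' ''i'' = int i \<and> scal \<tau>' ''j'' = int j \<and> scal \<tau>' ''e'' = int e)"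
            using C x\<tau> x Z iz jz ez unfolding locate_prog_def C_def
            by (intro runs_loop_free) (auto intro!: small simp: di dj e_def of_nat_diff)
        qed auto
      next
        fix \<tau>1 :: state
        assume \<tau>1: "scal \<tau>1 ''i'' = int i \<and> scal \<tau>1 ''j'' = int j \<and> scal \<tau>1 ''e'' = int e \<and> framed locate_prog \<tau> \<tau>1"
        then have fr1: "framed locate_prog \<tau> \<tau>1" by simp
        have C1: "C \<tau>1" using fr1 C by (auto simp: C_def framed_scal locate_prog_def)
        have x1: "scal \<tau>1 ''x'' = int x" using fr1 x\<tau> by (auto simp: framed_scal locate_prog_def)
        have A1: "arr \<tau>1 = arr \<tau>" using fr1 by (intro ext) (auto simp: framed_arr locate_prog_def)
        show "runs Q (Seq (power_loop ''t'' ''j'' ''e'' ''r'') entry_prog) \<tau>1 (power_time z z + csize entry_prog * M) (I (Suc x))"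
        proof (rule runs_Seq)
          have "runs Q (power_loop ''t'' ''j'' ''e'' ''r'') \<tau>1 (power_time j e)
            (\<lambda>\<tau>. scal \<tau> ''t'' = int j ^ e \<and> framed (power_loop ''t'' ''j'' ''e'' ''r'') \<tau>1 \<tau>)"
            using \<tau>1 by (intro runs_framed runs_power_loop) auto
          then show "runs Q (power_loop ''t'' ''j'' ''e'' ''r'') \<tau>1 (power_time z z)
            (\<lambda>\<tau>. scal \<tau> ''t'' = int j ^ e \<and> framed (power_loop ''t'' ''j'' ''e'' ''r'') \<tau>1 \<tau>)"
            by (rule runs_mono) (use jz ez in \<open>auto intro!: power_time_mono\<close>)
        next
          fix \<tau>2 :: state
          assume \<tau>2: "scal \<tau>2 ''t'' = int j ^ e \<and> framed (power_loop ''t'' ''j'' ''e'' ''r'') \<tau>1 \<tau>2"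
          then have fr2: "framed (power_loop ''t'' ''j'' ''e'' ''r'') \<tau>1 \<tau>2" by simp
          have C2: "C \<tau>2" using fr2 C1 by (auto simp: C_def framed_scal)
          have v2: "scal \<tau>2 ''x'' = int x" "scal \<tau>2 ''i'' = int i" "scal \<tau>2 ''j'' = int j" "scal \<tau>2 ''t'' = int j ^ e"
            using fr2 \<tau>1 x1 \<tau>2 by (auto simp: framed_scal)
          have A2: "arr \<tau>2 = arr \<tau>" using fr2 A1 by (metis framed_arr written_power_loop(2) empty_iff ext)
          define t where "t = int j ^ e"
          have tc: "int_cost t \<le> M" unfolding t_def M_def
          proof (rule int_cost_power)
            have "j * e \<le> z * z" using jz ez by (intro mult_le_mono) auto
            then show "j * e \<le> Z" using Z(1) by linarith
          qed
          have tq: "0 \<le> t mod int q" "t mod int q \<le> int q" using q by (auto simp: less_imp_le)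
          have tq2: "t mod int q \<le> int Z" using tq Z(7) by linarith
          have Wq: "int W * int q \<le> int Z" using Z(5) unfolding W_def by (metis of_nat_le_iff of_nat_mult)
          then have Wtq: "int W * (t mod int q) \<le> int Z"
            using mult_left_mono[OF tq(2), of "int W"] by linarith
          have Wtq0: "0 \<le> int W * (t mod int q)" "0 \<le> int W * int q" using tq by auto
          have WZ: "W \<le> Z" "W * q \<le> Z" using Z(5,6) by (simp_all add: W_def)
          have xZ: "int x + 1 \<le> int Z" using x Z(1) by linarith
          show "runs Q entry_prog \<tau>2 (csize entry_prog * M) (I (Suc x))"
          proof (rule runs_loop_free)
            have ic: "int_cost (int i) \<le> M" "int_cost (int j) \<le> M" "int_cost (int n) \<le> M"
              "int_cost (int x) \<le> M" "int_cost 0 \<le> M" "int_cost 1 \<le> M" "int_cost (int q) \<le> M"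
              "int_cost (int W) \<le> M" "int_cost (t mod int q) \<le> M" "int_cost (int W * (t mod int q)) \<le> M"
              "int_cost (int W * int q) \<le> M" "int_cost (int x + 1) \<le> M"
              by (rule small, use Z iz jz xZ in \<open>simp add: abs_of_nonneg Wtq0 Wq Wtq tq tq2 WZ del: of_nat_Suc\<close>)+
            show "cost_ok M entry_prog \<tau>2"
              using C2 v2 unfolding entry_prog_def equal_test_def C_def t_def[symmetric]
              by (simp add: ic tc)
            have val: "scal (after entry_prog \<tau>2) ''x'' = int x + 1 \<and>
                arr (after entry_prog \<tau>2) ''A'' = (arr \<tau> ''A'') (int x := code_entry n q (int W) i j)"
              using C2 v2 unfolding entry_prog_def equal_test_def C_def code_entry_def
              by (cases "i < n"; cases "j < n"; cases i j rule: linorder_cases; simp add: A2 e_def)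
            show "I (Suc x) (after entry_prog \<tau>2)"
              using val I unfolding I_def by (auto simp: less_Suc_eq i_def j_def)
          qed (simp add: entry_prog_def)
        qed
      qed
      then show "bval cond \<tau> \<and> bcost cond \<tau> \<le> bsize cond * M \<and> runs Q body \<tau> T (I (Suc x))"
        using bc bv by simp
    next
      fix \<tau> :: state assume I: "I (z * z) \<tau>" and f: "framed body \<tau>0 \<tau>"
      have C: "C \<tau>" using f \<tau>0 unfolding C_def body_def
        by (auto simp: framed_scal locate_prog_def entry_prog_def)
      have x\<tau>: "scal \<tau> ''x'' = int (z * z)" using I by (simp add: I_def)
      have bc: "bcost cond \<tau> \<le> bsize cond * M"
        using C x\<tau> Z unfolding cond_def C_def
        by (intro bcost_le[THEN conjunct1]) (auto intro!: small simp: zz simp del: of_nat_mult)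
      then show "\<not> bval cond \<tau> \<and> bcost cond \<tau> \<le> bsize cond * M \<and> R \<tau>"
        using C x\<tau> I by (simp add: cond_def C_def R_def I_def)
    qed
  qed
  moreover have "csize pre * M + Suc (z * z) * (bsize cond * M + T) \<le> matrix_time z g q"
  proof -
    have s: "csize pre = 14" "bsize cond = 5" "csize locate_prog + csize entry_prog \<le> 80"
      by (simp_all add: pre_def cond_def locate_prog_def entry_prog_def equal_test_def)
    have "csize locate_prog * M + csize entry_prog * M \<le> 80 * M"
      using mult_le_mono1[OF s(3), of M] by (simp add: add_mult_distrib)
    then have "5 * M + T \<le> 100 * M + power_time z z" unfolding T_def by linarith
    then have "Suc (z * z) * (5 * M + T) \<le> Suc (z * z) * (100 * M + power_time z z)" by (rule mult_le_mono2)
    then have "14 * M + Suc (z * z) * (5 * M + T) \<le> (z * z + 2) * (100 * M + power_time z z)" by simp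
    moreover have "z * z + z + (g + 1) * q + g + q + 5 = M" by (simp add: M_def Z_def)
    ultimately show ?thesis unfolding matrix_time_def s by metis
  qed
  ultimately show ?thesis unfolding R_def W_def by (rule runs_mono)
qed

section \<open>Random positions and their syndrome\<close>

lemma runs_Flip_Seq:
  assumes "coins \<sigma> = b # bs"
    and "runs Q c (\<sigma>\<lparr>scal := (scal \<sigma>)(x := of_bool b), coins := bs\<rparr>) T R"
  shows "runs Q (Seq (Flip x) c) \<sigma> (1 + T) R"
  using assms exec.Flip[of \<sigma> b bs Q x] exec.Seq unfolding runs_def by (metis add_left_mono)

text \<open>Horner's scheme, most significant bit first, as in \<open>bits_val\<close>.\<close>

definition bits_prog :: com where
  "bits_prog = Seq (Seq (Assign ''y'' (Const 0)) (Assign ''i'' (Const 0)))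
     (While (Less (Var ''i'') (Var ''a''))
       (Seq (Flip ''f'') (Seq (Assign ''y'' (Add (Mul (Const 2) (Var ''y'')) (Var ''f'')))
         (Assign ''i'' (Add (Var ''i'') (Const 1))))))"

definition bits_time :: "nat \<Rightarrow> nat" where
  "bits_time a = (a + 2) * (20 * (2 ^ a + a + 3))"

lemma runs_bits_prog:
  assumes a: "scal \<sigma> ''a'' = int a" and len: "a \<le> length (coins \<sigma>)"
  shows "runs Q bits_prog \<sigma> (bits_time a)
    (\<lambda>\<tau>. scal \<tau> ''y'' = int (bits_val (take a (coins \<sigma>))) \<and> coins \<tau> = drop a (coins \<sigma>))"
proof -
  define Z where "Z = 2 ^ a + a + 1"
  define M where "M = Z + 2"
  have Z: "2 ^ a + 1 \<le> Z" "a + 1 \<le> Z" by (simp_all add: Z_def)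
  have small: "int_cost v \<le> M" if "\<bar>v\<bar> \<le> int Z" for v
    unfolding M_def using that by (rule int_cost_le)
  define \<omega> where "\<omega> = coins \<sigma>"
  define pre where "pre = Seq (Assign ''y'' (Const 0)) (Assign ''i'' (Const 0))"
  define cond where "cond = Less (Var ''i'') (Var ''a'')"
  define push where "push = Seq (Assign ''y'' (Add (Mul (Const 2) (Var ''y'')) (Var ''f'')))
         (Assign ''i'' (Add (Var ''i'') (Const 1)))"
  define I :: "nat \<Rightarrow> state \<Rightarrow> bool" where "I j \<tau> \<longleftrightarrow> scal \<tau> ''i'' = int j \<and>
    scal \<tau> ''y'' = int (bits_val (take j \<omega>)) \<and> coins \<tau> = drop j \<omega>" for j \<tau>
  have "runs Q bits_prog \<sigma> (csize pre * M + Suc a * (bsize cond * M + (1 + csize push * M)))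
    (\<lambda>\<tau>. scal \<tau> ''y'' = int (bits_val (take a \<omega>)) \<and> coins \<tau> = drop a \<omega>)"
    unfolding bits_prog_def pre_def[symmetric] cond_def[symmetric] push_def[symmetric]
  proof (rule runs_Seq)
    show "runs Q pre \<sigma> (csize pre * M) (\<lambda>\<tau>. I 0 \<tau> \<and> scal \<tau> ''a'' = int a)"
      using a unfolding pre_def I_def
      by (intro runs_loop_free) (auto intro!: small simp: \<omega>_def bits_val_def)
  next
    fix \<tau>0 :: state assume \<tau>0: "I 0 \<tau>0 \<and> scal \<tau>0 ''a'' = int a"
    show "runs Q (While cond (Seq (Flip ''f'') push)) \<tau>0 (Suc a * (bsize cond * M + (1 + csize push * M)))
      (\<lambda>\<tau>. scal \<tau> ''y'' = int (bits_val (take a \<omega>)) \<and> coins \<tau> = drop a \<omega>)"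
    proof (rule runs_While[where I = I])
      show "I 0 \<tau>0" using \<tau>0 by simp
    next
      fix j and \<tau> :: state assume j: "j < a" and I: "I j \<tau>" and f: "framed (Seq (Flip ''f'') push) \<tau>0 \<tau>"
      have a\<tau>: "scal \<tau> ''a'' = int a" using f \<tau>0 by (auto simp: framed_scal push_def)
      have i\<tau>: "scal \<tau> ''i'' = int j" using I by (simp add: I_def)
      have bc: "bcost cond \<tau> \<le> bsize cond * M"
        using a\<tau> i\<tau> j Z unfolding cond_def by (intro bcost_le[THEN conjunct1]) (auto intro!: small)
      have jl: "j < length \<omega>" using j len by (simp add: \<omega>_def)
      then have dr: "drop j \<omega> = \<omega> ! j # drop (Suc j) \<omega>" by (simp add: Cons_nth_drop_Suc)
      have tk: "bits_val (take (Suc j) \<omega>) = 2 * bits_val (take j \<omega>) + of_bool (\<omega> ! j)"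
        using jl by (simp add: take_Suc_conv_app_nth bits_val_snoc)
      have "bits_val (take (Suc j) \<omega>) < 2 ^ length (take (Suc j) \<omega>)" by (rule bits_val_less)
      also have "\<dots> \<le> 2 ^ a" using j by (intro power_increasing) auto
      finally have b1: "2 * bits_val (take j \<omega>) + of_bool (\<omega> ! j) < 2 ^ a" unfolding tk .
      define y where "y = bits_val (take j \<omega>)"
      have yZ: "2 * y + of_bool (\<omega> ! j) \<le> Z" using b1 Z(1) unfolding y_def by linarith
      have "runs Q (Seq (Flip ''f'') push) \<tau> (1 + csize push * M) (I (Suc j))"
      proof (rule runs_Flip_Seq)
        show "coins \<tau> = \<omega> ! j # drop (Suc j) \<omega>" using I dr by (simp add: I_def)
        define \<tau>1 where \<tau>1: "\<tau>1 = \<tau>\<lparr>scal := (scal \<tau>)(''f'' := of_bool (\<omega> ! j)), coins := drop (Suc j) \<omega>\<rparr>"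
        show "runs Q push (\<tau>\<lparr>scal := (scal \<tau>)(''f'' := of_bool (\<omega> ! j)), coins := drop (Suc j) \<omega>\<rparr>)
            (csize push * M) (I (Suc j))"
          unfolding \<tau>1[symmetric]
        proof (rule runs_loop_free)
          show "cost_ok M push \<tau>1"
            using I yZ Z j unfolding push_def I_def \<tau>1 y_def[symmetric]
            by (cases "\<omega> ! j") (auto intro!: small)
          show "I (Suc j) (after push \<tau>1)"
            using I unfolding push_def I_def \<tau>1 tk by simp
        qed (simp add: push_def)
      qed
      then show "bval cond \<tau> \<and> bcost cond \<tau> \<le> bsize cond * M \<and>
          runs Q (Seq (Flip ''f'') push) \<tau> (1 + csize push * M) (I (Suc j))"
        using bc a\<tau> i\<tau> j by (simp add: cond_def)
    next
      fix \<tau> :: state assume I: "I a \<tau>" and f: "framed (Seq (Flip ''f'') push) \<tau>0 \<tau>"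
      have a\<tau>: "scal \<tau> ''a'' = int a" using f \<tau>0 by (auto simp: framed_scal push_def)
      have i\<tau>: "scal \<tau> ''i'' = int a" using I by (simp add: I_def)
      have "bcost cond \<tau> \<le> bsize cond * M"
        using a\<tau> i\<tau> Z unfolding cond_def by (intro bcost_le[THEN conjunct1]) (auto intro!: small)
      then show "\<not> bval cond \<tau> \<and> bcost cond \<tau> \<le> bsize cond * M \<and>
          (scal \<tau> ''y'' = int (bits_val (take a \<omega>)) \<and> coins \<tau> = drop a \<omega>)"
        using I a\<tau> i\<tau> by (simp add: cond_def I_def)
    qed
  qed
  moreover have "csize pre * M + Suc a * (bsize cond * M + (1 + csize push * M)) \<le> bits_time a"
  proof -
    have s: "csize pre = 4" "bsize cond = 3" "csize push = 10"
      by (simp_all add: pre_def cond_def push_def)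
    have "3 * M + (1 + 10 * M) \<le> 20 * M" by (simp add: M_def)
    then have "Suc a * (3 * M + (1 + 10 * M)) \<le> Suc a * (20 * M)" by (rule mult_le_mono2)
    then have "4 * M + Suc a * (3 * M + (1 + 10 * M)) \<le> (a + 2) * (20 * M)" by simp
    moreover have "2 ^ a + a + 3 = M" by (simp add: M_def Z_def)
    ultimately show ?thesis unfolding bits_time_def s by metis
  qed
  ultimately show ?thesis unfolding \<omega>_def by (rule runs_mono)
qed

definition accumulate_prog :: com where
  "accumulate_prog = Seq (power_loop ''t'' ''y'' ''r'' ''i'')
     (Seq (Assign ''x'' (Add (Var ''n'') (Var ''r'')))
     (Seq (Store ''s'' (Var ''x'') (Add (Elem ''s'' (Var ''x'')) (Mul (Var ''W'') (Mod (Var ''t'') (Var ''q'')))))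
       (Assign ''r'' (Add (Var ''r'') (Const 1)))))"

definition syndrome_prog :: com where
  "syndrome_prog = Seq (Assign ''b'' (Const 0))
     (While (Less (Var ''b'') (Var ''h''))
       (Seq bits_prog
       (Seq (Seq (Assign ''y'' (Add (Mul (Var ''b'') (Var ''P'')) (Var ''y''))) (Assign ''r'' (Const 0)))
       (Seq (While (Less (Var ''r'') (Var ''K'')) accumulate_prog)
         (Assign ''b'' (Add (Var ''b'') (Const 1)))))))"

definition syndrome_time :: "nat \<Rightarrow> nat \<Rightarrow> nat \<Rightarrow> nat \<Rightarrow> nat \<Rightarrow> nat \<Rightarrow> nat" where
  "syndrome_time n K q W h a = (h + 2) * ((K + 2) * (60 * (n * K + n + K + 2 * h * (W * q) + W * q + W + q + a + 5)
     + power_time n K) + bits_time a)"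

text \<open>The bound S on the present entries serves the costs: accumulated sums are not reduced
  modulo q, so their size has to be carried along.\<close>

lemma runs_accumulate_prog:
  assumes init: "scal \<sigma> ''n'' = int n" "scal \<sigma> ''K'' = int K" "scal \<sigma> ''q'' = int q" "scal \<sigma> ''W'' = int W"
      "scal \<sigma> ''y'' = int y" "scal \<sigma> ''r'' = 0"
    and y: "y \<le> n" and q: "1 \<le> q"
    and s: "\<And>x. x < n + K \<Longrightarrow> arr \<sigma> ''s'' (int x) = s0 x"
    and s_bound: "\<And>x. x < n + K \<Longrightarrow> 0 \<le> s0 x \<and> s0 x \<le> int S"
    and M: "M = n * K + n + K + S + W * q + W + q + 5"
  shows "runs Q (While (Less (Var ''r'') (Var ''K'')) accumulate_prog) \<sigma> ((K + 1) * (30 * M + power_time n K))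
    (\<lambda>\<tau>. \<forall>x<n + K. arr \<tau> ''s'' (int x) = (if x < n then s0 x else s0 x + int W * (int y ^ (x - n) mod int q)))"
proof -
  define Z where "Z = n * K + n + K + S + W * q + W + q + 3"
  have MZ: "M = Z + 2" by (simp add: M Z_def)
  have Z: "n * K \<le> Z" "n + K + 2 \<le> Z" "S + W * q \<le> Z" "W * q \<le> Z" "S \<le> Z" "W \<le> Z" "q + 2 \<le> Z" by (simp_all add: Z_def)
  have small: "int_cost v \<le> M" if "\<bar>v\<bar> \<le> int Z" for v
    unfolding MZ using that by (rule int_cost_le)
  define cond where "cond = Less (Var ''r'') (Var ''K'')"
  define add where "add = Seq (Assign ''x'' (Add (Var ''n'') (Var ''r'')))
     (Seq (Store ''s'' (Var ''x'') (Add (Elem ''s'' (Var ''x'')) (Mul (Var ''W'') (Mod (Var ''t'') (Var ''q'')))))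
       (Assign ''r'' (Add (Var ''r'') (Const 1))))"
  \<comment> \<open>The array after r of the K syndrome coordinates have been updated; those from
    \<open>n + r\<close> on are still old.\<close>
  define s1 where "s1 r x = (if x < n \<or> n + r \<le> x then s0 x else s0 x + int W * (int y ^ (x - n) mod int q))" for r x
  define I :: "nat \<Rightarrow> state \<Rightarrow> bool" where "I r \<tau> \<longleftrightarrow> scal \<tau> ''r'' = int r \<and>
      (\<forall>x<n + K. arr \<tau> ''s'' (int x) = s1 r x)" for r \<tau>
  define C :: "state \<Rightarrow> bool" where "C \<tau> \<longleftrightarrow> scal \<tau> ''n'' = int n \<and> scal \<tau> ''K'' = int K \<and>
      scal \<tau> ''q'' = int q \<and> scal \<tau> ''W'' = int W \<and> scal \<tau> ''y'' = int y" for \<tau>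
  have acc: "accumulate_prog = Seq (power_loop ''t'' ''y'' ''r'' ''i'') add"
    by (simp add: accumulate_prog_def add_def)
  have "runs Q (While cond accumulate_prog) \<sigma> (Suc K * (bsize cond * M + (power_time n K + csize add * M)))
    (\<lambda>\<tau>. \<forall>x<n + K. arr \<tau> ''s'' (int x) = (if x < n then s0 x else s0 x + int W * (int y ^ (x - n) mod int q)))"
  proof (rule runs_While[where I = I])
    show "I 0 \<sigma>" using init s by (auto simp: I_def s1_def)
  next
    fix r and \<tau> :: state assume r: "r < K" and I: "I r \<tau>" and f: "framed accumulate_prog \<sigma> \<tau>"
    have C: "C \<tau>" using f init by (auto simp: C_def framed_scal accumulate_prog_def)
    have r\<tau>: "scal \<tau> ''r'' = int r" using I by (simp add: I_def)
    have bc: "bcost cond \<tau> \<le> bsize cond * M"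
      using C r\<tau> r Z unfolding cond_def C_def by (intro bcost_le[THEN conjunct1]) (auto intro!: small)
    have "runs Q accumulate_prog \<tau> (power_time n K + csize add * M) (I (Suc r))"
      unfolding acc
    proof (rule runs_Seq)
      have "runs Q (power_loop ''t'' ''y'' ''r'' ''i'') \<tau> (power_time y r)
        (\<lambda>\<tau>'. scal \<tau>' ''t'' = int y ^ r \<and> framed (power_loop ''t'' ''y'' ''r'' ''i'') \<tau> \<tau>')"
        using C r\<tau> by (intro runs_framed runs_power_loop) (auto simp: C_def)
      then show "runs Q (power_loop ''t'' ''y'' ''r'' ''i'') \<tau> (power_time n K)
        (\<lambda>\<tau>'. scal \<tau>' ''t'' = int y ^ r \<and> framed (power_loop ''t'' ''y'' ''r'' ''i'') \<tau> \<tau>')"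
        by (rule runs_mono) (use y r in \<open>auto intro!: power_time_mono\<close>)
    next
      fix \<tau>2 :: state
      assume \<tau>2: "scal \<tau>2 ''t'' = int y ^ r \<and> framed (power_loop ''t'' ''y'' ''r'' ''i'') \<tau> \<tau>2"
      then have fr2: "framed (power_loop ''t'' ''y'' ''r'' ''i'') \<tau> \<tau>2" by simp
      have C2: "C \<tau>2" using fr2 C by (auto simp: C_def framed_scal)
      have v2: "scal \<tau>2 ''r'' = int r" "scal \<tau>2 ''t'' = int y ^ r"
        using fr2 r\<tau> \<tau>2 by (auto simp: framed_scal)
      have A2: "arr \<tau>2 = arr \<tau>" using fr2 by (metis framed_arr written_power_loop(2) empty_iff ext)
      define t where "t = int y ^ r"
      have tc: "int_cost t \<le> M" unfolding t_def MZ
      proof (rule int_cost_power)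
        have "y * r \<le> n * K" using y r by (intro mult_le_mono) auto
        then show "y * r \<le> Z" using Z(1) by linarith
      qed
      have sv: "arr \<tau> ''s'' (int (n + r)) = s0 (n + r)" using I r by (simp add: I_def s1_def del: of_nat_add)
      have sb: "0 \<le> s0 (n + r)" "s0 (n + r) \<le> int S" using s_bound[of "n + r"] r by auto
      have tq: "0 \<le> t mod int q" "t mod int q \<le> int q" using q by (auto simp: less_imp_le)
      have Wtq: "0 \<le> int W * (t mod int q)" "int W * (t mod int q) \<le> int (W * q)"
        using tq mult_left_mono[OF tq(2), of "int W"] by auto
      have nr: "int n + int r = int (n + r)" by simp
      have ic: "int_cost (int n) \<le> M" "int_cost (int r) \<le> M" "int_cost (int (n + r)) \<le> M"
        "int_cost (int W) \<le> M" "int_cost (int q) \<le> M" "int_cost 1 \<le> M" "int_cost (int r + 1) \<le> M"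
        by (rule small, use Z r in \<open>simp\<close>)+
      have ic2: "int_cost (t mod int q) \<le> M" "int_cost (int W * (t mod int q)) \<le> M"
        "int_cost (s0 (n + r)) \<le> M" "int_cost (s0 (n + r) + int W * (t mod int q)) \<le> M"
      proof -
        have "\<bar>t mod int q\<bar> \<le> int Z" using tq Z(7) by linarith
        then show "int_cost (t mod int q) \<le> M" by (rule small)
        have "\<bar>int W * (t mod int q)\<bar> \<le> int Z" using Wtq Z(4) by linarith
        then show "int_cost (int W * (t mod int q)) \<le> M" by (rule small)
        have "\<bar>s0 (n + r)\<bar> \<le> int Z" using sb Z(5) by linarith
        then show "int_cost (s0 (n + r)) \<le> M" by (rule small)
        have "\<bar>s0 (n + r) + int W * (t mod int q)\<bar> \<le> int Z" using sb Wtq Z(3) by linarith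
        then show "int_cost (s0 (n + r) + int W * (t mod int q)) \<le> M" by (rule small)
      qed
      show "runs Q add \<tau>2 (csize add * M) (I (Suc r))"
      proof (rule runs_loop_free)
        show "cost_ok M add \<tau>2"
          using C2 v2 sv unfolding add_def C_def t_def[symmetric]
          by (simp add: ic ic2 tc A2 nr del: of_nat_add)
        have val: "scal (after add \<tau>2) ''r'' = int r + 1 \<and>
            arr (after add \<tau>2) ''s'' = (arr \<tau> ''s'') (int (n + r) := s0 (n + r) + int W * (t mod int q))"
          using C2 v2 sv unfolding add_def C_def t_def[symmetric] by (simp add: A2 nr del: of_nat_add)
        show "I (Suc r) (after add \<tau>2)"
          using val I unfolding I_def by (auto simp: s1_def t_def simp del: of_nat_add)
      qed (simp add: add_def)
    qed
    then show "bval cond \<tau> \<and> bcost cond \<tau> \<le> bsize cond * M \<and>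
        runs Q accumulate_prog \<tau> (power_time n K + csize add * M) (I (Suc r))"
      using bc C r\<tau> r by (simp add: cond_def C_def)
  next
    fix \<tau> :: state assume I: "I K \<tau>" and f: "framed accumulate_prog \<sigma> \<tau>"
    have C: "C \<tau>" using f init by (auto simp: C_def framed_scal accumulate_prog_def)
    have r\<tau>: "scal \<tau> ''r'' = int K" using I by (simp add: I_def)
    have "bcost cond \<tau> \<le> bsize cond * M"
      using C r\<tau> Z unfolding cond_def C_def by (intro bcost_le[THEN conjunct1]) (auto intro!: small)
    then show "\<not> bval cond \<tau> \<and> bcost cond \<tau> \<le> bsize cond * M \<and>
       (\<forall>x<n + K. arr \<tau> ''s'' (int x) = (if x < n then s0 x else s0 x + int W * (int y ^ (x - n) mod int q)))"
      using C r\<tau> I by (simp add: cond_def C_def I_def s1_def)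
  qed
  moreover have "Suc K * (bsize cond * M + (power_time n K + csize add * M)) \<le> (K + 1) * (30 * M + power_time n K)"
  proof -
    have "bsize cond + csize add \<le> 30" by (simp add: cond_def add_def)
    then have "(bsize cond + csize add) * M \<le> 30 * M" by (rule mult_le_mono1)
    then have "bsize cond * M + (power_time n K + csize add * M) \<le> 30 * M + power_time n K"
      by (simp add: add_mult_distrib)
    then show ?thesis by (intro mult_le_mono) auto
  qed
  ultimately show ?thesis unfolding cond_def by (rule runs_mono)
qed

lemma runs_syndrome_prog:
  assumes init: "scal \<sigma> ''n'' = int n" "scal \<sigma> ''K'' = int K" "scal \<sigma> ''q'' = int q" "scal \<sigma> ''W'' = int W"
      "scal \<sigma> ''h'' = int h" "scal \<sigma> ''a'' = int a" "scal \<sigma> ''P'' = 2 ^ a"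
    and q: "1 \<le> q" and n: "n = h * 2 ^ a"
    and s: "\<And>x. x < n + K \<Longrightarrow> arr \<sigma> ''s'' (int x) = 0"
    and len: "a * h \<le> length (coins \<sigma>)"
  shows "runs Q syndrome_prog \<sigma> (syndrome_time n K q W h a)
    (\<lambda>\<tau>. \<forall>x<n + K. arr \<tau> ''s'' (int x) =
      (if x < n then 0 else int W * (\<Sum>b<h. int (position a (coins \<sigma>) b) ^ (x - n) mod int q)))"
proof -
  define \<omega> where "\<omega> = coins \<sigma>"
  define M where "M = n * K + n + K + h * (W * q) + W * q + W + q + 5"
  have hn: "h \<le> n" by (simp add: n)
  have small: "int_cost v \<le> M" if "\<bar>v\<bar> \<le> int (n + 1)" for v
    using int_cost_le[OF that] by (simp add: M_def)
  define S where "S b x = (if x < n then 0 else int W * (\<Sum>b'<b. int (position a \<omega> b') ^ (x - n) mod int q))" for b x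
  \<comment> \<open>The bound h W q holds for every partial sum, so the same M serves all
    rounds.\<close>
  have S_bound: "0 \<le> S b x \<and> S b x \<le> int (h * (W * q))" if "b \<le> h" for b x
  proof -
    have t: "0 \<le> int y ^ r mod int q \<and> int y ^ r mod int q \<le> int q" for y r using q by (simp add: less_imp_le)
    have 0: "0 \<le> (\<Sum>b'<b. int (position a \<omega> b') ^ (x - n) mod int q)" using t by (intro sum_nonneg) auto
    have "(\<Sum>b'<b. int (position a \<omega> b') ^ (x - n) mod int q) \<le> (\<Sum>b'<b. int q)" using t by (intro sum_mono) auto
    also have "\<dots> \<le> int h * int q" using that by (simp add: mult_right_mono)
    finally have "int W * (\<Sum>b'<b. int (position a \<omega> b') ^ (x - n) mod int q) \<le> int W * (int h * int q)"
      by (intro mult_left_mono) auto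
    then have "int W * (\<Sum>b'<b. int (position a \<omega> b') ^ (x - n) mod int q) \<le> int (h * (W * q))"
      by (simp add: algebra_simps)
    then show ?thesis unfolding S_def using 0 by auto
  qed
  define cond where "cond = Less (Var ''b'') (Var ''h'')"
  define mid where "mid = Seq (Assign ''y'' (Add (Mul (Var ''b'') (Var ''P'')) (Var ''y''))) (Assign ''r'' (Const 0))"
  define loop where "loop = While (Less (Var ''r'') (Var ''K'')) accumulate_prog"
  define last where "last = Assign ''b'' (Add (Var ''b'') (Const 1))"
  define body where "body = Seq bits_prog (Seq mid (Seq loop last))"
  define T where "T = bits_time a + (csize mid * M + ((K + 1) * (30 * M + power_time n K) + csize last * M))"
  define C :: "state \<Rightarrow> bool" where "C \<tau> \<longleftrightarrow> scal \<tau> ''n'' = int n \<and> scal \<tau> ''K'' = int K \<and> scal \<tau> ''q'' = int q \<and>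
    scal \<tau> ''W'' = int W \<and> scal \<tau> ''h'' = int h \<and> scal \<tau> ''a'' = int a \<and> scal \<tau> ''P'' = 2 ^ a" for \<tau>
  have C_framed: "C \<tau>'" if "framed c \<tau> \<tau>'" "C \<tau>"
    "scalars_written c \<subseteq> {''b'', ''f'', ''y'', ''i'', ''r'', ''t'', ''x''}" for c \<tau> \<tau>'
  proof -
    have "''n'' \<notin> scalars_written c" "''K'' \<notin> scalars_written c" "''q'' \<notin> scalars_written c" "''W'' \<notin> scalars_written c"
      "''h'' \<notin> scalars_written c" "''a'' \<notin> scalars_written c" "''P'' \<notin> scalars_written c" using that(3) by auto
    then show ?thesis using that(1,2) unfolding C_def by (auto simp: framed_scal)
  qed
  have wb: "scalars_written bits_prog = {''b'', ''f'', ''y'', ''i'', ''r'', ''t'', ''x''} - {''b'', ''r'', ''t'', ''x''}"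
    by (auto simp: bits_prog_def)
  have wm: "scalars_written mid = {''y'', ''r''}" by (auto simp: mid_def)
  have wl: "scalars_written loop = {''i'', ''r'', ''t'', ''x''}" by (auto simp: loop_def accumulate_prog_def)
  have wbody: "scalars_written body \<subseteq> {''b'', ''f'', ''y'', ''i'', ''r'', ''t'', ''x''}"
    unfolding body_def using wb wm wl by (auto simp: last_def)
  define I :: "nat \<Rightarrow> state \<Rightarrow> bool" where "I b \<tau> \<longleftrightarrow> scal \<tau> ''b'' = int b \<and> coins \<tau> = drop (a * b) \<omega> \<and>
      (\<forall>x<n + K. arr \<tau> ''s'' (int x) = S b x)" for b \<tau>
  define pre where "pre = Assign ''b'' (Const 0)"
  have "runs Q syndrome_prog \<sigma> (csize pre * M + Suc h * (bsize cond * M + T)) (\<lambda>\<tau>. \<forall>x<n + K. arr \<tau> ''s'' (int x) = S h x)"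
    unfolding syndrome_prog_def pre_def[symmetric] cond_def[symmetric] mid_def[symmetric] loop_def[symmetric]
      last_def[symmetric] body_def[symmetric]
  proof (rule runs_Seq)
    show "runs Q pre \<sigma> (csize pre * M) (\<lambda>\<tau>. C \<tau> \<and> I 0 \<tau>)"
      using init s unfolding pre_def I_def C_def
      by (intro runs_loop_free) (auto intro!: small simp: S_def \<omega>_def)
  next
    fix \<tau>0 :: state assume \<tau>0: "C \<tau>0 \<and> I 0 \<tau>0"
    show "runs Q (While cond body) \<tau>0 (Suc h * (bsize cond * M + T)) (\<lambda>\<tau>. \<forall>x<n + K. arr \<tau> ''s'' (int x) = S h x)"
    proof (rule runs_While[where I = I])
      show "I 0 \<tau>0" using \<tau>0 by simp
    next
      fix b and \<tau> :: state assume b: "b < h" and I: "I b \<tau>" and f: "framed body \<tau>0 \<tau>"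
      have C: "C \<tau>" using C_framed[OF f _ wbody] \<tau>0 by simp
      have b\<tau>: "scal \<tau> ''b'' = int b" using I by (simp add: I_def)
      have bc: "bcost cond \<tau> \<le> bsize cond * M"
        using C b\<tau> b hn unfolding cond_def C_def by (intro bcost_le[THEN conjunct1]) (auto intro!: small)
      have ab: "a * b + a \<le> a * h" using b by (metis Suc_leI mult_Suc_right mult_le_mono2 add.commute)
      then have la: "a \<le> length (coins \<tau>)" using I len unfolding I_def \<omega>_def by simp
      define v where "v = bits_val (take a (drop (a * b) \<omega>))"
      have yv: "position a \<omega> b = b * 2 ^ a + v" by (simp add: position_def v_def)
      have "position a \<omega> b < Suc b * 2 ^ a" by (rule position_bound)
      also have "\<dots> \<le> n" unfolding n using b by (intro mult_le_mono1) simp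
      finally have yn: "position a \<omega> b < n" .
      have Pn: "2 ^ a \<le> n" using b by (simp add: n)
      have "runs Q body \<tau> T (I (Suc b))"
        unfolding body_def T_def
      proof (rule runs_Seq[OF runs_framed[OF runs_bits_prog]])
        show "scal \<tau> ''a'' = int a" using C by (simp add: C_def)
        show "a \<le> length (coins \<tau>)" by (rule la)
      next
        fix \<tau>1 :: state
        assume *: "(scal \<tau>1 ''y'' = int (bits_val (take a (coins \<tau>))) \<and> coins \<tau>1 = drop a (coins \<tau>)) \<and> framed bits_prog \<tau> \<tau>1"
        then have fr: "framed bits_prog \<tau> \<tau>1" by simp
        have C1: "C \<tau>1" by (rule C_framed[OF fr C]) (auto simp: wb)
        have b1: "scal \<tau>1 ''b'' = int b" using fr b\<tau> by (auto simp: framed_scal wb)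
        have y1: "scal \<tau>1 ''y'' = int v" using * I by (simp add: I_def v_def)
        have c1: "coins \<tau>1 = drop (a * Suc b) \<omega>" using * I by (simp add: I_def add.commute)
        have s1: "arr \<tau>1 ''s'' = arr \<tau> ''s''" using fr by (auto simp: framed_arr bits_prog_def)
        have bP: "int b * 2 ^ a = int (b * 2 ^ a)" "int (b * 2 ^ a) + int v = int (position a \<omega> b)" by (simp_all add: yv)
        have le: "b * 2 ^ a \<le> n" "v \<le> n" using yn yv by linarith+
        show "runs Q (Seq mid (Seq loop last)) \<tau>1 (csize mid * M + ((K + 1) * (30 * M + power_time n K) + csize last * M)) (I (Suc b))"
        proof (rule runs_Seq)
          show "runs Q mid \<tau>1 (csize mid * M) (\<lambda>\<tau>'. (scal \<tau>' ''y'' = int (position a \<omega> b) \<and> scal \<tau>' ''r'' = 0) \<and> framed mid \<tau>1 \<tau>')"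
          proof (rule runs_framed)
            have "(2::int) ^ a \<le> int n" using Pn by (metis of_nat_le_iff of_nat_numeral of_nat_power)
            then have "\<bar>(2::int) ^ a\<bar> \<le> int (n + 1)" using zero_le_power[of "2::int" a] by linarith
            then have P: "int_cost (2 ^ a) \<le> M" by (rule small)
            have ic: "int_cost (int b) \<le> M" "int_cost (int v) \<le> M" "int_cost 0 \<le> M"
              "int_cost (int (b * 2 ^ a)) \<le> M" "int_cost (int (position a \<omega> b)) \<le> M"
              by (rule small, use b hn le yn in \<open>simp del: of_nat_mult\<close>)+
            show "runs Q mid \<tau>1 (csize mid * M) (\<lambda>\<tau>'. scal \<tau>' ''y'' = int (position a \<omega> b) \<and> scal \<tau>' ''r'' = 0)"
              using C1 b1 y1 unfolding mid_def C_def
              by (intro runs_loop_free) (simp_all add: bP ic P del: of_nat_mult)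
          qed
        next
          fix \<tau>2 :: state
          assume *: "(scal \<tau>2 ''y'' = int (position a \<omega> b) \<and> scal \<tau>2 ''r'' = 0) \<and> framed mid \<tau>1 \<tau>2"
          then have fr: "framed mid \<tau>1 \<tau>2" by simp
          have C2: "C \<tau>2" by (rule C_framed[OF fr C1]) (auto simp: wm)
          have b2: "scal \<tau>2 ''b'' = int b" using fr b1 by (auto simp: framed_scal wm)
          have c2: "coins \<tau>2 = drop (a * Suc b) \<omega>" using fr c1 by (auto simp: framed_coins mid_def)
          have s2: "arr \<tau>2 ''s'' (int x) = S b x" if "x < n + K" for x
            using fr s1 I that by (auto simp: framed_arr mid_def I_def)
          show "runs Q (Seq loop last) \<tau>2 ((K + 1) * (30 * M + power_time n K) + csize last * M) (I (Suc b))"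
          proof (rule runs_Seq[OF runs_framed])
            show "runs Q loop \<tau>2 ((K + 1) * (30 * M + power_time n K))
              (\<lambda>\<tau>. \<forall>x<n + K. arr \<tau> ''s'' (int x) = (if x < n then S b x else S b x + int W * (int (position a \<omega> b) ^ (x - n) mod int q)))"
              unfolding loop_def
            proof (rule runs_accumulate_prog)
              show "0 \<le> S b x \<and> S b x \<le> int (h * (W * q))" for x using S_bound[of b x] b by simp
            qed (use C2 * yn q s2 in \<open>auto simp: C_def M_def\<close>)
          next
            fix \<tau>3 :: state
            assume *: "(\<forall>x<n + K. arr \<tau>3 ''s'' (int x) = (if x < n then S b x else S b x + int W * (int (position a \<omega> b) ^ (x - n) mod int q)))
              \<and> framed loop \<tau>2 \<tau>3"
            then have fr: "framed loop \<tau>2 \<tau>3" by simp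
            have b3: "scal \<tau>3 ''b'' = int b" using fr b2 by (auto simp: framed_scal wl)
            have c3: "coins \<tau>3 = drop (a * Suc b) \<omega>" using fr c2 by (auto simp: framed_coins loop_def accumulate_prog_def)
            have s3: "\<forall>x<n + K. arr \<tau>3 ''s'' (int x) = S (Suc b) x"
              using * by (auto simp: S_def distrib_left)
            show "runs Q last \<tau>3 (csize last * M) (I (Suc b))"
              using b3 c3 s3 b hn unfolding last_def I_def
              by (intro runs_loop_free) (auto intro!: small)
          qed
        qed
      qed
      then show "bval cond \<tau> \<and> bcost cond \<tau> \<le> bsize cond * M \<and> runs Q body \<tau> T (I (Suc b))"
        using bc C b\<tau> b by (simp add: cond_def C_def)
    next
      fix \<tau> :: state assume I: "I h \<tau>" and f: "framed body \<tau>0 \<tau>"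
      have C: "C \<tau>" using C_framed[OF f _ wbody] \<tau>0 by simp
      have b\<tau>: "scal \<tau> ''b'' = int h" using I by (simp add: I_def)
      have "bcost cond \<tau> \<le> bsize cond * M"
        using C b\<tau> hn unfolding cond_def C_def by (intro bcost_le[THEN conjunct1]) (auto intro!: small)
      then show "\<not> bval cond \<tau> \<and> bcost cond \<tau> \<le> bsize cond * M \<and> (\<forall>x<n + K. arr \<tau> ''s'' (int x) = S h x)"
        using C b\<tau> I by (simp add: cond_def C_def I_def)
    qed
  qed
  moreover have "csize pre * M + Suc h * (bsize cond * M + T) \<le> syndrome_time n K q W h a"
  proof -
    define M' where "M' = n * K + n + K + 2 * h * (W * q) + W * q + W + q + a + 5"
    have MM: "M \<le> M'" by (simp add: M_def M'_def)
    have s: "csize pre = 2" "bsize cond = 3" "csize mid = 8" "csize last = 4"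
      by (simp_all add: pre_def cond_def mid_def last_def)
    have "3 * M + T = bits_time a + (15 * M + (K + 1) * (30 * M + power_time n K))"
      unfolding T_def s by simp
    also have "\<dots> \<le> bits_time a + (15 * M' + (K + 1) * (30 * M' + power_time n K))"
      using MM by (intro add_left_mono add_mono mult_le_mono) auto
    finally have "Suc h * (3 * M + T) \<le> Suc h * (bits_time a + (15 * M' + (K + 1) * (30 * M' + power_time n K)))"
      by (rule mult_le_mono2)
    moreover have "2 * M \<le> 2 * M'" using MM by simp
    ultimately have "2 * M + Suc h * (3 * M + T) \<le> 2 * M' + Suc h * (bits_time a + (15 * M' + (K + 1) * (30 * M' + power_time n K)))"
      by (rule add_mono[rotated])
    also have "\<dots> \<le> (h + 2) * ((K + 2) * (60 * M' + power_time n K) + bits_time a)"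
      by (simp add: algebra_simps)
    finally show ?thesis unfolding syndrome_time_def M'_def[symmetric] s .
  qed
  ultimately show ?thesis by (rule runs_mono) (simp add: S_def \<omega>_def)
qed

text \<open>With u and v as computed here, u/v lies in (p, p + 2^(-L-j)]: adding 1 turns the floor
  into a strict upper bound. The index L + j of the query is logarithmic in m and k, so its unary
  charge is harmless.\<close>

definition exp_prog :: "nat \<Rightarrow> com" where
  "exp_prog j = Seq (Query ''u'' (Add (Var ''L'') (Const (int j))))
     (Seq (Assign ''u'' (Add (Var ''u'') (Const 1))) (Assign ''v'' (Mul (Const (2 ^ j)) (Var ''x''))))"

lemma runs_Query:
  assumes "acost_ok M e \<sigma>" "i = nat (aval e \<sigma>)" "i \<le> T" "int_cost (Q i) \<le> M"
    and "R (\<sigma>\<lparr>scal := (scal \<sigma>)(x := Q i)\<rparr>)"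
  shows "runs Q (Query x e) \<sigma> (T + (asize e + 2) * M) R"
proof -
  have "1 \<le> M" "acost e \<sigma> \<le> asize e * M" using acost_ok_pos acost_le assms(1) by auto
  then have "1 + acost e \<sigma> + i + int_cost (Q i) \<le> T + (asize e + 2) * M"
    using assms(3,4) by (simp add: add_mult_distrib del: acost.simps)
  then show ?thesis unfolding runs_def using exec.Query[OF assms(2), of Q x] assms(5) by blast
qed

lemma runs_exp_prog:
  assumes p: "0 \<le> p" and L: "scal \<sigma> ''L'' = int L" "scal \<sigma> ''x'' = 2 ^ L"
    and u: "u = nat \<lfloor>2 ^ (L + j) * p\<rfloor> + 1"
  shows "runs (dyadic_approx p) (exp_prog j) \<sigma> (20 * (u + 2 ^ (L + j) + 2))
    (\<lambda>\<tau>. scal \<tau> ''u'' = int u \<and> scal \<tau> ''v'' = int (2 ^ (L + j)))"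
proof -
  define D :: nat where "D = 2 ^ (L + j)"
  define Z where "Z = u + D"
  define M where "M = Z + 2"
  have small: "int_cost v \<le> M" if "\<bar>v\<bar> \<le> int Z" for v
    unfolding M_def using that by (rule int_cost_le)
  define u0 where "u0 = nat \<lfloor>2 ^ (L + j) * p\<rfloor>"
  have d: "dyadic_approx p (L + j) = int u0"
    unfolding dyadic_approx_def u0_def using p by simp
  have u1: "u = u0 + 1" by (simp add: u u0_def)
  have lt: "L + j < D" unfolding D_def by (rule less_exp)
  define Dj :: nat where "Dj = 2 ^ j"
  define DL :: nat where "DL = 2 ^ L"
  have Pj: "Dj \<le> D" "DL \<le> D" unfolding D_def Dj_def DL_def by (intro power_increasing; simp)+
  have ic: "int_cost (int L) \<le> M" "int_cost (int j) \<le> M" "int_cost (int L + int j) \<le> M" "int_cost (int u0) \<le> M"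
    "int_cost 1 \<le> M" "int_cost (int u0 + 1) \<le> M" "int_cost (int Dj) \<le> M" "int_cost (int DL) \<le> M"
    "int_cost (int D) \<le> M"
    by (rule small, use lt Pj u1 in \<open>simp add: Z_def\<close>)+
  have pw: "int Dj * int DL = int D" by (simp add: D_def Dj_def DL_def power_add)
  have pj: "(2::int) ^ j = int Dj" "(2::int) ^ L = int DL" by (simp_all add: Dj_def DL_def)
  define rest where "rest = Seq (Assign ''u'' (Add (Var ''u'') (Const 1))) (Assign ''v'' (Mul (Const (2 ^ j)) (Var ''x'')))"
  have "runs (dyadic_approx p) (exp_prog j) \<sigma> ((D + (asize (Add (Var ''L'') (Const (int j))) + 2) * M) + csize rest * M)
    (\<lambda>\<tau>. scal \<tau> ''u'' = int u \<and> scal \<tau> ''v'' = int D)"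
    unfolding exp_prog_def rest_def[symmetric]
  proof (rule runs_Seq[where R = "\<lambda>\<tau>. scal \<tau> ''u'' = int u0 \<and> scal \<tau> ''x'' = int DL", OF runs_Query])
    show "acost_ok M (Add (Var ''L'') (Const (int j))) \<sigma>" using L ic by simp
    show "L + j = nat (aval (Add (Var ''L'') (Const (int j))) \<sigma>)" using L by (simp add: nat_add_distrib)
    show "L + j \<le> D" using lt by simp
    show "int_cost (dyadic_approx p (L + j)) \<le> M" using ic by (simp add: d)
    show "scal (\<sigma>\<lparr>scal := (scal \<sigma>)(''u'' := dyadic_approx p (L + j))\<rparr>) ''u'' = int u0 \<and>
        scal (\<sigma>\<lparr>scal := (scal \<sigma>)(''u'' := dyadic_approx p (L + j))\<rparr>) ''x'' = int DL"
      using L by (simp add: d pj)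
  next
    fix \<tau> :: state assume \<tau>: "scal \<tau> ''u'' = int u0 \<and> scal \<tau> ''x'' = int DL"
    show "runs (dyadic_approx p) rest \<tau> (csize rest * M) (\<lambda>\<tau>. scal \<tau> ''u'' = int u \<and> scal \<tau> ''v'' = int D)"
    proof (rule runs_loop_free)
      show "cost_ok M rest \<tau>"
        using \<tau> ic unfolding rest_def pj by (simp add: pw del: of_nat_mult)
      show "scal (after rest \<tau>) ''u'' = int u \<and> scal (after rest \<tau>) ''v'' = int D"
        using \<tau> unfolding rest_def pj by (simp add: u1 pw del: of_nat_mult)
    qed (simp add: rest_def)
  qed
  moreover have "(D + (asize (Add (Var ''L'') (Const (int j))) + 2) * M) + csize rest * M \<le> 20 * (u + D + 2)"
    by (simp add: rest_def M_def Z_def)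
  ultimately show ?thesis unfolding D_def by (rule runs_mono)
qed

text \<open>An exponent \<open>num L / den L\<close> just above \<open>p\<close>: the exact value for rational \<open>p\<close>, a dyadic
  approximation of precision \<open>2 ^ (- L - j)\<close> otherwise.\<close>

lemma exponent_program:
  assumes p: "1 \<le> p" and \<eta>: "0 < \<eta>"
  shows "\<exists>c num den C. (p \<in> \<rat> \<longrightarrow> oracle_free c) \<and> scalars_written c \<subseteq> {''u'', ''v''} \<and>
    arrays_written c = {} \<and> flip_free c \<and>
    (\<forall>L. 1 \<le> den L \<and> den L \<le> C * 2 ^ L \<and> num L \<le> C * 2 ^ L \<and> p \<le> real (num L) / real (den L) \<and>
      (\<forall>x::real. 1 \<le> x \<and> x \<le> 2 ^ L \<longrightarrow> x powr (real (num L) / real (den L)) \<le> (1 + \<eta>) * x powr p) \<and>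
      (\<forall>\<sigma>. scal \<sigma> ''L'' = int L \<and> scal \<sigma> ''x'' = 2 ^ L \<longrightarrow>
        runs (dyadic_approx p) c \<sigma> (C * 2 ^ L) (\<lambda>\<tau>. scal \<tau> ''u'' = int (num L) \<and> scal \<tau> ''v'' = int (den L))))"
proof (cases "p \<in> \<rat>")
  case True
  then obtain a b :: nat where ab: "b \<noteq> 0" "p = real a / real b"
    using p by (elim Rats_abs_nat_div_natE) auto
  define c where "c = Seq (Assign ''u'' (Const (int a))) (Assign ''v'' (Const (int b)))"
  define C where "C = 10 * (a + b + 2)"
  have C: "y \<le> C * 2 ^ L" if "y \<le> C" for L y
  proof -
    have "C \<le> C * 2 ^ L" by simp
    with that show ?thesis by (rule le_trans)
  qed
  define M where "M = a + b + 2"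
  have ic: "int_cost (int a) \<le> M" "int_cost (int b) \<le> M"
    unfolding M_def by (rule int_cost_le, simp)+
  have run: "runs Q c \<sigma> (C * 2 ^ L) (\<lambda>\<tau>. scal \<tau> ''u'' = int a \<and> scal \<tau> ''v'' = int b)" for Q \<sigma> L
  proof (rule runs_mono)
    show "runs Q c \<sigma> (csize c * M) (\<lambda>\<tau>. scal \<tau> ''u'' = int a \<and> scal \<tau> ''v'' = int b)"
      unfolding c_def by (intro runs_loop_free) (simp_all add: ic)
    show "csize c * M \<le> C * 2 ^ L" by (rule C) (simp add: c_def C_def M_def)
  qed
  have x: "x powr (real a / real b) \<le> (1 + \<eta>) * x powr p" for x
    using \<eta> ab(2) mult_right_mono[of 1 "1 + \<eta>" "x powr p"] by simp
  have "oracle_free c" "scalars_written c \<subseteq> {''u'', ''v''}" "arrays_written c = {}" "flip_free c"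
    by (auto simp: c_def)
  moreover have "1 \<le> b" "\<And>L. b \<le> C * 2 ^ L" "\<And>L. a \<le> C * 2 ^ L"
    using ab(1) by simp (rule C, simp add: C_def)+
  ultimately show ?thesis using ab(2) x run
    by (intro exI[of _ c] exI[of _ "\<lambda>_. a"] exI[of _ "\<lambda>_. b"] exI[of _ C]) simp
next
  case False
  \<comment> \<open>An exponent too large by at most 2^(-L-j) costs a factor whose logarithm is at
    most ln x / 2^(L+j) \<le> 2^(-j) for x \<le> 2^L, using only ln x \<le> x. So
    \<open>2 ^ j\<close> has to exceed \<open>1 / ln (1 + \<eta>)\<close>.\<close>
  obtain j :: nat where j: "1 / ln (1 + \<eta>) < 2 ^ j" using real_arch_pow[of 2 "1 / ln (1 + \<eta>)"] by auto
  have ln0: "0 < ln (1 + \<eta>)" using \<eta> by simp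
  define num where "num L = nat \<lfloor>2 ^ (L + j) * p\<rfloor> + 1" for L
  define den where "den L = (2::nat) ^ (L + j)" for L
  define P where "P = nat \<lceil>p\<rceil>"
  define C where "C = 20 * (2 ^ j * P + 2 ^ j + 3)"
  have le1: "(1::nat) \<le> 2 ^ L" for L by simp
  have num_le: "num L \<le> 2 ^ L * 2 ^ j * P + 1" for L
  proof -
    have "\<lfloor>2 ^ (L + j) * p\<rfloor> \<le> \<lfloor>2 ^ (L + j) * real P\<rfloor>"
      unfolding P_def by (intro floor_mono mult_left_mono) (auto simp: real_nat_ceiling_ge)
    also have "2 ^ (L + j) * real P = real (2 ^ (L + j) * P)" by simp
    then have "\<lfloor>2 ^ (L + j) * real P\<rfloor> = int (2 ^ (L + j) * P)" by (metis floor_of_nat)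
    finally have "\<lfloor>2 ^ (L + j) * p\<rfloor> \<le> int (2 ^ (L + j) * P)" .
    then have "nat \<lfloor>2 ^ (L + j) * p\<rfloor> \<le> 2 ^ (L + j) * P" by (simp only: nat_le_iff)
    then show ?thesis by (simp add: num_def power_add)
  qed
  have time: "20 * (num L + 2 ^ (L + j) + 2) \<le> C * 2 ^ L" for L
  proof -
    have "20 * (num L + 2 ^ (L + j) + 2) \<le> 20 * (2 ^ L * 2 ^ j * P + 1 + 2 ^ L * 2 ^ j + 2)"
      using num_le[of L] by (simp add: power_add)
    also have "\<dots> \<le> C * 2 ^ L" using le1[of L] by (simp add: C_def algebra_simps)
    finally show ?thesis .
  qed
  have "1 \<le> den L \<and> den L \<le> C * 2 ^ L \<and> num L \<le> C * 2 ^ L \<and> p \<le> real (num L) / real (den L) \<and>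
      (\<forall>x::real. 1 \<le> x \<and> x \<le> 2 ^ L \<longrightarrow> x powr (real (num L) / real (den L)) \<le> (1 + \<eta>) * x powr p) \<and>
      (\<forall>\<sigma>. scal \<sigma> ''L'' = int L \<and> scal \<sigma> ''x'' = 2 ^ L \<longrightarrow>
        runs (dyadic_approx p) (exp_prog j) \<sigma> (C * 2 ^ L) (\<lambda>\<tau>. scal \<tau> ''u'' = int (num L) \<and> scal \<tau> ''v'' = int (den L)))" for L
  proof (intro conjI allI impI)
    show "1 \<le> den L" by (simp add: den_def)
    show "den L \<le> C * 2 ^ L" unfolding den_def by (rule le_trans[OF _ time]) simp
    show "num L \<le> C * 2 ^ L" by (rule le_trans[OF _ time]) simp
    define q where "q = real (den L)"
    have q: "q = 2 ^ (L + j)" "0 < q" by (simp_all add: q_def den_def)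
    have fl: "0 \<le> \<lfloor>q * p\<rfloor>" using q p by simp
    have num: "real (num L) = real_of_int \<lfloor>q * p\<rfloor> + 1" using fl by (simp add: num_def q)
    have lo: "q * p \<le> real (num L)" unfolding num by linarith
    have hi: "real (num L) \<le> q * p + 1" unfolding num by linarith
    show "p \<le> real (num L) / real (den L)"
      using lo q(2) unfolding q_def[symmetric] by (simp add: field_simps)
    have up: "real (num L) / real (den L) \<le> p + 1 / q"
      using hi q(2) unfolding q_def[symmetric] by (simp add: field_simps)
    show "x powr (real (num L) / real (den L)) \<le> (1 + \<eta>) * x powr p" if x: "1 \<le> x \<and> x \<le> 2 ^ L" for x :: real
    proof -
      have "x powr (real (num L) / real (den L)) \<le> x powr (p + 1 / q)" using up x by (intro powr_mono) auto
      also have "\<dots> = x powr p * x powr (1 / q)" by (rule powr_add)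
      also have "x powr (1 / q) \<le> 1 + \<eta>"
      proof -
        have "ln x \<le> x" using x ln_le_minus_one[of x] by linarith
        then have "ln x \<le> 2 ^ L" using x by linarith
        then have "1 / q * ln x \<le> 1 / q * 2 ^ L" using q by (intro mult_left_mono) auto
        also have "\<dots> = 1 / 2 ^ j" by (simp add: q power_add)
        also have "\<dots> \<le> ln (1 + \<eta>)" using j ln0 by (simp add: field_simps)
        finally have "exp (1 / q * ln x) \<le> exp (ln (1 + \<eta>))" by simp
        then show ?thesis using x \<eta> by (simp add: powr_def)
      qed
      then have "x powr p * x powr (1 / q) \<le> x powr p * (1 + \<eta>)" by (intro mult_left_mono) auto
      finally show ?thesis by (simp add: mult.commute)
    qed
    fix \<sigma> :: state assume "scal \<sigma> ''L'' = int L \<and> scal \<sigma> ''x'' = 2 ^ L"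
    then have "runs (dyadic_approx p) (exp_prog j) \<sigma> (20 * (num L + 2 ^ (L + j) + 2))
      (\<lambda>\<tau>. scal \<tau> ''u'' = int (num L) \<and> scal \<tau> ''v'' = int (den L))"
      unfolding den_def using p by (intro runs_exp_prog) (auto simp: num_def)
    then show "runs (dyadic_approx p) (exp_prog j) \<sigma> (C * 2 ^ L) (\<lambda>\<tau>. scal \<tau> ''u'' = int (num L) \<and> scal \<tau> ''v'' = int (den L))"
      by (rule runs_mono) (use time in auto)
  qed
  moreover have "scalars_written (exp_prog j) \<subseteq> {''u'', ''v''}" "arrays_written (exp_prog j) = {}" "flip_free (exp_prog j)"
    by (auto simp: exp_prog_def)
  ultimately show ?thesis using False
    by (intro exI[of _ "exp_prog j"] exI[of _ num] exI[of _ den] exI[of _ C]) simp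
qed

section \<open>Parameters\<close>

text \<open>Restricted to positive arguments, where the estimates of the parameters are available;
  the final bounds are extended to all arguments explicitly.\<close>

definition poly_bounded_pos :: "(nat \<Rightarrow> nat \<Rightarrow> nat) \<Rightarrow> bool" where
  "poly_bounded_pos f \<longleftrightarrow> (\<exists>C. \<forall>m k. 1 \<le> m \<longrightarrow> 1 \<le> k \<longrightarrow> f m k \<le> C * (m + k + 1) ^ C)"

lemma poly_bounded_pos_common:
  assumes "poly_bounded_pos f" "poly_bounded_pos g"
  obtains C where "\<And>m k. 1 \<le> m \<Longrightarrow> 1 \<le> k \<Longrightarrow> f m k \<le> C * (m + k + 1) ^ C \<and> g m k \<le> C * (m + k + 1) ^ C"
proof -
  obtain C D where C: "\<And>m k. 1 \<le> m \<Longrightarrow> 1 \<le> k \<Longrightarrow> f m k \<le> C * (m + k + 1) ^ C"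
    and D: "\<And>m k. 1 \<le> m \<Longrightarrow> 1 \<le> k \<Longrightarrow> g m k \<le> D * (m + k + 1) ^ D"
    using assms unfolding poly_bounded_pos_def by metis
  have up: "c * (m + k + 1) ^ c \<le> max C D * (m + k + 1) ^ max C D" if "c \<le> max C D" for c m k
    using that by (intro mult_le_mono power_increasing) auto
  show ?thesis
    by (rule that[of "max C D"]) (use C D up[of C] up[of D] le_trans in \<open>meson max.cobounded1 max.cobounded2\<close>)
qed

lemma poly_bounded_pos_mono: "poly_bounded_pos g \<Longrightarrow> (\<And>m k. 1 \<le> m \<Longrightarrow> 1 \<le> k \<Longrightarrow> f m k \<le> g m k) \<Longrightarrow> poly_bounded_pos f"
  unfolding poly_bounded_pos_def by (meson le_trans)

lemma poly_bounded_pos_const: "poly_bounded_pos (\<lambda>m k. c)"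
  unfolding poly_bounded_pos_def by (rule exI[of _ c]) simp

lemma poly_bounded_pos_fst: "poly_bounded_pos (\<lambda>m k. m)" and poly_bounded_pos_snd: "poly_bounded_pos (\<lambda>m k. k)"
  unfolding poly_bounded_pos_def by (rule exI[of _ 1], simp)+

lemma poly_bounded_pos_add: "poly_bounded_pos f \<Longrightarrow> poly_bounded_pos g \<Longrightarrow> poly_bounded_pos (\<lambda>m k. f m k + g m k)"
proof -
  assume "poly_bounded_pos f" "poly_bounded_pos g"
  then obtain C where C: "\<And>m k. 1 \<le> m \<Longrightarrow> 1 \<le> k \<Longrightarrow> f m k \<le> C * (m + k + 1) ^ C \<and> g m k \<le> C * (m + k + 1) ^ C"
    using poly_bounded_pos_common by blast
  show ?thesis unfolding poly_bounded_pos_def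
  proof (intro exI[of _ "2 * C"] allI impI)
    fix m k :: nat assume mk: "1 \<le> m" "1 \<le> k"
    have "f m k + g m k \<le> (2 * C) * (m + k + 1) ^ C" using C[OF mk] by simp
    also have "\<dots> \<le> (2 * C) * (m + k + 1) ^ (2 * C)" by (intro mult_le_mono2 power_increasing) auto
    finally show "f m k + g m k \<le> (2 * C) * (m + k + 1) ^ (2 * C)" .
  qed
qed

lemma poly_bounded_pos_mult: "poly_bounded_pos f \<Longrightarrow> poly_bounded_pos g \<Longrightarrow> poly_bounded_pos (\<lambda>m k. f m k * g m k)"
proof -
  assume "poly_bounded_pos f" "poly_bounded_pos g"
  then obtain C where C: "\<And>m k. 1 \<le> m \<Longrightarrow> 1 \<le> k \<Longrightarrow> f m k \<le> C * (m + k + 1) ^ C \<and> g m k \<le> C * (m + k + 1) ^ C"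
    using poly_bounded_pos_common by blast
  show ?thesis unfolding poly_bounded_pos_def
  proof (intro exI[of _ "C * C + 2 * C"] allI impI)
    fix m k :: nat assume mk: "1 \<le> m" "1 \<le> k"
    have "f m k * g m k \<le> (C * (m + k + 1) ^ C) * (C * (m + k + 1) ^ C)" using C[OF mk] by (intro mult_le_mono) auto
    also have "\<dots> = (C * C) * (m + k + 1) ^ (2 * C)" by (subst mult_2) (simp only: power_add mult_ac)
    also have "\<dots> \<le> (C * C + 2 * C) * (m + k + 1) ^ (C * C + 2 * C)" by (intro mult_le_mono power_increasing) auto
    finally show "f m k * g m k \<le> (C * C + 2 * C) * (m + k + 1) ^ (C * C + 2 * C)" .
  qed
qed

lemma poly_bounded_pos_power: "poly_bounded_pos f \<Longrightarrow> poly_bounded_pos (\<lambda>m k. f m k ^ e)"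
  by (induction e) (auto intro: poly_bounded_pos_const poly_bounded_pos_mult)

lemma poly_bounded_pos_Suc: "poly_bounded_pos f \<Longrightarrow> poly_bounded_pos (\<lambda>m k. Suc (f m k))"
  using poly_bounded_pos_add[of f "\<lambda>m k. 1"] poly_bounded_pos_const[of 1] by simp

lemmas poly_bounded_pos_intros = poly_bounded_pos_const poly_bounded_pos_fst poly_bounded_pos_snd poly_bounded_pos_add poly_bounded_pos_mult poly_bounded_pos_power poly_bounded_pos_Suc

text \<open>A budget in units of \<open>\<epsilon> * D \<ge> 12\<close>. The approximate exponent
  adds \<epsilon>D/24 to D/2 and the roundings add 3/2 \<le> \<epsilon>D/8, so K \<le> D/2 +
  \<epsilon>D/6. The surplus multiplies this by at most 1 + \<epsilon>/2. The result stays below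
  (1/2 + 5\<epsilon>/6) D, which leaves \<epsilon>/6 for the term 2/\<gamma>^p.\<close>

lemma parameter_bounds:
  fixes D \<epsilon> :: real
  assumes \<epsilon>: "0 < \<epsilon>" "\<epsilon> \<le> 1 / 2" and D: "12 / \<epsilon> \<le> D"
    and E: "D \<le> real E" "real E \<le> (1 + \<epsilon> / 12) * D + 1"
    and w: "w = nat \<lceil>2 / \<epsilon>\<rceil>" and K: "K = E div 2 + 1" and h: "h = K + K div w"
  shows "D < 2 * real K" "real h \<le> (1 / 2 + 5 * \<epsilon> / 6) * D" "1 \<le> w" "K \<le> 2 * (w * (K div w))"
proof -
  have eD: "12 \<le> \<epsilon> * D" using D \<epsilon> by (simp add: field_simps)
  have D24: "24 \<le> D"
  proof -
    have "24 \<le> 12 / \<epsilon>" using \<epsilon> by (simp add: field_simps)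
    then show ?thesis using D by linarith
  qed
  have "E < 2 * K" unfolding K by presburger
  then show DK: "D < 2 * real K" using E(1) by linarith
  have w_lo: "2 / \<epsilon> \<le> real w" unfolding w by (rule real_nat_ceiling_ge)
  have "0 < 2 / \<epsilon>" using \<epsilon> by simp
  then have "0 \<le> \<lceil>2 / \<epsilon>\<rceil>" by linarith
  then have "real w = real_of_int \<lceil>2 / \<epsilon>\<rceil>" unfolding w by (rule of_nat_nat)
  then have w_hi: "real w \<le> 2 / \<epsilon> + 1" by linarith
  show w1: "1 \<le> w" using w_lo \<epsilon> by (cases w) (auto simp: field_simps)
  have "real w * \<epsilon> \<le> 2 + \<epsilon>" using w_hi \<epsilon> by (simp add: field_simps)
  also have "\<dots> \<le> \<epsilon> * D / 2" using eD \<epsilon> by simp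
  also have "\<dots> < real K * \<epsilon>" using DK \<epsilon> by simp
  \<comment> \<open>Once w \<le> K, the quotient is at least 1 and the remainder is below one more
    w, so K is less than twice \<open>w * (K div w)\<close>.\<close>
  finally have "w \<le> K" using \<epsilon> by simp
  then have "1 \<le> K div w" using w1 by (simp add: div_greater_zero_iff Suc_leI)
  then have "w \<le> w * (K div w)" by simp
  moreover have "K < w + w * (K div w)" 
    using mult_div_mod_eq[of w K] mod_less_divisor[of w K] w1 by linarith
  ultimately show "K \<le> 2 * (w * (K div w))" by linarith
  have "real (K div w) \<le> real K / real w" by (rule of_nat_div_le_of_nat)
  also have "\<dots> \<le> real K * (\<epsilon> / 2)"
  proof -
    have "1 / real w \<le> \<epsilon> / 2" using w_lo w1 \<epsilon> by (simp add: field_simps)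
    then show ?thesis using mult_left_mono[of "1 / real w" "\<epsilon> / 2" "real K"] by simp
  qed
  finally have h1: "real h \<le> real K * (1 + \<epsilon> / 2)" by (simp add: h algebra_simps)
  have "real K \<le> real E / 2 + 1" unfolding K using of_nat_div_le_of_nat[of E 2, where ?'a = real] by simp
  also have "\<dots> \<le> ((1 + \<epsilon> / 12) * D + 1) / 2 + 1" using E(2) by simp
  also have "\<dots> = D / 2 + \<epsilon> * D / 24 + 3 / 2" by (simp add: field_simps)
  also have "\<dots> \<le> D / 2 + \<epsilon> * D / 6" using eD by linarith
  finally have K1: "real K \<le> D / 2 + \<epsilon> * D / 6" .
  have "real h \<le> (D / 2 + \<epsilon> * D / 6) * (1 + \<epsilon> / 2)"
    using h1 mult_right_mono[OF K1, of "1 + \<epsilon> / 2"] \<epsilon> by linarith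
  also have "\<dots> = D / 2 + \<epsilon> * D * (5 / 12 + \<epsilon> / 12)" by (simp add: field_simps)
  also have "\<dots> \<le> D / 2 + \<epsilon> * D * (5 / 6)"
    using \<epsilon> eD by (intro add_left_mono mult_left_mono) auto
  also have "\<dots> = (1 / 2 + 5 * \<epsilon> / 6) * D" by (simp add: field_simps)
  finally show "real h \<le> (1 / 2 + 5 * \<epsilon> / 6) * D" .
qed

text \<open>c is linear on the left and sits in the exponent on the right. It is chosen from P and w
  alone, before L and h, and this is what keeps 2^(cL) polynomial in m and k.\<close>

lemma growth_constant:
  "\<exists>c\<ge>8. P \<le> c \<and> (\<forall>L\<ge>1. \<forall>h\<le>2 ^ (P * L). (4 * w + 1) * c * L * h + 2 \<le> (2::nat) ^ (c * L))"
proof -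
  define A where "A = (4 * w + 1) * (P + 1) + 2"
  define B where "B = 4 * w + 1"
  define y where "y = A + B + 2"
  \<comment> \<open>The exponent (P + 4y + 1) L has one part per factor: 4yL absorbs the constant
    coefficient through (y + 1)^4 \<le> 2^(4y), L absorbs the factor L \<le> 2^L, and PL absorbs
    h.\<close>
  define c1 where "c1 = 4 * y + 1"
  have c1: "(4 * w + 1) * (P + c1) + 2 \<le> 2 ^ (4 * y)"
  proof -
    have "(4 * w + 1) * (P + c1) + 2 = A + 4 * B * y" by (simp add: A_def B_def c1_def algebra_simps)
    also have "\<dots> \<le> y + 4 * y * y" by (intro add_mono mult_le_mono) (auto simp: y_def)
    also have "\<dots> \<le> y + 4 * y * y + (y * y * y * y + 4 * y * y * y + 2 * y * y + 3 * y + 1)" by simp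
    also have "\<dots> = (y + 1) ^ 4" by (simp add: power4_eq_xxxx algebra_simps)
    also have "\<dots> \<le> (2 ^ y) ^ 4" using Suc_leI[OF less_exp[of y]] by (intro power_mono) auto
    also have "\<dots> = 2 ^ (4 * y)" by (simp add: power_mult[symmetric] mult.commute)
    finally show ?thesis .
  qed
  show ?thesis
  proof (intro exI[of _ "P + c1"] conjI allI impI)
    show "8 \<le> P + c1" by (simp add: c1_def y_def)
    fix L h :: nat assume L: "1 \<le> L" and h: "h \<le> 2 ^ (P * L)"
    define X where "X = (2::nat) ^ (P * L)"
    have X1: "1 \<le> X" by (simp add: X_def)
    have "(4 * w + 1) * (P + c1) * L * h + 2 \<le> (4 * w + 1) * (P + c1) * L * X + 2 * (L * X)"
      using h L X1 unfolding X_def[symmetric] by (intro add_mono mult_le_mono) auto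
    also have "\<dots> = ((4 * w + 1) * (P + c1) + 2) * (L * X)" by (simp add: algebra_simps)
    also have "\<dots> \<le> 2 ^ (4 * y) * (2 ^ L * X)" using c1 less_exp[of L] by (intro mult_le_mono) auto
    also have "\<dots> = 2 ^ (4 * y + L + P * L)" by (simp add: X_def power_add)
    also have "\<dots> \<le> 2 ^ ((P + c1) * L)"
    proof (intro power_increasing)
      have "4 * y * 1 \<le> 4 * y * L" using L by (intro mult_le_mono2)
      then show "4 * y + L + P * L \<le> (P + c1) * L" by (simp add: c1_def algebra_simps)
    qed simp
    finally show "(4 * w + 1) * (P + c1) * L * h + 2 \<le> 2 ^ ((P + c1) * L)" .
  qed simp
qed

text \<open>The lcm argument loses a factor of order j, the bit length of the interval end. With j =
  a + cL the additional cL bits pay for j and h together.\<close>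

lemma next_prime_bound:
  assumes bound: "(4 * w + 1) * c * L * h + 2 \<le> 2 ^ (c * L)"
  shows "next_prime (h * 2 ^ (4 * w * c * L)) \<le> 2 ^ ((4 * w + 1) * c * L)"
proof -
  define j where "j = (4 * w + 1) * c * L"
  define a where "a = 4 * w * c * L"
  have ja: "j = a + c * L" by (simp add: j_def a_def algebra_simps)
  have "Suc (j * (h * 2 ^ a)) < j * (h * 2 ^ a) + 2 * 2 ^ a"
    using one_le_power[of "2::nat" a] by linarith
  also have "\<dots> = 2 ^ a * (j * h + 2)" by (simp add: algebra_simps)
  also have "2 ^ a * (j * h + 2) \<le> 2 ^ a * 2 ^ (c * L)" using bound unfolding j_def by (intro mult_le_mono2)
  also have "\<dots> = 2 ^ j" by (simp add: ja power_add)
  finally obtain q :: nat where "prime q" "h * 2 ^ a < q" "q \<le> 2 ^ j" using prime_between_power2 by blast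
  then show ?thesis using next_prime_le unfolding j_def a_def by (meson le_trans)
qed

text \<open>There are at most \<open>q ^ K\<close> syndromes, so a random one of the \<open>2 ^ (a h)\<close> choices has a syndrome
  shared with fewer than \<open>N\<close> others with probability at most \<open>1 / 100\<close>.\<close>

lemma counting_bound:
  fixes D B :: real
  assumes D: "24 \<le> D" "D < 2 * real K" and B: "1 \<le> B" "B \<le> 2 ^ L" and L: "1 \<le> L" and c: "8 \<le> c"
    and K: "K \<le> 2 * (w * (K div w))" and h: "h = K + K div w" and q: "q \<le> 2 ^ ((4 * w + 1) * c * L)"
  shows "100 * (real q ^ K * B powr (3 * D)) \<le> 2 ^ (4 * w * c * L * h)"
proof -
  have "real q \<le> real (2 ^ ((4 * w + 1) * c * L))" using q by (simp only: of_nat_le_iff)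
  then have "real q ^ K \<le> (2 ^ ((4 * w + 1) * c * L)) ^ K" by (intro power_mono) auto
  also have "\<dots> = 2 powr real ((4 * w + 1) * c * L * K)" by (simp add: powr_realpow power_mult[symmetric] del: of_nat_mult)
  finally have 1: "real q ^ K \<le> 2 powr real ((4 * w + 1) * c * L * K)" .
  have "B powr (3 * D) \<le> (2 ^ L) powr (3 * D)" using B D by (intro powr_mono2) auto
  also have "(2::real) ^ L = 2 powr real L" by (simp add: powr_realpow)
  also have "(2 powr real L) powr (3 * D) = 2 powr (real L * (3 * D))" by (rule powr_powr)
  finally have 2: "B powr (3 * D) \<le> 2 powr (real L * (3 * D))" .
  have 3: "(100::real) \<le> 2 powr 7" by (simp add: powr_realpow[symmetric])
  have "100 * (real q ^ K * B powr (3 * D)) \<le> 2 powr 7 * (2 powr real ((4 * w + 1) * c * L * K) * 2 powr (real L * (3 * D)))"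
    using 1 2 3 by (intro mult_mono) auto
  also have "\<dots> = 2 powr (7 + real ((4 * w + 1) * c * L * K) + real L * (3 * D))" by (simp add: powr_add)
  also have "\<dots> \<le> 2 powr real (4 * w * c * L * h)"
  proof (intro powr_mono)
    \<comment> \<open>With a = 4wcL, the exponent ah is aK + 4wcL (K div w) \<ge> aK + 2cLK, while
      q^K is at most 2^((a + cL) K). The remaining cLK \<ge> 8L D/2 = 4LD covers 3LD for N and 7
      \<le> LD for the factor 100 \<le> 2^7.\<close>
    have LD: "24 \<le> real L * D" using L D mult_mono[of 1 "real L" 24 D] by simp
    have "4 * (real L * D) = 8 * real L * (D / 2)" by simp
    also have "\<dots> \<le> real c * real L * real K" using c D by (intro mult_mono) auto
    finally have s: "7 + real L * (3 * D) \<le> real (c * L * K)" using LD by simp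
    have "c * L * (2 * K) \<le> c * L * (4 * (w * (K div w)))" using K by (intro mult_le_mono2) simp
    then have "(4 * w + 1) * c * L * K + c * L * K \<le> 4 * w * c * L * h"
      unfolding h by (simp add: algebra_simps)
    then have "real ((4 * w + 1) * c * L * K) + real (c * L * K) \<le> real (4 * w * c * L * h)"
      by (metis of_nat_add of_nat_le_iff)
    then show "7 + real ((4 * w + 1) * c * L * K) + real L * (3 * D) \<le> real (4 * w * c * L * h)" using s by linarith
  qed simp
  also have "\<dots> = 2 ^ (4 * w * c * L * h)" by (simp add: powr_realpow del: of_nat_mult)
  finally show ?thesis .
qed

section \<open>The whole algorithm\<close>

definition lattice_prog :: "nat \<Rightarrow> nat \<Rightarrow> nat \<Rightarrow> com \<Rightarrow> com" where
  "lattice_prog \<gamma> w c exponent = Seq (log_prog \<gamma>) (Seq exponent (Seq root_prog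
     (Seq (dim_prog w c) (Seq prime_prog (Seq matrix_prog syndrome_prog)))))"

lemma written_root_prog: "scalars_written root_prog = {''G'', ''i'', ''E'', ''R''}"
    "arrays_written root_prog = {}" "flip_free root_prog"
  and written_dim_prog: "scalars_written (dim_prog w c) = {''K'', ''h'', ''a'', ''t'', ''P'', ''i'', ''n''}"
    "arrays_written (dim_prog w c) = {}" "flip_free (dim_prog w c)"
  and written_prime_prog: "scalars_written prime_prog = {''q'', ''f'', ''i''}"
    "arrays_written prime_prog = {}" "flip_free prime_prog"
  and written_log_prog: "scalars_written (log_prog \<gamma>) = {''g'', ''x'', ''L''}"
    "arrays_written (log_prog \<gamma>) = {}" "flip_free (log_prog \<gamma>)"
  and written_matrix_prog: "scalars_written matrix_prog = {''rows'', ''cols'', ''W'', ''x'', ''i'', ''j'', ''e'', ''t'', ''r''}"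
    "arrays_written matrix_prog = {''A''}" "flip_free matrix_prog"
  and written_syndrome_prog: "scalars_written syndrome_prog = {''b'', ''y'', ''i'', ''f'', ''r'', ''t'', ''x''}"
    "arrays_written syndrome_prog = {''s''}"
  by (auto simp: root_prog_def dim_prog_def prime_prog_def trial_prog_def log_prog_def matrix_prog_def locate_prog_def
      entry_prog_def syndrome_prog_def bits_prog_def accumulate_prog_def)

lemma oracle_free_lattice_prog: "oracle_free (lattice_prog \<gamma> w c exponent) = oracle_free exponent"
  by (simp add: lattice_prog_def root_prog_def dim_prog_def prime_prog_def trial_prog_def log_prog_def matrix_prog_def
      locate_prog_def entry_prog_def syndrome_prog_def bits_prog_def accumulate_prog_def power_loop_def)

lemma result_eq:
  assumes "scal \<tau> ''rows'' = int z" "scal \<tau> ''cols'' = int z" and z: "z = n + K"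
    and A: "\<forall>x<z * z. arr \<tau> ''A'' (int x) = code_entry n q W (x div z) (x mod z)"
    and s: "\<forall>x<z. arr \<tau> ''s'' (int x) = (if x < n then 0 else W * (\<Sum>b<h. int (y b) ^ (x - n) mod int q))"
  shows "result \<tau> = (code_mat n K q W, syndrome_vec n K q W h y)"
proof -
  have "mat z z (\<lambda>(i, j). arr \<tau> ''A'' (int (i * z + j))) = code_mat n K q W"
  proof (rule eq_matI)
    fix i j assume "i < dim_row (code_mat n K q W)" "j < dim_col (code_mat n K q W)"
    then have ij: "i < z" "j < z" by (auto simp: code_mat_def z)
    have "i * z + j < Suc i * z" using ij by simp
    also have "\<dots> \<le> z * z" using ij by (intro mult_le_mono1) simp
    finally have "arr \<tau> ''A'' (int (i * z + j)) = code_entry n q W ((i * z + j) div z) ((i * z + j) mod z)"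
      using A by blast
    moreover have "(i * z + j) div z = i" "(i * z + j) mod z = j" using ij by auto
    ultimately show "mat z z (\<lambda>(i, j). arr \<tau> ''A'' (int (i * z + j))) $$ (i, j) = code_mat n K q W $$ (i, j)"
      using ij by (simp add: code_mat_def code_entry_def z)
  qed (simp_all add: code_mat_def z)
  moreover have "Matrix.vec z (\<lambda>i. arr \<tau> ''s'' (int i)) = syndrome_vec n K q W h y"
    using s by (intro eq_vecI) (auto simp: syndrome_vec_def z)
  ultimately show ?thesis using assms(1,2) by (simp add: result_def Let_def)
qed

lemma runs_lattice_prog:
  assumes mk: "1 \<le> m" "1 \<le> k"
    and ex: "scalars_written ex \<subseteq> {''u'', ''v''}" "arrays_written ex = {}" "flip_free ex"
    and L: "L = clog (2 * m * (1 + \<gamma> * k))"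
    and ex_run: "\<And>\<sigma>. scal \<sigma> ''L'' = int L \<and> scal \<sigma> ''x'' = 2 ^ L \<Longrightarrow>
      runs Q ex \<sigma> T0 (\<lambda>\<tau>. scal \<tau> ''u'' = int u \<and> scal \<tau> ''v'' = int v)"
    and v: "1 \<le> v" and g: "g = \<gamma> * k" and E: "E = root_ceil v (g ^ u)"
    and K: "K = E div 2 + 1" and h: "h = K + K div w" and a: "a = c * L" and n: "n = h * 2 ^ a"
    and q: "q = next_prime n" and len: "a * h \<le> length \<omega>"
  shows "runs Q (lattice_prog \<gamma> w c ex) (start m k \<omega>)
    (log_time \<gamma> m k + (T0 + (root_time g u v E + (dim_time w c E L K a n +
      (prime_time q + (matrix_time (n + K) g q + syndrome_time n K q (g + 1) h a))))))
    (\<lambda>\<tau>. result \<tau> = (code_mat n K q (int (g + 1)), syndrome_vec n K q (int (g + 1)) h (position a \<omega>)))"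
proof -
  have "1 \<le> h" by (simp add: h K)
  then have n1: "1 \<le> n" by (simp add: n)
  have q1: "1 \<le> q" using next_prime[of n] prime_ge_1_nat unfolding q by blast
  define R where "R \<tau> \<longleftrightarrow> result \<tau> = (code_mat n K q (int (g + 1)), syndrome_vec n K q (int (g + 1)) h (position a \<omega>))" for \<tau>
  \<comment> \<open>The syndrome block relies on unread coins and on an array s that is still zero;
    Z carries both past the earlier blocks.\<close>
  define Z where "Z \<tau> \<longleftrightarrow> coins \<tau> = \<omega> \<and> (\<forall>x. arr \<tau> ''s'' x = 0)" for \<tau> :: state
  show ?thesis
    unfolding lattice_prog_def R_def[symmetric]
  proof (rule runs_Seq[OF runs_framed[OF runs_log_prog]])
    show "scal (start m k \<omega>) ''m'' = int m" "scal (start m k \<omega>) ''k'' = int k" by (simp_all add: start_def)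
  next
    fix \<tau>1 :: state
    assume 1: "(scal \<tau>1 ''g'' = int (\<gamma> * k) \<and> scal \<tau>1 ''L'' = int (clog (2 * m * (1 + \<gamma> * k))) \<and>
      scal \<tau>1 ''x'' = 2 ^ clog (2 * m * (1 + \<gamma> * k))) \<and> framed (log_prog \<gamma>) (start m k \<omega>) \<tau>1"
    then have f1: "framed (log_prog \<gamma>) (start m k \<omega>) \<tau>1" by simp
    have Z1: "Z \<tau>1" using framed_coins[OF f1] framed_arr[OF f1, of "''s''"]
      by (simp add: Z_def written_log_prog start_def)
    have v1: "scal \<tau>1 ''g'' = int g" "scal \<tau>1 ''L'' = int L" "scal \<tau>1 ''x'' = 2 ^ L"
      using 1 by (simp_all only: g L)
    show "runs Q (Seq ex (Seq root_prog (Seq (dim_prog w c) (Seq prime_prog (Seq matrix_prog syndrome_prog))))) \<tau>1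
      (T0 + (root_time g u v E + (dim_time w c E L K a n +
        (prime_time q + (matrix_time (n + K) g q + syndrome_time n K q (g + 1) h a))))) R"
    proof (rule runs_Seq[OF runs_framed[OF ex_run]])
      show "scal \<tau>1 ''L'' = int L \<and> scal \<tau>1 ''x'' = 2 ^ L" using v1 by simp
    next
      fix \<tau>2 :: state
      assume 2: "(scal \<tau>2 ''u'' = int u \<and> scal \<tau>2 ''v'' = int v) \<and> framed ex \<tau>1 \<tau>2"
      then have f2: "framed ex \<tau>1 \<tau>2" by simp
      have fs: "scal \<tau>2 x = scal \<tau>1 x" if "x \<notin> {''u'', ''v''}" for x
        using framed_scal[OF f2] ex(1) that by blast
      have Z2: "Z \<tau>2" using framed_coins[OF f2] framed_arr[OF f2, of "''s''"] Z1 ex by (simp add: Z_def)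
      have v2: "scal \<tau>2 ''g'' = int g" "scal \<tau>2 ''L'' = int L" "scal \<tau>2 ''u'' = int u" "scal \<tau>2 ''v'' = int v"
        using v1 2 by (auto simp: fs)
      show "runs Q (Seq root_prog (Seq (dim_prog w c) (Seq prime_prog (Seq matrix_prog syndrome_prog)))) \<tau>2
        (root_time g u v E + (dim_time w c E L K a n +
          (prime_time q + (matrix_time (n + K) g q + syndrome_time n K q (g + 1) h a)))) R"
      proof (rule runs_Seq[OF runs_framed[OF runs_root_prog[OF v2(1,3,4) v E]]])
        fix \<tau>3 :: state
        assume 3: "scal \<tau>3 ''E'' = int E \<and> framed root_prog \<tau>2 \<tau>3"
        then have f3: "framed root_prog \<tau>2 \<tau>3" by simp
        have Z3: "Z \<tau>3" using framed_coins[OF f3] framed_arr[OF f3, of "''s''"] Z2 by (simp add: Z_def written_root_prog)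
        have v3: "scal \<tau>3 ''g'' = int g" "scal \<tau>3 ''L'' = int L" "scal \<tau>3 ''E'' = int E"
          using v2 3 framed_scal[OF f3] by (auto simp: written_root_prog)
        show "runs Q (Seq (dim_prog w c) (Seq prime_prog (Seq matrix_prog syndrome_prog))) \<tau>3
          (dim_time w c E L K a n + (prime_time q + (matrix_time (n + K) g q + syndrome_time n K q (g + 1) h a))) R"
        proof (rule runs_Seq[OF runs_framed[OF runs_dim_prog[OF v3(3,2) K h a n]]])
          fix \<tau>4 :: state
          assume 4: "(scal \<tau>4 ''K'' = int K \<and> scal \<tau>4 ''h'' = int h \<and> scal \<tau>4 ''a'' = int a \<and>
            scal \<tau>4 ''P'' = 2 ^ a \<and> scal \<tau>4 ''n'' = int n) \<and> framed (dim_prog w c) \<tau>3 \<tau>4"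
          then have f4: "framed (dim_prog w c) \<tau>3 \<tau>4" by simp
          have Z4: "Z \<tau>4" using framed_coins[OF f4] framed_arr[OF f4, of "''s''"] Z3 by (simp add: Z_def written_dim_prog)
          have v4: "scal \<tau>4 ''n'' = int n" "scal \<tau>4 ''K'' = int K" "scal \<tau>4 ''h'' = int h" "scal \<tau>4 ''a'' = int a"
              "scal \<tau>4 ''P'' = 2 ^ a" "scal \<tau>4 ''g'' = int g"
            using v3 4 framed_scal[OF f4] by (auto simp: written_dim_prog)
          show "runs Q (Seq prime_prog (Seq matrix_prog syndrome_prog)) \<tau>4
            (prime_time q + (matrix_time (n + K) g q + syndrome_time n K q (g + 1) h a)) R"
            unfolding q
          proof (rule runs_Seq[OF runs_framed[OF runs_prime_prog[OF v4(1) n1]]], unfold q[symmetric])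
            fix \<tau>5 :: state
            assume 5: "scal \<tau>5 ''q'' = int q \<and> framed prime_prog \<tau>4 \<tau>5"
            then have f5: "framed prime_prog \<tau>4 \<tau>5" by simp
            have Z5: "Z \<tau>5" using framed_coins[OF f5] framed_arr[OF f5, of "''s''"] Z4 by (simp add: Z_def written_prime_prog)
            have v5: "scal \<tau>5 ''n'' = int n" "scal \<tau>5 ''K'' = int K" "scal \<tau>5 ''q'' = int q" "scal \<tau>5 ''g'' = int g"
              "scal \<tau>5 ''h'' = int h" "scal \<tau>5 ''a'' = int a" "scal \<tau>5 ''P'' = 2 ^ a"
              using v4 5 framed_scal[OF f5] by (auto simp: written_prime_prog)
            show "runs Q (Seq matrix_prog syndrome_prog) \<tau>5
              (matrix_time (n + K) g q + syndrome_time n K q (g + 1) h a) R"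
            proof (rule runs_Seq[OF runs_framed[OF runs_matrix_prog[OF v5(1-4) q1 refl]]])
              fix \<tau>6 :: state
              assume 6: "(scal \<tau>6 ''rows'' = int (n + K) \<and> scal \<tau>6 ''cols'' = int (n + K) \<and> scal \<tau>6 ''W'' = int (g + 1) \<and>
                (\<forall>x<(n + K) * (n + K). arr \<tau>6 ''A'' (int x) = code_entry n q (int (g + 1)) (x div (n + K)) (x mod (n + K))))
                \<and> framed matrix_prog \<tau>5 \<tau>6"
              then have f6: "framed matrix_prog \<tau>5 \<tau>6" by simp
              have Z6: "coins \<tau>6 = \<omega>" "\<And>x. arr \<tau>6 ''s'' x = 0"
                using framed_coins[OF f6] framed_arr[OF f6, of "''s''"] Z5 by (auto simp: Z_def written_matrix_prog)
              have v6: "scal \<tau>6 ''n'' = int n" "scal \<tau>6 ''K'' = int K" "scal \<tau>6 ''q'' = int q" "scal \<tau>6 ''W'' = int (g + 1)"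
                "scal \<tau>6 ''h'' = int h" "scal \<tau>6 ''a'' = int a" "scal \<tau>6 ''P'' = 2 ^ a"
                using v5 6 framed_scal[OF f6] by (auto simp: written_matrix_prog)
              have len6: "a * h \<le> length (coins \<tau>6)" using Z6(1) len by simp
              have "runs Q syndrome_prog \<tau>6 (syndrome_time n K q (g + 1) h a) (\<lambda>\<tau>. (\<forall>x<n + K. arr \<tau> ''s'' (int x) =
                (if x < n then 0 else int (g + 1) * (\<Sum>b<h. int (position a \<omega> b) ^ (x - n) mod int q)))
                \<and> framed syndrome_prog \<tau>6 \<tau>)"
                using runs_framed[OF runs_syndrome_prog[OF v6 q1 n Z6(2) len6]] unfolding Z6(1) .
              then show "runs Q syndrome_prog \<tau>6 (syndrome_time n K q (g + 1) h a) R"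
              proof (rule runs_mono)
                fix \<tau> :: state
                assume *: "(\<forall>x<n + K. arr \<tau> ''s'' (int x) =
                  (if x < n then 0 else int (g + 1) * (\<Sum>b<h. int (position a \<omega> b) ^ (x - n) mod int q)))
                  \<and> framed syndrome_prog \<tau>6 \<tau>"
                then have f7: "framed syndrome_prog \<tau>6 \<tau>" by simp
                have "scal \<tau> ''rows'' = int (n + K)" "scal \<tau> ''cols'' = int (n + K)" "arr \<tau> ''A'' = arr \<tau>6 ''A''"
                  using 6 framed_scal[OF f7] framed_arr[OF f7] by (auto simp: written_syndrome_prog)
                then show "R \<tau>" unfolding R_def using 6 * by (intro result_eq[OF _ _ refl]) auto
              qed simp
            qed
          qed
        qed
      qed
    qed
  qed
qed

section \<open>Size estimates for the parameters of the program\<close>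

lemma root_ceil_bounds:
  fixes x D :: real
  assumes v: "1 \<le> v" and g: "1 \<le> g" and x: "x = real g" and E: "E = root_ceil v (g ^ u)"
  shows "x powr (real u / real v) \<le> real E" "real E \<le> x powr (real u / real v) + 1"
proof -
  have v0: "0 < real v" using v by simp
  have pw: "(real e ^ v) powr (1 / real v) = real e" for e
  proof (cases "e = 0")
    case True
    then show ?thesis using v by simp
  next
    case False
    then have "real e ^ v = real e powr real v" by (simp add: powr_realpow)
    then show ?thesis using v0 False by (simp add: powr_powr)
  qed
  have xg: "(real g ^ u) powr (1 / real v) = x powr (real u / real v)"
    using g by (simp add: x powr_realpow[symmetric] powr_powr)
  have "g ^ u \<le> E ^ v" unfolding E by (rule root_ceil[OF v])
  then have "real (g ^ u) \<le> real (E ^ v)" by (simp only: of_nat_le_iff)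
  then have "(real g ^ u) powr (1 / real v) \<le> (real E ^ v) powr (1 / real v)" by (intro powr_mono2) auto
  then show "x powr (real u / real v) \<le> real E" by (simp only: pw xg)
  show "real E \<le> x powr (real u / real v) + 1"
  proof (cases E)
    case (Suc e)
    then have "e ^ v < g ^ u" using root_ceil_minimal[of e v "g ^ u"] E by simp
    then have "real (e ^ v) \<le> real (g ^ u)" by (simp only: of_nat_le_iff less_imp_le)
    then have "(real e ^ v) powr (1 / real v) \<le> (real g ^ u) powr (1 / real v)" by (intro powr_mono2) auto
    then show ?thesis unfolding pw xg using Suc by simp
  qed simp
qed

lemma clog_upper: "1 \<le> b \<Longrightarrow> 2 ^ clog b \<le> 2 * b"
proof (cases "clog b")
  case (Suc l)
  then have "2 ^ l < b" by (intro clog_minimal) simp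
  then show ?thesis by (simp add: Suc)
qed simp

lemma clog_pos: "2 \<le> b \<Longrightarrow> 1 \<le> clog b"
proof (rule ccontr)
  assume b: "2 \<le> b" and "\<not> 1 \<le> clog b"
  then have "clog b = 0" by simp
  then have "b \<le> 2 ^ 0" using clog[of b] by simp
  then show False using b by simp
qed

lemma poly_bounded_pos_clog: "poly_bounded_pos f \<Longrightarrow> poly_bounded_pos (\<lambda>m k. clog (f m k))"
  by (rule poly_bounded_pos_mono[of f]) (auto simp: clog_le)

text \<open>The exponent is a constant multiple of a logarithm: this is why the block length 2^a,
  and with it the dimension, stays polynomial.\<close>

lemma poly_bounded_pos_power2_clog: "poly_bounded_pos f \<Longrightarrow> poly_bounded_pos (\<lambda>m k. 2 ^ (c * clog (f m k)))"
proof -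
  assume f: "poly_bounded_pos f"
  have "(2::nat) ^ clog b \<le> 2 * b + 1" for b
  proof (cases "b = 0")
    case True
    then show ?thesis using clog_le[of b] by simp
  next
    case False
    then show ?thesis using clog_upper[of b] by simp
  qed
  then have "((2::nat) ^ clog b) ^ c \<le> (2 * b + 1) ^ c" for b by (intro power_mono) auto
  then have "(2::nat) ^ (c * clog b) \<le> (2 * b + 1) ^ c" for b
    by (simp add: power_mult[symmetric] mult.commute)
  then show ?thesis 
    by (rule poly_bounded_pos_mono[of "\<lambda>m k. (2 * f m k + 1) ^ c", rotated]) (intro poly_bounded_pos_intros f)
qed

text \<open>Here \<epsilon> stands for \<gamma>'. It enters the program only through the integers
  \<gamma>, w, c and the exponent program, fixed independently of m and k; so p is the only real
  number that may have to be queried at run time.\<close>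

lemma locally_dense_program:
  fixes p \<epsilon> \<alpha> :: real and \<gamma> :: nat
  assumes p: "1 \<le> p" and \<epsilon>: "0 < \<epsilon>" "\<epsilon> \<le> 1 / 2" and \<gamma>: "12 / \<epsilon> \<le> real \<gamma>"
    and \<alpha>: "\<alpha> = (1 / 2 + \<epsilon> - 2 / real \<gamma> powr p) powr (1 / p)"
  shows "\<exists>(c :: com) T m' n'. poly_bounded T \<and> poly_bounded m' \<and> poly_bounded n' \<and> (p \<in> \<rat> \<longrightarrow> oracle_free c) \<and>
    (\<forall>m k. 1 \<le> m \<and> 1 \<le> k \<longrightarrow> halts_within (dyadic_approx p) c (T m k) m k \<and>
      success_prob (dyadic_approx p) c (T m k) m k (locally_dense p \<alpha> (\<gamma> * k)
        ((2 * real m * (1 + real \<gamma> * real k)) powr (3 * (real \<gamma> * real k) powr p)) (m' m k) (n' m k)) \<ge> 0.99)"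
proof -
  obtain ex num den C0 where ex: "p \<in> \<rat> \<longrightarrow> oracle_free ex" "scalars_written ex \<subseteq> {''u'', ''v''}"
      "arrays_written ex = {}" "flip_free ex"
    and exL: "\<And>L. 1 \<le> den L \<and> den L \<le> C0 * 2 ^ L \<and> num L \<le> C0 * 2 ^ L \<and> p \<le> real (num L) / real (den L) \<and>
      (\<forall>x::real. 1 \<le> x \<and> x \<le> 2 ^ L \<longrightarrow> x powr (real (num L) / real (den L)) \<le> (1 + \<epsilon> / 12) * x powr p) \<and>
      (\<forall>\<sigma>. scal \<sigma> ''L'' = int L \<and> scal \<sigma> ''x'' = 2 ^ L \<longrightarrow>
        runs (dyadic_approx p) ex \<sigma> (C0 * 2 ^ L) (\<lambda>\<tau>. scal \<tau> ''u'' = int (num L) \<and> scal \<tau> ''v'' = int (den L)))"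
    using exponent_program[OF p, of "\<epsilon> / 12"] \<epsilon>(1) by auto
  define w where "w = nat \<lceil>2 / \<epsilon>\<rceil>"
  \<comment> \<open>An integer exponent above p turns bounds by real powers into polynomial
    ones.\<close>
  define P where "P = nat \<lceil>p\<rceil>"
  have pP: "p \<le> real P" unfolding P_def by (rule real_nat_ceiling_ge)
  obtain c where c: "8 \<le> c" "\<And>L h. 1 \<le> L \<Longrightarrow> h \<le> 2 ^ (P * L) \<Longrightarrow> (4 * w + 1) * c * L * h + 2 \<le> (2::nat) ^ (c * L)"
    using growth_constant[of P w] by blast
  define b where "b m k = 2 * m * (1 + \<gamma> * k)" for m k :: nat
  define L where "L m k = clog (b m k)" for m k
  define E where "E m k = root_ceil (den (L m k)) ((\<gamma> * k) ^ num (L m k))" for m k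
  define K where "K m k = E m k div 2 + 1" for m k
  define h where "h m k = K m k + K m k div w" for m k
  define a where "a m k = 4 * w * c * L m k" for m k
  define n where "n m k = h m k * 2 ^ a m k" for m k
  define q where "q m k = next_prime (n m k)" for m k
  define prog where "prog = lattice_prog \<gamma> w (4 * w * c) ex"
  define time where "time m k = log_time \<gamma> m k + (C0 * 2 ^ L m k + (root_time (\<gamma> * k) (num (L m k)) (den (L m k)) (E m k) +
      (dim_time w (4 * w * c) (E m k) (L m k) (K m k) (a m k) (n m k) + (prime_time (q m k) +
      (matrix_time (n m k + K m k) (\<gamma> * k) (q m k) +
       syndrome_time (n m k) (K m k) (q m k) (\<gamma> * k + 1) (h m k) (a m k))))))" for m k
  have \<gamma>24: "24 \<le> real \<gamma>"
  proof -
    have "24 \<le> 12 / \<epsilon>" using \<epsilon> by (simp add: field_simps)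
    then show ?thesis using \<gamma> by linarith
  qed
  define D where "D k = (real \<gamma> * real k) powr p" for k :: nat
  have x24: "24 \<le> real \<gamma> * real k" and x\<gamma>: "real \<gamma> \<le> real \<gamma> * real k" if "1 \<le> k" for k
  proof -
    show g: "real \<gamma> \<le> real \<gamma> * real k" using that mult_left_mono[of 1 "real k" "real \<gamma>"] by simp
    then show "24 \<le> real \<gamma> * real k" using \<gamma>24 by linarith
  qed
  have Dx: "real \<gamma> * real k \<le> D k" if "1 \<le> k" for k
  proof -
    have "(real \<gamma> * real k) powr 1 \<le> (real \<gamma> * real k) powr p" using x24[OF that] p by (intro powr_mono) auto
    then show ?thesis using x24[OF that] by (simp add: D_def)
  qed
  have xL: "real \<gamma> * real k \<le> 2 ^ L m k" and b50: "50 \<le> real (b m k)" and bL: "real (b m k) \<le> 2 ^ L m k"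
    and L1: "1 \<le> L m k" if mk: "1 \<le> m" "1 \<le> k" for m k
  proof -
    define X where "X = real \<gamma> * real k"
    have X24: "24 \<le> X" using x24[OF mk(2)] by (simp add: X_def)
    have "real (b m k) = 2 * real m * (1 + X)" by (simp add: b_def X_def algebra_simps)
    moreover have "2 * 1 * (1 + X) \<le> 2 * real m * (1 + X)"
      using mk X24 by (intro mult_right_mono) auto
    ultimately have bb: "2 * (1 + X) \<le> real (b m k)" by simp
    have "2 * (1 + 24) \<le> 2 * (1 + X)" using X24 by simp
    then have "2 * (1 + 24) \<le> real (b m k)" using bb by (rule order_trans)
    then show b50: "50 \<le> real (b m k)" by simp
    have "real (b m k) \<le> real (2 ^ L m k)" unfolding L_def using clog by (simp only: of_nat_le_iff)
    then show bL: "real (b m k) \<le> 2 ^ L m k" by (simp only: of_nat_power of_nat_numeral)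
    have "X \<le> 2 * (1 + X)" using X24 by simp
    then show "real \<gamma> * real k \<le> 2 ^ L m k" using bb bL unfolding X_def[symmetric] by (meson order_trans)
    show "1 \<le> L m k" unfolding L_def using b50 by (intro clog_pos) simp
  qed
  have Eb: "D k \<le> real (E m k)" "real (E m k) \<le> (1 + \<epsilon> / 12) * D k + 1" if mk: "1 \<le> m" "1 \<le> k" for m k
  proof -
    define x where "x = real (\<gamma> * k)"
    have x: "x = real \<gamma> * real k" by (simp add: x_def)
    have g1: "1 \<le> \<gamma> * k" using x24[OF mk(2)] x x_def by linarith
    have "x powr p \<le> x powr (real (num (L m k)) / real (den (L m k)))"
      using exL[of "L m k"] x24[OF mk(2)] unfolding x by (intro powr_mono) auto
    also have "\<dots> \<le> real (E m k)"
      using exL[of "L m k"] g1 by (intro root_ceil_bounds(1)[OF _ _ x_def]) (auto simp: E_def)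
    finally show "D k \<le> real (E m k)" by (simp add: D_def x)
    have "real (E m k) \<le> x powr (real (num (L m k)) / real (den (L m k))) + 1"
      using exL[of "L m k"] g1 by (intro root_ceil_bounds(2)[OF _ _ x_def]) (auto simp: E_def)
    also have "x powr (real (num (L m k)) / real (den (L m k))) \<le> (1 + \<epsilon> / 12) * x powr p"
      using exL[of "L m k"] x24[OF mk(2)] xL[OF mk] unfolding x by auto
    finally show "real (E m k) \<le> (1 + \<epsilon> / 12) * D k + 1" by (simp add: D_def x)
  qed
  have par: "D k < 2 * real (K m k)" "real (h m k) \<le> (1 / 2 + 5 * \<epsilon> / 6) * D k" "1 \<le> w"
      "K m k \<le> 2 * (w * (K m k div w))" if mk: "1 \<le> m" "1 \<le> k" for m k
  proof -
    have "12 / \<epsilon> \<le> D k" using \<gamma> x\<gamma>[OF mk(2)] Dx[OF mk(2)] by linarith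
    from parameter_bounds[OF \<epsilon> this Eb[OF mk] w_def K_def h_def]
    show "D k < 2 * real (K m k)" "real (h m k) \<le> (1 / 2 + 5 * \<epsilon> / 6) * D k" "1 \<le> w"
      "K m k \<le> 2 * (w * (K m k div w))" by auto
  qed
  have q_le: "q m k \<le> 2 ^ ((4 * w + 1) * c * L m k)" if mk: "1 \<le> m" "1 \<le> k" for m k
  proof -
    have "real (h m k) \<le> 1 * D k"
      using par(2)[OF mk] mult_right_mono[of "1 / 2 + 5 * \<epsilon> / 6" 1 "D k"] \<epsilon> by (simp add: D_def)
    also have "\<dots> \<le> (2 ^ L m k) powr p" unfolding D_def using xL[OF mk] p by (simp add: powr_mono2)
    also have "\<dots> \<le> (2 ^ L m k) powr real P" using pP by (intro powr_mono) auto
    also have "\<dots> = (2 ^ L m k) ^ P" by (simp add: powr_realpow)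
    also have "\<dots> = 2 ^ (P * L m k)" by (simp add: power_mult[symmetric] mult.commute)
    finally have "real (h m k) \<le> real (2 ^ (P * L m k))" by simp
    then have "h m k \<le> 2 ^ (P * L m k)" by (simp only: of_nat_le_iff)
    from next_prime_bound[OF c(2)[OF L1[OF mk] this]] show ?thesis
      by (simp add: q_def n_def a_def)
  qed
  have poly_bounded_pos_b: "poly_bounded_pos b" unfolding b_def by (intro poly_bounded_pos_intros)
  have poly_bounded_pos_L: "poly_bounded_pos L" unfolding L_def using poly_bounded_pos_b by (rule poly_bounded_pos_clog)
  have poly_bounded_pos_2L: "poly_bounded_pos (\<lambda>m k. 2 ^ (e * L m k))" for e unfolding L_def using poly_bounded_pos_b by (rule poly_bounded_pos_power2_clog)
  have poly_bounded_pos_2L1: "poly_bounded_pos (\<lambda>m k. 2 ^ L m k)" using poly_bounded_pos_2L[of 1] by simp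
  have poly_bounded_pos_num: "poly_bounded_pos (\<lambda>m k. num (L m k))" and poly_bounded_pos_den: "poly_bounded_pos (\<lambda>m k. den (L m k))"
    by (rule poly_bounded_pos_mono[of "\<lambda>m k. C0 * 2 ^ L m k"]; use exL in \<open>auto intro!: poly_bounded_pos_intros poly_bounded_pos_2L1\<close>)+
  have poly_bounded_pos_E: "poly_bounded_pos E"
  proof (rule poly_bounded_pos_mono[of "\<lambda>m k. 2 * (\<gamma> * k) ^ P + 1"])
    fix m k :: nat assume mk: "1 \<le> m" "1 \<le> k"
    have "D k \<le> (real \<gamma> * real k) powr real P"
      unfolding D_def using x24[OF mk(2)] pP by (intro powr_mono) auto
    also have "\<dots> = (real \<gamma> * real k) ^ P" using x24[OF mk(2)] by (intro powr_realpow) linarith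
    finally have DP: "D k \<le> (real \<gamma> * real k) ^ P" .
    have "(1 + \<epsilon> / 12) * D k \<le> 2 * D k" using \<epsilon> by (intro mult_right_mono) (auto simp: D_def)
    then have "real (E m k) \<le> 2 * (real \<gamma> * real k) ^ P + 1" using Eb(2)[OF mk] DP by linarith
    then have "real (E m k) \<le> real (2 * (\<gamma> * k) ^ P + 1)" by simp
    then show "E m k \<le> 2 * (\<gamma> * k) ^ P + 1" by (simp only: of_nat_le_iff)
  qed (intro poly_bounded_pos_intros)
  have poly_bounded_pos_K: "poly_bounded_pos K"
    by (rule poly_bounded_pos_mono[of "\<lambda>m k. E m k + 1"]) (intro poly_bounded_pos_intros poly_bounded_pos_E, simp add: K_def)
  have poly_bounded_pos_h: "poly_bounded_pos h"
    by (rule poly_bounded_pos_mono[of "\<lambda>m k. 2 * K m k"]) (intro poly_bounded_pos_intros poly_bounded_pos_K, simp add: h_def mult_2)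
  have poly_bounded_pos_a: "poly_bounded_pos a" unfolding a_def by (intro poly_bounded_pos_intros poly_bounded_pos_L)
  have poly_bounded_pos_2a: "poly_bounded_pos (\<lambda>m k. 2 ^ a m k)" unfolding a_def by (rule poly_bounded_pos_2L)
  have poly_bounded_pos_n: "poly_bounded_pos n" unfolding n_def by (intro poly_bounded_pos_intros poly_bounded_pos_h poly_bounded_pos_2a)
  have poly_bounded_pos_q: "poly_bounded_pos q" by (rule poly_bounded_pos_mono[OF poly_bounded_pos_2L q_le])
  note poly_facts = poly_bounded_pos_intros poly_bounded_pos_L poly_bounded_pos_2L1 poly_bounded_pos_num poly_bounded_pos_den poly_bounded_pos_E poly_bounded_pos_K poly_bounded_pos_h poly_bounded_pos_a poly_bounded_pos_2a poly_bounded_pos_n poly_bounded_pos_q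
  have "poly_bounded_pos time"
    unfolding time_def log_time_def root_time_def dim_time_def prime_time_def matrix_time_def syndrome_time_def
      bits_time_def power_time_def Let_def by (intro poly_facts)
  \<comment> \<open>With a h added, T is at least the number of coins that are read, so the program
    never runs out of them.\<close>
  then have "poly_bounded_pos (\<lambda>m k. time m k + a m k * h m k)" by (intro poly_bounded_pos_add poly_bounded_pos_mult poly_bounded_pos_a poly_bounded_pos_h)
  then obtain C where C: "\<And>m k. 1 \<le> m \<Longrightarrow> 1 \<le> k \<Longrightarrow> time m k + a m k * h m k \<le> C * (m + k + 1) ^ C"
    unfolding poly_bounded_pos_def by blast
  define T where "T m k = C * (m + k + 1) ^ C" for m k :: nat
  have "poly_bounded_pos (\<lambda>m k. n m k + K m k)" by (intro poly_facts)
  then obtain C' where C': "\<And>m k. 1 \<le> m \<Longrightarrow> 1 \<le> k \<Longrightarrow> n m k + K m k \<le> C' * (m + k + 1) ^ C'"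
    unfolding poly_bounded_pos_def by blast
  \<comment> \<open>The value 0 at nonpositive arguments makes the polynomial bound hold
    everywhere.\<close>
  define z where "z m k = (if 1 \<le> m \<and> 1 \<le> k then n m k + K m k else 0)" for m k
  have run: "runs (dyadic_approx p) prog (start m k \<omega>) (T m k) (\<lambda>\<tau>. result \<tau> =
      (code_mat (n m k) (K m k) (q m k) (int (\<gamma> * k + 1)),
       syndrome_vec (n m k) (K m k) (q m k) (int (\<gamma> * k + 1)) (h m k) (position (a m k) \<omega>)))"
    if mk: "1 \<le> m" "1 \<le> k" and \<omega>: "length \<omega> = T m k" for m k \<omega>
  proof -
    have len: "a m k * h m k \<le> length \<omega>" and le: "time m k \<le> T m k" using C[OF mk] \<omega> by (simp_all add: T_def)
    have "runs (dyadic_approx p) prog (start m k \<omega>) (time m k) (\<lambda>\<tau>. result \<tau> =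
      (code_mat (n m k) (K m k) (q m k) (int (\<gamma> * k + 1)),
       syndrome_vec (n m k) (K m k) (q m k) (int (\<gamma> * k + 1)) (h m k) (position (a m k) \<omega>)))"
      unfolding time_def prog_def using exL[of "L m k"]
      by (intro runs_lattice_prog[OF mk ex(2-4) _ _ _ refl _ _ _ _ _ _ len])
        (auto simp: L_def b_def E_def K_def h_def a_def n_def q_def)
    then show ?thesis by (rule runs_mono) (use le in auto)
  qed
  have prob: "measure_pmf.prob (coin_strings (T m k)) {\<omega>. locally_dense p \<alpha> (\<gamma> * k)
      ((2 * real m * (1 + real \<gamma> * real k)) powr (3 * (real \<gamma> * real k) powr p)) (z m k) (z m k)
      (code_mat (n m k) (K m k) (q m k) (int (\<gamma> * k + 1)),
       syndrome_vec (n m k) (K m k) (q m k) (int (\<gamma> * k + 1)) (h m k) (position (a m k) \<omega>))} \<ge> 0.99"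
    if mk: "1 \<le> m" "1 \<le> k" for m k
  proof -
    define A where "A = 1 / 2 + \<epsilon> - 2 / real \<gamma> powr p"
    have g1: "real \<gamma> \<le> real \<gamma> powr p"
    proof -
      have "real \<gamma> powr 1 \<le> real \<gamma> powr p" using \<gamma>24 p by (intro powr_mono) auto
      then show ?thesis using \<gamma>24 by simp
    qed
    \<comment> \<open>Here \<gamma> \<ge> 12/\<epsilon> gives 2/\<gamma> \<le> \<epsilon>/6, just
      what the bound (1/2 + 5\<epsilon>/6) D on h leaves over.\<close>
    have "2 / real \<gamma> powr p \<le> 2 / real \<gamma>" using g1 \<gamma>24 by (intro divide_left_mono) auto
    also have "\<dots> \<le> \<epsilon> / 6" using \<gamma> \<gamma>24 \<epsilon> by (simp add: field_simps)
    finally have A_lo: "1 / 2 + 5 * \<epsilon> / 6 \<le> A" by (simp add: A_def)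
    have "0 < 2 / real \<gamma> powr p" using \<gamma>24 by simp
    then have A_hi: "A < 1" using \<epsilon> unfolding A_def by linarith
    have A0: "0 < A" using A_lo \<epsilon> by linarith
    have \<alpha>A: "\<alpha> = A powr (1 / p)" by (simp add: \<alpha> A_def)
    have \<alpha>0: "0 < \<alpha>" using A0 by (simp add: \<alpha>A)
    have \<alpha>1: "\<alpha> < 1"
      using powr_less_mono2[of "1 / p" A 1] A0 A_hi p by (simp add: \<alpha>A)
    have d: "real (\<gamma> * k) powr p = D k" by (simp add: D_def)
    have "(\<alpha> * real (\<gamma> * k)) powr p = \<alpha> powr p * D k"
      unfolding d[symmetric] by (rule powr_mult)
    also have "\<alpha> powr p = A" using A0 p by (simp add: \<alpha>A powr_powr)
    finally have R: "(\<alpha> * real (\<gamma> * k)) powr p = A * D k" .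
    have hR: "real (h m k) \<le> (\<alpha> * real (\<gamma> * k)) powr p"
      unfolding R using par(2)[OF mk] mult_right_mono[OF A_lo, of "D k"] by (simp add: D_def)
    have np: "n m k < q m k" "prime (q m k)" using next_prime[of "n m k"] by (auto simp: q_def)
    have w1: "1 \<le> w" using par(3)[OF mk] .
    \<comment> \<open>Blocks have at least two positions, so n \<ge> 2h \<ge> 2K, and q > n yields
      the condition \<open>2 * K \<le> q\<close>.\<close>
    have "1 * 1 \<le> (4 * w * c) * L m k" using w1 c(1) L1[OF mk] by (intro mult_le_mono) auto
    then have "2 ^ 1 \<le> (2::nat) ^ a m k" unfolding a_def by (intro power_increasing) auto
    then have "K m k * 2 \<le> n m k" unfolding n_def h_def by (intro mult_le_mono) auto
    then have Kq: "2 * K m k \<le> q m k" using np(1) by linarith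
    have K1: "1 \<le> K m k" by (simp add: K_def)
    have D24: "24 \<le> D k" using x24[OF mk(2)] Dx[OF mk(2)] by linarith
    have bb: "real (b m k) = 2 * real m * (1 + real \<gamma> * real k)" by (simp add: b_def algebra_simps)
    have N0: "0 < (2 * real m * (1 + real \<gamma> * real k)) powr (3 * (real \<gamma> * real k) powr p)"
      unfolding bb[symmetric] using b50[OF mk] by simp
    have cnt: "100 * (real (q m k) ^ K m k * real (b m k) powr (3 * D k)) \<le> 2 ^ (4 * w * c * L m k * h m k)"
      by (rule counting_bound[OF D24 par(1)[OF mk] _ bL[OF mk] L1[OF mk] c(1) par(4)[OF mk] h_def q_le[OF mk]])
        (use b50[OF mk] in linarith)
    have T: "a m k * h m k \<le> T m k" using C[OF mk] by (simp add: T_def)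
    have zz: "z m k = n m k + K m k" using mk by (simp add: z_def)
    have d0: "0 < \<gamma> * k" using \<gamma>24 mk(2) by (cases \<gamma>) auto
    show ?thesis
      unfolding zz n_def
      by (rule code_mat_locally_dense_prob[OF p \<alpha>0 \<alpha>1 d0 _ _ np(2) _ Kq K1 hR N0 _ T])
        (use par(1)[OF mk] np(1) cnt in \<open>simp_all add: d n_def a_def bb D_def del: of_nat_mult\<close>)
  qed
  show ?thesis
  proof (rule exI[of _ prog], rule exI[of _ T], rule exI[of _ z], rule exI[of _ z],
      intro conjI allI impI; (elim conjE)?)
    show "poly_bounded T" unfolding poly_bounded_def T_def by (intro exI[of _ C]) simp
    show "poly_bounded z" "poly_bounded z"
      unfolding poly_bounded_def z_def by (intro exI[of _ C']; use C' in auto)+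
    show "p \<in> \<rat> \<Longrightarrow> oracle_free prog" unfolding prog_def oracle_free_lattice_prog using ex(1) by simp
    fix m k :: nat assume mk: "1 \<le> m" "1 \<le> k"
    show "halts_within (dyadic_approx p) prog (T m k) m k"
      unfolding halts_within_def using run[OF mk] unfolding runs_def by blast
    define good where "good = locally_dense p \<alpha> (\<gamma> * k)
      ((2 * real m * (1 + real \<gamma> * real k)) powr (3 * (real \<gamma> * real k) powr p)) (z m k) (z m k)"
    define out where "out \<omega> = (code_mat (n m k) (K m k) (q m k) (int (\<gamma> * k + 1)),
       syndrome_vec (n m k) (K m k) (q m k) (int (\<gamma> * k + 1)) (h m k) (position (a m k) \<omega>))" for \<omega>
    have fin: "finite {\<omega> :: bool list. length \<omega> = T m k}"
      using finite_lists_length_eq[of "UNIV :: bool set"] by simp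
    have ne: "{\<omega> :: bool list. length \<omega> = T m k} \<noteq> {}" using Ex_list_of_length by blast
    have supp: "set_pmf (coin_strings (T m k)) = {\<omega>. length \<omega> = T m k}"
      unfolding coin_strings_def using set_pmf_of_set[OF ne fin] .
    have "0.99 \<le> measure_pmf.prob (coin_strings (T m k)) {\<omega>. good (out \<omega>)}"
      using prob[OF mk] by (simp add: good_def out_def)
    \<comment> \<open>Runs are controlled only for strings of length T, so the event is first cut
      down to the support.\<close>
    also have "\<dots> = measure_pmf.prob (coin_strings (T m k)) ({\<omega>. good (out \<omega>)} \<inter> set_pmf (coin_strings (T m k)))"
      by (rule measure_Int_set_pmf[symmetric])
    also have "\<dots> \<le> measure_pmf.prob (coin_strings (T m k))
        {\<omega>. \<exists>t \<tau>. exec (dyadic_approx p) prog (start m k \<omega>) t \<tau> \<and> good (result \<tau>)}"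
    proof (rule measure_pmf.finite_measure_mono)
      show "{\<omega>. good (out \<omega>)} \<inter> set_pmf (coin_strings (T m k))
        \<subseteq> {\<omega>. \<exists>t \<tau>. exec (dyadic_approx p) prog (start m k \<omega>) t \<tau> \<and> good (result \<tau>)}"
      proof
        fix \<omega> assume "\<omega> \<in> {\<omega>. good (out \<omega>)} \<inter> set_pmf (coin_strings (T m k))"
        then have "good (out \<omega>)" "length \<omega> = T m k" by (auto simp: supp)
        then show "\<omega> \<in> {\<omega>. \<exists>t \<tau>. exec (dyadic_approx p) prog (start m k \<omega>) t \<tau> \<and> good (result \<tau>)}"
          using run[OF mk] unfolding runs_def out_def[symmetric] by (metis (mono_tags, lifting) mem_Collect_eq)
      qed
    qed simp
    finally show "0.99 \<le> success_prob (dyadic_approx p) prog (T m k) m k (locally_dense p \<alpha> (\<gamma> * k)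
        ((2 * real m * (1 + real \<gamma> * real k)) powr (3 * (real \<gamma> * real k) powr p)) (z m k) (z m k))"
      unfolding success_prob_def good_def .
  qed
qed

text \<open>The two exponents differ by 2D, and B^(2D) \<ge> 50^4 exceeds 10^5.\<close>

lemma dimension_bound_amplified:
  fixes B D :: real
  assumes "50 \<le> B" "24 \<le> D"
  shows "10 ^ 5 * B powr D \<le> B powr (3 * D)"
proof -
  have "(10::real) ^ 5 \<le> 50 ^ 4" by simp
  also have "\<dots> = 50 powr 4" by (simp add: powr_realpow[symmetric])
  also have "\<dots> \<le> B powr (2 * D)"
  proof -
    have "50 powr 4 \<le> B powr 4" using assms by (intro powr_mono2) auto
    also have "\<dots> \<le> B powr (2 * D)" using assms by (intro powr_mono) auto
    finally show ?thesis .
  qed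
  finally have "10 ^ 5 * B powr D \<le> B powr (2 * D) * B powr D" by (intro mult_right_mono) auto
  also have "\<dots> = B powr (3 * D)" by (simp add: powr_add[symmetric])
  finally show ?thesis .
qed

text \<open>The threshold m0 is quantified before \<gamma>', so that it depends on p alone, while
  the program may depend on p and \<gamma>'. The oracle stands for the digits of a real constant p,
  which a finite program cannot contain in general; a rational p is written into the
  program.\<close>

theorem theorem4p3:
  fixes p :: real
  assumes "1 \<le> p"
  shows "\<exists>m0 :: nat. \<forall>\<gamma>' :: real. 1 \<le> \<gamma>' \<and> \<gamma>' < 2 powr (1 / p) \<longrightarrow>
    (let \<epsilon> = \<gamma>' powr (- p) - 1 / 2;
         \<gamma> = nat \<lceil>max (12 / \<epsilon>) (1 / ((1 + \<epsilon> / 2) powr (1 / p) - 1))\<rceil>;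
         \<alpha> = (1 / \<gamma>' powr p - 2 / real \<gamma> powr p) powr (1 / p);
         d = (\<lambda>k. \<gamma> * k);
         B = (\<lambda>m k. 2 * real m * (1 + real \<gamma> * real k));
         N = (\<lambda>m k. B m k powr (3 * (real \<gamma> * real k) powr p))
     in 0 < \<epsilon> \<and>
        (\<exists>(c :: com) T m' n'.
           poly_bounded T \<and> poly_bounded m' \<and> poly_bounded n' \<and>
           (p \<in> \<rat> \<longrightarrow> oracle_free c) \<and>
           (\<forall>m k. 1 \<le> m \<and> 1 \<le> k \<longrightarrow>
              halts_within (dyadic_approx p) c (T m k) m k \<and>
              (m0 \<le> m \<longrightarrow>
                 N m k \<ge> 10 ^ 5 * B m k powr ((real \<gamma> * real k) powr p) \<and>
                 success_prob (dyadic_approx p) c (T m k) m k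
                   (locally_dense p \<alpha> (d k) (N m k) (m' m k) (n' m k)) \<ge> 0.99))))"
proof (intro exI[of _ 1] allI impI)
  \<comment> \<open>The witness 1 for m0 works since \<epsilon> \<le> 1/2 forces \<gamma> \<ge> 24,
    whence B \<ge> 50 and D \<ge> 24 for all positive m and k.\<close>
  fix \<gamma>' :: real assume \<gamma>': "1 \<le> \<gamma>' \<and> \<gamma>' < 2 powr (1 / p)"
  define \<epsilon> where "\<epsilon> = \<gamma>' powr (- p) - 1 / 2"
  define \<gamma> where "\<gamma> = nat \<lceil>max (12 / \<epsilon>) (1 / ((1 + \<epsilon> / 2) powr (1 / p) - 1))\<rceil>"
  define \<alpha> where "\<alpha> = (1 / \<gamma>' powr p - 2 / real \<gamma> powr p) powr (1 / p)"
  have "\<gamma>' powr p < (2 powr (1 / p)) powr p" using \<gamma>' assms by (intro powr_less_mono2) auto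
  also have "\<dots> = 2" using assms by (simp add: powr_powr)
  finally have hi: "\<gamma>' powr p < 2" .
  have lo: "1 \<le> \<gamma>' powr p" using \<gamma>' assms by (intro ge_one_powr_ge_zero) auto
  have inv: "\<gamma>' powr (- p) = 1 / \<gamma>' powr p" by (simp add: powr_minus divide_inverse)
  have \<epsilon>: "0 < \<epsilon>" "\<epsilon> \<le> 1 / 2"
  proof -
    define y where "y = \<gamma>' powr p"
    have "y < 2" "1 \<le> y" using hi lo unfolding y_def by auto
    moreover from this have "0 < y" by linarith
    ultimately show "0 < \<epsilon>" "\<epsilon> \<le> 1 / 2" unfolding \<epsilon>_def inv y_def[symmetric] by (simp_all add: field_simps)
  qed
  have "max (12 / \<epsilon>) (1 / ((1 + \<epsilon> / 2) powr (1 / p) - 1)) \<le> real \<gamma>"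
    unfolding \<gamma>_def by (rule real_nat_ceiling_ge)
  then have \<gamma>: "12 / \<epsilon> \<le> real \<gamma>" by simp
  have "1 / \<gamma>' powr p = 1 / 2 + \<epsilon>" unfolding \<epsilon>_def inv by simp
  then have \<alpha>: "\<alpha> = (1 / 2 + \<epsilon> - 2 / real \<gamma> powr p) powr (1 / p)" unfolding \<alpha>_def by simp
  obtain c T m' n' where c: "poly_bounded T" "poly_bounded m'" "poly_bounded n'" "p \<in> \<rat> \<longrightarrow> oracle_free c"
    and run: "\<forall>m k. 1 \<le> m \<and> 1 \<le> k \<longrightarrow> halts_within (dyadic_approx p) c (T m k) m k \<and>
      success_prob (dyadic_approx p) c (T m k) m k (locally_dense p \<alpha> (\<gamma> * k)
        ((2 * real m * (1 + real \<gamma> * real k)) powr (3 * (real \<gamma> * real k) powr p)) (m' m k) (n' m k)) \<ge> 0.99"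
    using locally_dense_program[OF assms \<epsilon> \<gamma> \<alpha>] by blast
  have N: "10 ^ 5 * (2 * real m * (1 + real \<gamma> * real k)) powr ((real \<gamma> * real k) powr p)
      \<le> (2 * real m * (1 + real \<gamma> * real k)) powr (3 * (real \<gamma> * real k) powr p)" if mk: "1 \<le> m" "1 \<le> k" for m k :: nat
  proof (rule dimension_bound_amplified)
    define X where "X = real \<gamma> * real k"
    have "24 \<le> 12 / \<epsilon>" using \<epsilon> by (simp add: field_simps)
    then have "24 \<le> real \<gamma>" using \<gamma> by linarith
    then have X: "24 \<le> X" using mk(2) mult_mono[of 24 "real \<gamma>" 1 "real k"] by (simp add: X_def)
    have "50 \<le> 2 * 1 * (1 + X)" using X by simp
    also have "\<dots> \<le> 2 * real m * (1 + X)" using mk X by (intro mult_right_mono) auto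
    finally show "50 \<le> 2 * real m * (1 + real \<gamma> * real k)" by (simp only: X_def)
    have "X powr 1 \<le> X powr p" using X assms by (intro powr_mono) auto
    then show "24 \<le> (real \<gamma> * real k) powr p" using X unfolding X_def[symmetric] by simp
  qed
  show "let \<epsilon> = \<gamma>' powr (- p) - 1 / 2;
         \<gamma> = nat \<lceil>max (12 / \<epsilon>) (1 / ((1 + \<epsilon> / 2) powr (1 / p) - 1))\<rceil>;
         \<alpha> = (1 / \<gamma>' powr p - 2 / real \<gamma> powr p) powr (1 / p);
         d = (\<lambda>k. \<gamma> * k);
         B = (\<lambda>m k. 2 * real m * (1 + real \<gamma> * real k));
         N = (\<lambda>m k. B m k powr (3 * (real \<gamma> * real k) powr p))
     in 0 < \<epsilon> \<and>
        (\<exists>(c :: com) T m' n'.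
           poly_bounded T \<and> poly_bounded m' \<and> poly_bounded n' \<and>
           (p \<in> \<rat> \<longrightarrow> oracle_free c) \<and>
           (\<forall>m k. 1 \<le> m \<and> 1 \<le> k \<longrightarrow>
              halts_within (dyadic_approx p) c (T m k) m k \<and>
              (1 \<le> m \<longrightarrow>
                 N m k \<ge> 10 ^ 5 * B m k powr ((real \<gamma> * real k) powr p) \<and>
                 success_prob (dyadic_approx p) c (T m k) m k
                   (locally_dense p \<alpha> (d k) (N m k) (m' m k) (n' m k)) \<ge> 0.99)))"
    unfolding Let_def \<epsilon>_def[symmetric] \<gamma>_def[symmetric] \<alpha>_def[symmetric]
    by (rule conjI[OF \<epsilon>(1)], rule exI[of _ c], rule exI[of _ T], rule exI[of _ m'], rule exI[of _ n'])
      (use run N c in auto)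
qed

end
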